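(* Let $n=5$ and let $J$ be a matroidal ideal of degree $3$ in $R=K[x_1,\dots,x_5]$ with $\gcd(J)=1$. Then $J$ is sequentially Cohen-Macaulay (SCM) if and only if there is a permutation $y_1,\dots,y_5$ of the variables $x_1,\dots,x_5$ such that $$J=y_1y_2\mathfrak{p}+y_1J_1+y_2J_2+J_3,$$ where $\mathfrak{p}=(y_3,y_4,y_5)$, $J_1$ and $J_2$ are SCM matroidal ideals of degree $2$ with $\operatorname{supp}(J_1)=\operatorname{supp}(J_2)=\{y_3,y_4,y_5\}$, $J_3$ is the (possibly zero) ideal generated by the elements of $G(J)$ divisible by neither $y_1$ nor $y_2$, $J_3\subseteq J_1\cap J_2$, and one of the following holds: (a) $\gcd(J_1)=1$ and $\gcd(J_2)=1$; or (b) $\gcd(J_1)=y_3=\gcd(J_2)$ and $J_3=0$.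
   Context: $K$ is a field; polynomial rings have the standard grading. For a monomial ideal $I$, $G(I)$ is its unique minimal set of monomial generators, $\gcd(I)$ is the greatest common divisor of the elements of $G(I)$, and $\operatorname{supp}(I)$ is the set of variables dividing some element of $G(I)$. A monomial ideal $I$ generated in one degree is polymatroidal if for all $u,v\in G(I)$ and every $i$ with $\deg_{x_i}(v)<\deg_{x_i}(u)$ there is $j$ with $\deg_{x_j}(u)<\deg_{x_j}(v)$ and $x_j(u/x_i)\in G(I)$; it is matroidal if moreover it is generated by square-free monomials. Standing assumption: the given matroidal ideal of $R$ is fully supported, i.e. $\operatorname{supp}(J)=\{x_1,\dots,x_5\}$. Ideals of polynomial subrings of $R$ are identified with their extensions to $R$. A graded module $M$ is sequentially Cohen-Macaulay if there is a finite filtration by graded submodules $0=M_0\subset M_1\subset\dots\subset M_r=M$ with each $M_i/M_{i-1}$ Cohen-Macaulay and $\dim(M_1/M_0)<\dots<\dim(M_r/M_{r-1})$; an ideal $I\subset R$ is called SCM if $R/I$ is sequentially Cohen-Macaulay. *)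

theory Defs
  imports
    "HOL-Algebra.QuotRing"
    "HOL-Algebra.Module"
    "HOL-Algebra.Algebraic_Closure_Type"
    "HOL-Library.Poly_Mapping"
    "HOL-Library.Extended_Nat"
    "HOL-Library.Numeral_Type"
begin

section \<open>Modules over a commutative ring\<close>

definition ring_module :: "('a, 'm) ring_scheme \<Rightarrow> ('a, 'a) module" where
  "ring_module R =
    \<lparr>carrier = carrier R, monoid.mult = monoid.mult R, monoid.one = monoid.one R,
     zero = zero R, add = add R, module.smult = monoid.mult R\<rparr>"

text \<open>
  The quotient \<open>M/N\<close>, with cosets as elements, as for \<^const>\<open>FactRing\<close>.  The record type of modules
  inherits the fields \<^const>\<open>monoid.mult\<close> and \<^const>\<open>monoid.one\<close> from rings;
  they play no role for modules and are left unspecified.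
\<close>

definition quot_module :: "('a, 'b) module \<Rightarrow> 'b set \<Rightarrow> ('a, 'b set) module" where
  "quot_module M N =
    \<lparr>carrier = a_rcosets\<^bsub>M\<^esub> N, monoid.mult = undefined, monoid.one = undefined,
     zero = N, add = set_add M,
     module.smult = (\<lambda>a C. \<Union>x\<in>C. N +>\<^bsub>M\<^esub> (a \<odot>\<^bsub>M\<^esub> x))\<rparr>"

abbreviation sub_module :: "('a, 'b) module \<Rightarrow> 'b set \<Rightarrow> ('a, 'b) module" where
  "sub_module M N \<equiv> M\<lparr>carrier := N\<rparr>"

definition gen_submodule :: "('a, 'm) ring_scheme \<Rightarrow> ('a, 'b) module \<Rightarrow> 'b set \<Rightarrow> 'b set" where
  "gen_submodule R M S = \<Inter>{N. submodule N R M \<and> S \<subseteq> N}"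

text \<open>The submodule \<open>(A)M\<close> of \<open>M\<close>, for a set \<open>A\<close> of ring elements.\<close>

definition set_smult :: "('a, 'm) ring_scheme \<Rightarrow> 'a set \<Rightarrow> ('a, 'b) module \<Rightarrow> 'b set" where
  "set_smult R A M = gen_submodule R M {a \<odot>\<^bsub>M\<^esub> x | a x. a \<in> A \<and> x \<in> carrier M}"

definition annihilator :: "('a, 'm) ring_scheme \<Rightarrow> ('a, 'b) module \<Rightarrow> 'a set" where
  "annihilator R M = {a \<in> carrier R. \<forall>x\<in>carrier M. a \<odot>\<^bsub>M\<^esub> x = \<zero>\<^bsub>M\<^esub>}"

section \<open>Dimension, depth and Cohen--Macaulay modules\<close>

definition krull_dim :: "('a, 'm) ring_scheme \<Rightarrow> enat" where
  "krull_dim R = Sup {enat k | k. \<exists>P :: nat \<Rightarrow> 'a set.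
     (\<forall>i\<le>k. primeideal (P i) R) \<and> (\<forall>i<k. P i \<subset> P (Suc i))}"

text \<open>
  \<open>dim M = dim (R/Ann M)\<close>.  The zero module gets dimension 0 rather than \<open>-\<infinity>\<close>; below, only nonzero
  modules matter.
\<close>

definition module_dim :: "('a, 'm) ring_scheme \<Rightarrow> ('a, 'b) module \<Rightarrow> enat" where
  "module_dim R M = krull_dim (R Quot annihilator R M)"

definition module_nonzerodivisor :: "('a, 'b) module \<Rightarrow> 'a \<Rightarrow> bool" where
  "module_nonzerodivisor M a \<longleftrightarrow> (\<forall>x\<in>carrier M. a \<odot>\<^bsub>M\<^esub> x = \<zero>\<^bsub>M\<^esub> \<longrightarrow> x = \<zero>\<^bsub>M\<^esub>)"

definition regular_sequence :: "('a, 'm) ring_scheme \<Rightarrow> ('a, 'b) module \<Rightarrow> 'a list \<Rightarrow> bool" where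
  "regular_sequence R M as \<longleftrightarrow> set as \<subseteq> carrier R \<and>
     (\<forall>i<length as.
        module_nonzerodivisor (quot_module M (set_smult R (set (take i as)) M)) (as ! i)) \<and>
     set_smult R (set as) M \<noteq> carrier M"

text \<open>
  For the polynomial ring, \<open>m\<close> is the graded maximal ideal, and depth and the Cohen--Macaulay
  property of a finitely generated graded module refer to regular sequences in \<open>m\<close>.
\<close>

definition module_depth :: "('a, 'm) ring_scheme \<Rightarrow> 'a set \<Rightarrow> ('a, 'b) module \<Rightarrow> enat" where
  "module_depth R m M = Sup {enat (length as) | as. set as \<subseteq> m \<and> regular_sequence R M as}"

definition cohen_macaulay :: "('a, 'm) ring_scheme \<Rightarrow> 'a set \<Rightarrow> ('a, 'b) module \<Rightarrow> bool" where
  "cohen_macaulay R m M \<longleftrightarrow>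
     carrier M = {\<zero>\<^bsub>M\<^esub>} \<or> module_depth R m M = module_dim R M"

text \<open>A grading of \<open>M\<close> is given by its family \<open>D\<close> of homogeneous components.\<close>

definition graded_submodule ::
  "('a, 'm) ring_scheme \<Rightarrow> ('a, 'b) module \<Rightarrow> (int \<Rightarrow> 'b set) \<Rightarrow> 'b set \<Rightarrow> bool" where
  "graded_submodule R M D N \<longleftrightarrow> submodule N R M \<and>
     (\<forall>x\<in>N. \<exists>F c. finite F \<and> (\<forall>d\<in>F. c d \<in> N \<inter> D d) \<and> x = finsum M c F)"

definition sequentially_CM ::
  "('a, 'm) ring_scheme \<Rightarrow> 'a set \<Rightarrow> ('a, 'b) module \<Rightarrow> (int \<Rightarrow> 'b set) \<Rightarrow> bool" where
  "sequentially_CM R m M D \<longleftrightarrow> (\<exists>r (N :: nat \<Rightarrow> 'b set).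
     N 0 = {\<zero>\<^bsub>M\<^esub>} \<and> N r = carrier M \<and>
     (\<forall>i\<le>r. graded_submodule R M D (N i)) \<and>
     (\<forall>i<r. N i \<subset> N (Suc i)) \<and>
     (\<forall>i<r. cohen_macaulay R m (quot_module (sub_module M (N (Suc i))) (N i))) \<and>
     (\<forall>i j. i < j \<and> j < r \<longrightarrow>
        module_dim R (quot_module (sub_module M (N (Suc i))) (N i))
        < module_dim R (quot_module (sub_module M (N (Suc j))) (N j))))"

section \<open>Polynomial rings\<close>

text \<open>
  A polynomial over the field \<open>'k\<close> in the variables \<open>'v\<close> is a finitely supported function from
  exponent vectors to coefficients; multiplication is convolution.
\<close>

type_synonym 'v mpol_exp = "'v \<Rightarrow>\<^sub>0 nat"
type_synonym ('v, 'k) mpol = "'v mpol_exp \<Rightarrow>\<^sub>0 'k"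

abbreviation mpol_ring :: "('v, 'k::field) mpol ring" where
  "mpol_ring \<equiv> ring_of_type_algebra"

definition monomial :: "'v mpol_exp \<Rightarrow> ('v, 'k::field) mpol" where
  "monomial u = Poly_Mapping.single u 1"

definition pvar :: "'v \<Rightarrow> ('v, 'k::field) mpol" where
  "pvar i = monomial (Poly_Mapping.single i 1)"

definition mdeg :: "'v::finite mpol_exp \<Rightarrow> nat" where
  "mdeg u = (\<Sum>i\<in>UNIV. Poly_Mapping.lookup u i)"

definition homogeneous_component :: "int \<Rightarrow> ('v::finite, 'k::field) mpol set" where
  "homogeneous_component d = {f. \<forall>u\<in>Poly_Mapping.keys f. int (mdeg u) = d}"

definition graded_max_ideal :: "('v, 'k::field) mpol set" where
  "graded_max_ideal = Idl\<^bsub>mpol_ring\<^esub> (range pvar)"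

text \<open>The ideal \<open>I\<close> is called SCM if \<open>R/I\<close> is, with the grading induced from \<open>R\<close>.\<close>

definition SCM_ideal :: "('v::finite, 'k::field) mpol set \<Rightarrow> bool" where
  "SCM_ideal I \<longleftrightarrow>
     sequentially_CM mpol_ring graded_max_ideal (quot_module (ring_module mpol_ring) I)
       (\<lambda>d. (\<lambda>f. I +>\<^bsub>mpol_ring\<^esub> f) ` homogeneous_component d)"

section \<open>Monomial ideals\<close>

text \<open>Monomials are represented by their exponent vectors.\<close>

definition monomial_ideal :: "('v, 'k::field) mpol set \<Rightarrow> bool" where
  "monomial_ideal I \<longleftrightarrow> (\<exists>S. I = Idl\<^bsub>mpol_ring\<^esub> (monomial ` S))"

definition min_gens :: "('v, 'k::field) mpol set \<Rightarrow> 'v mpol_exp set" where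
  "min_gens I = (THE S. Idl\<^bsub>mpol_ring\<^esub> (monomial ` S) = I \<and>
     (\<forall>T. T \<subset> S \<longrightarrow> Idl\<^bsub>mpol_ring\<^esub> (monomial ` T) \<noteq> I))"

text \<open>
  The monomial that is a greatest common divisor, in the polynomial ring, of the minimal generators;
  meaningful for nonzero \<open>I\<close> only.
\<close>

definition ideal_gcd :: "('v, 'k::field) mpol set \<Rightarrow> ('v, 'k) mpol" where
  "ideal_gcd I = (THE g. g \<in> range monomial \<and> (\<forall>u\<in>min_gens I. g dvd monomial u) \<and>
     (\<forall>h. (\<forall>u\<in>min_gens I. h dvd monomial u) \<longrightarrow> h dvd g))"

definition ideal_supp :: "('v, 'k::field) mpol set \<Rightarrow> 'v set" where
  "ideal_supp I = {i. \<exists>u\<in>min_gens I. (pvar i :: ('v, 'k) mpol) dvd monomial u}"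

text \<open>
  The exponent vector \<open>u - single i 1 + single j 1\<close> stands for \<open>x\<^sub>j(u/x\<^sub>i)\<close>; the truncated subtraction
  is harmless since \<open>x\<^sub>i\<close> divides \<open>u\<close> here.
\<close>

definition polymatroidal :: "nat \<Rightarrow> ('v::finite, 'k::field) mpol set \<Rightarrow> bool" where
  "polymatroidal d I \<longleftrightarrow> monomial_ideal I \<and> (\<forall>u\<in>min_gens I. mdeg u = d) \<and>
     (\<forall>u\<in>min_gens I. \<forall>v\<in>min_gens I. \<forall>i. Poly_Mapping.lookup v i < Poly_Mapping.lookup u i \<longrightarrow>
        (\<exists>j. Poly_Mapping.lookup u j < Poly_Mapping.lookup v j \<and>
             u - Poly_Mapping.single i 1 + Poly_Mapping.single j 1 \<in> min_gens I))"

definition matroidal :: "nat \<Rightarrow> ('v::finite, 'k::field) mpol set \<Rightarrow> bool" where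
  "matroidal d I \<longleftrightarrow> polymatroidal d I \<and> (\<forall>u\<in>min_gens I. \<forall>i. Poly_Mapping.lookup u i \<le> 1)"

end

theory Submission
  imports Defs
begin

text \<open>
  The bases of a rank three matroid on five elements without loops or coloops are the complements of
  the pairs that are independent in the dual matroid, whose parallel classes partition the variables.
  The ideal is sequentially Cohen--Macaulay exactly when at most one of these classes is nontrivial.
  No class has more than three elements, and the cases where the largest class has one, two or three
  elements and all others are trivial are the ideals described by the decomposition.

  If there is at most one nontrivial class, let \<open>I\<close> be generated by the products of all but one
  variable of the largest class, so that \<open>I = R\<close> if all classes are trivial.  Then \<open>J \<subset> I \<subseteq> R\<close> is the
  required filtration: \<open>I/J\<close> and \<open>R/I\<close> are shellable relative Stanley--Reisner modules, of dimensions
  two and three.  If there are two disjoint parallel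
  pairs, the top quotient \<open>R/L\<close> of any filtration has \<open>J \<subseteq> L \<subseteq> P \<inter> Q\<close> for two three-dimensional
  coordinate primes whose subspaces meet only in a line, and such a quotient has depth at most two.

  Upper bounds for dimension and depth come from one argument: \<open>d + 1\<close> elements are algebraically
  dependent modulo an ideal whose faces have at most \<open>d\<close> elements, and the lexicographically smallest
  term of such a relation excludes both a chain of primes and a regular sequence of length \<open>d + 1\<close>.
\<close>

section \<open>Ideals of a ring type\<close>

text \<open>Three things are arbitrary and shape the proof: the field may be finite, so linear
  systems of parameters need not exist; the ideals of a filtration need not be monomial; the
  elements of a regular sequence need not be homogeneous. Depth is therefore bounded by computing
  with elements. The reason behind that computation is local cohomology. For two disjoint pairs put
  \<open>N = P + Q\<close>; then \<open>R/N = K[t]\<close>, and \<open>H^1(K[t])\<close> embeds in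
  \<open>H^2(R/(P \<inter> Q))\<close>, since \<open>R/P\<close> and \<open>R/Q\<close> have depth
  three. The obstruction to lifting it to \<open>H^2(R/L)\<close> lies in
  \<open>H^3((P \<inter> Q)/L)\<close>, which \<open>t\<close> kills, because \<open>t\<close> times
  \<open>P \<inter> Q\<close> lies in \<open>J\<close>. But \<open>t\<close> acts surjectively on
  \<open>H^1(K[t])\<close>, so everything lifts and \<open>H^2(R/L)\<close> is nonzero. All
  subquotients of \<open>R/J\<close> are handled as pairs of ideals, so that exact sequences become
  identities between ideals.\<close>

abbreviation type_ring :: "'r::comm_ring_1 ring" where
  "type_ring \<equiv> ring_of_type_algebra"

abbreviation tideal :: "'r::comm_ring_1 set \<Rightarrow> bool" where
  "tideal I \<equiv> ideal I type_ring"

lemma type_ring_simps [simp]: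
  "carrier (type_ring :: 'r::comm_ring_1 ring) = UNIV"
  "monoid.mult (type_ring :: 'r ring) = (*)"
  "add (type_ring :: 'r ring) = (+)"
  "one (type_ring :: 'r ring) = 1"
  "zero (type_ring :: 'r ring) = 0"
  by (simp_all add: ring_of_type_algebra_def)

lemma type_ring_a_inv [simp]: "a_inv type_ring x = - (x :: 'r::comm_ring_1)"
proof -
  interpret cring "type_ring :: 'r ring" ..
  show ?thesis using minus_equality[of "- x" x] by simp
qed

lemma tideal_iff:
  "tideal (I :: 'r::comm_ring_1 set) \<longleftrightarrow>
    0 \<in> I \<and> (\<forall>x\<in>I. \<forall>y\<in>I. x + y \<in> I) \<and> (\<forall>r. \<forall>x\<in>I. r * x \<in> I)"
proof
  assume I: "tideal I"
  interpret ideal I "type_ring :: 'r ring" by fact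
  show "0 \<in> I \<and> (\<forall>x\<in>I. \<forall>y\<in>I. x + y \<in> I) \<and> (\<forall>r. \<forall>x\<in>I. r * x \<in> I)"
    using additive_subgroup.zero_closed[OF is_additive_subgroup]
      additive_subgroup.a_closed[OF is_additive_subgroup] I_l_closed by simp
next
  assume I: "0 \<in> I \<and> (\<forall>x\<in>I. \<forall>y\<in>I. x + y \<in> I) \<and> (\<forall>r. \<forall>x\<in>I. r * x \<in> I)"
  interpret cring "type_ring :: 'r ring" ..
  show "tideal I"
  proof (rule idealI)
    show "subgroup I (add_monoid (type_ring :: 'r ring))"
    proof (rule add.subgroupI)
      fix a assume "a \<in> I"
      then have "(- 1) * a \<in> I" using I by blast
      then show "\<ominus>\<^bsub>type_ring\<^esub> a \<in> I" by simp
    qed (use I in auto)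
  next
    fix a x assume "a \<in> I"
    then have "x * a \<in> I" using I by blast
    then show "x \<otimes>\<^bsub>type_ring\<^esub> a \<in> I" "a \<otimes>\<^bsub>type_ring\<^esub> x \<in> I"
      by (simp_all add: mult.commute)
  qed (rule ring_axioms)
qed

lemma tideal_0: "tideal I \<Longrightarrow> 0 \<in> I"
  and tideal_add: "tideal I \<Longrightarrow> x \<in> I \<Longrightarrow> y \<in> I \<Longrightarrow> x + y \<in> I"
  and tideal_mult: "tideal I \<Longrightarrow> x \<in> I \<Longrightarrow> r * x \<in> I"
  by (auto simp: tideal_iff)

lemma tideal_mult2: "tideal I \<Longrightarrow> x \<in> I \<Longrightarrow> x * r \<in> I"
  by (metis tideal_mult mult.commute)

lemma tideal_uminus: "tideal I \<Longrightarrow> x \<in> I \<Longrightarrow> - x \<in> I"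
  by (metis tideal_mult mult_minus1)

lemma tideal_diff: "tideal I \<Longrightarrow> x \<in> I \<Longrightarrow> y \<in> I \<Longrightarrow> x - y \<in> I"
  by (metis tideal_add tideal_uminus uminus_add_conv_diff add.commute)

lemmas tidealD = tideal_0 tideal_add tideal_mult tideal_mult2 tideal_uminus tideal_diff

lemma tideal_add_cancel: "tideal I \<Longrightarrow> x \<in> I \<Longrightarrow> x + y \<in> I \<longleftrightarrow> y \<in> I"
  by (metis add_diff_cancel_left' tideal_add tideal_diff)

lemma tideal_sum: "tideal I \<Longrightarrow> (\<And>a. a \<in> A \<Longrightarrow> f a \<in> I) \<Longrightarrow> sum f A \<in> I"
  by (induction A rule: infinite_finite_induct) (auto intro: tidealD)

lemma tideal_eq_UNIV: "tideal I \<Longrightarrow> 1 \<in> I \<Longrightarrow> I = UNIV"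
  by (metis UNIV_eq_I mult.right_neutral tideal_mult)

lemma tideal_UNIV: "tideal UNIV"
  by (simp add: tideal_iff)

definition tprime :: "'r::comm_ring_1 set \<Rightarrow> bool" where
  "tprime P \<longleftrightarrow> tideal P \<and> 1 \<notin> P \<and> (\<forall>a b. a * b \<in> P \<longrightarrow> a \<in> P \<or> b \<in> P)"

lemma tprime_iff: "primeideal P type_ring \<longleftrightarrow> tprime (P :: 'r::comm_ring_1 set)"
proof
  assume "primeideal P (type_ring :: 'r ring)"
  then interpret primeideal P "type_ring :: 'r ring" .
  show "tprime P"
    using I_notcarr I_prime is_ideal tideal_eq_UNIV unfolding tprime_def by auto
next
  assume P: "tprime P"
  interpret cring "type_ring :: 'r ring" ..
  show "primeideal P (type_ring :: 'r ring)"
    by (rule primeidealI) (use P is_cring in \<open>auto simp: tprime_def\<close>)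
qed

lemma tprime_tideal: "tprime P \<Longrightarrow> tideal P"
  by (simp add: tprime_def)

lemma tprime_mult: "tprime P \<Longrightarrow> a * b \<in> P \<longleftrightarrow> a \<in> P \<or> b \<in> P"
  by (auto simp: tprime_def intro: tidealD)

lemma tprime_power: "tprime P \<Longrightarrow> a ^ n \<in> P \<Longrightarrow> a \<in> P"
  by (induction n) (auto simp: tprime_mult, simp add: tprime_def)

text \<open>The annihilator of the module \<open>L/K\<close>, to which the dimension of a filtration
  factor refers.\<close>

definition colon :: "'r::comm_ring_1 set \<Rightarrow> 'r set \<Rightarrow> 'r set" where
  "colon K L = {r. \<forall>x\<in>L. r * x \<in> K}"

lemma tideal_colon: "tideal K \<Longrightarrow> tideal (colon K L)"
  by (auto simp: tideal_iff colon_def distrib_right mult.assoc)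

text \<open>For the module \<open>M = L/K\<close> this is the ideal with
  \<open>M/aM = L/(aL + K)\<close>; a regular sequence can thus be followed inside the ring, with
  \<open>L\<close> fixed and \<open>K\<close> growing.\<close>

definition ideal_step :: "'r::comm_ring_1 \<Rightarrow> 'r set \<Rightarrow> 'r set \<Rightarrow> 'r set" where
  "ideal_step a L K = {a * x + y |x y. x \<in> L \<and> y \<in> K}"

lemma ideal_stepI: "x \<in> L \<Longrightarrow> y \<in> K \<Longrightarrow> a * x + y \<in> ideal_step a L K"
  by (auto simp: ideal_step_def)

lemma ideal_stepE:
  assumes "z \<in> ideal_step a L K"
  obtains x y where "z = a * x + y" "x \<in> L" "y \<in> K"
  using assms by (auto simp: ideal_step_def)

lemma tideal_ideal_step:
  assumes "tideal L" "tideal K"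
  shows "tideal (ideal_step a L K)"
  unfolding tideal_iff
proof (intro conjI ballI allI)
  show "0 \<in> ideal_step a L K"
    using ideal_stepI[OF tideal_0 tideal_0, OF assms, of a] by simp
next
  fix x y assume "x \<in> ideal_step a L K" "y \<in> ideal_step a L K"
  then obtain p q r s where *: "x = a * p + q" "y = a * r + s" "p \<in> L" "r \<in> L" "q \<in> K" "s \<in> K"
    by (elim ideal_stepE) blast
  then have "x + y = a * (p + r) + (q + s)" by (simp add: algebra_simps)
  then show "x + y \<in> ideal_step a L K"
    by (metis * assms ideal_stepI tideal_add)
next
  fix r x assume "x \<in> ideal_step a L K"
  then obtain p q where *: "x = a * p + q" "p \<in> L" "q \<in> K"
    by (elim ideal_stepE)
  then have "r * x = a * (r * p) + r * q" by (simp add: algebra_simps)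
  then show "r * x \<in> ideal_step a L K"
    by (metis * assms ideal_stepI tideal_mult)
qed

lemma ideal_step_superset: "tideal L \<Longrightarrow> K \<subseteq> ideal_step a L K"
  using ideal_stepI[OF tideal_0, of L _ K a] by auto

lemma ideal_step_mult: "tideal K \<Longrightarrow> x \<in> L \<Longrightarrow> a * x \<in> ideal_step a L K"
  using ideal_stepI[OF _ tideal_0, of x L K a] by auto

lemma ideal_step_subset: "tideal L \<Longrightarrow> K \<subseteq> L \<Longrightarrow> ideal_step a L K \<subseteq> L"
  by (auto elim!: ideal_stepE intro!: tideal_add tideal_mult)

text \<open>Recursive in the ideal \<open>K\<close>, which suits inductions over exact sequences;
  that the final quotient is nonzero is demanded separately, where depth is defined.\<close>

fun weakly_regular :: "'r::comm_ring_1 list \<Rightarrow> 'r set \<Rightarrow> 'r set \<Rightarrow> bool" where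
  "weakly_regular [] L K \<longleftrightarrow> True"
| "weakly_regular (a # as) L K \<longleftrightarrow>
     (\<forall>x\<in>L. a * x \<in> K \<longrightarrow> x \<in> K) \<and> weakly_regular as L (ideal_step a L K)"

fun ideal_steps :: "'r::comm_ring_1 list \<Rightarrow> 'r set \<Rightarrow> 'r set \<Rightarrow> 'r set" where
  "ideal_steps [] L K = K"
| "ideal_steps (a # as) L K = ideal_steps as L (ideal_step a L K)"

lemma tideal_ideal_steps: "tideal L \<Longrightarrow> tideal K \<Longrightarrow> tideal (ideal_steps as L K)"
  by (induction as arbitrary: K) (auto simp: tideal_ideal_step)

lemma ideal_steps_subset: "tideal L \<Longrightarrow> K \<subseteq> L \<Longrightarrow> ideal_steps as L K \<subseteq> L"
  by (induction as arbitrary: K) (auto simp: ideal_step_subset)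

lemma ideal_steps_superset: "tideal L \<Longrightarrow> K \<subseteq> ideal_steps as L K"
  by (induction as arbitrary: K) (auto dest: ideal_step_superset)

lemma ideal_steps_mult:
  "tideal L \<Longrightarrow> tideal K \<Longrightarrow> a \<in> set as \<Longrightarrow> x \<in> L \<Longrightarrow> a * x \<in> ideal_steps as L K"
proof (induction as arbitrary: K)
  case (Cons b as)
  then show ?case
    by (metis ideal_step_mult ideal_steps.simps(2) ideal_steps_superset set_ConsD subset_iff
        tideal_ideal_step)
qed simp

lemma ideal_steps_least:
  assumes "tideal Z" "K \<subseteq> Z" "\<And>a x. a \<in> set as \<Longrightarrow> x \<in> L \<Longrightarrow> a * x \<in> Z"
  shows "ideal_steps as L K \<subseteq> Z"
  using assms
proof (induction as arbitrary: K)
  case (Cons b as)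
  have "ideal_step b L K \<subseteq> Z"
    using Cons.prems by (auto elim!: ideal_stepE intro!: tideal_add)
  then show ?case using Cons by simp
qed simp

lemma weakly_regular_nth:
  "weakly_regular as L K \<longleftrightarrow>
    (\<forall>i<length as. \<forall>x\<in>L. as ! i * x \<in> ideal_steps (take i as) L K \<longrightarrow>
      x \<in> ideal_steps (take i as) L K)"
proof (induction as arbitrary: K)
  case (Cons a as)
  show ?case
    unfolding weakly_regular.simps Cons.IH by (auto simp: less_Suc_eq_0_disj)
qed simp

lemma weakly_regular_append:
  "weakly_regular (as @ bs) L K \<longleftrightarrow>
    weakly_regular as L K \<and> weakly_regular bs L (ideal_steps as L K)"
  by (induction as arbitrary: K) auto

section \<open>Modules presented as quotients of ideals\<close>

text \<open>The map \<open>\<phi>\<close> induces an isomorphism from \<open>L / K\<close> to \<open>M\<close>.\<close>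

definition presents ::
  "('r::comm_ring_1 \<Rightarrow> 'b) \<Rightarrow> ('r, 'b) module \<Rightarrow> 'r set \<Rightarrow> 'r set \<Rightarrow> bool" where
  "presents \<phi> M L K \<longleftrightarrow> tideal L \<and> tideal K \<and> K \<subseteq> L \<and> carrier M = \<phi> ` L \<and> \<zero>\<^bsub>M\<^esub> = \<phi> 0 \<and>
     (\<forall>f\<in>L. \<phi> f = \<zero>\<^bsub>M\<^esub> \<longleftrightarrow> f \<in> K) \<and>
     (\<forall>f\<in>L. \<forall>g\<in>L. \<phi> (f + g) = \<phi> f \<oplus>\<^bsub>M\<^esub> \<phi> g) \<and>
     (\<forall>r. \<forall>f\<in>L. \<phi> (r * f) = r \<odot>\<^bsub>M\<^esub> \<phi> f)"

context
  fixes \<phi> :: "'r::comm_ring_1 \<Rightarrow> 'b" and M L K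
  assumes pres: "presents \<phi> M L K"
begin

lemma presentsD:
  "tideal L" "tideal K" "K \<subseteq> L" "carrier M = \<phi> ` L" "\<zero>\<^bsub>M\<^esub> = \<phi> 0"
  "f \<in> L \<Longrightarrow> \<phi> f = \<phi> 0 \<longleftrightarrow> f \<in> K"
  "f \<in> L \<Longrightarrow> g \<in> L \<Longrightarrow> \<phi> f \<oplus>\<^bsub>M\<^esub> \<phi> g = \<phi> (f + g)"
  "f \<in> L \<Longrightarrow> r \<odot>\<^bsub>M\<^esub> \<phi> f = \<phi> (r * f)"
  using pres by (auto simp: presents_def)

lemma presents_closed:
  "0 \<in> L" "f \<in> L \<Longrightarrow> g \<in> L \<Longrightarrow> f + g \<in> L" "f \<in> L \<Longrightarrow> r * f \<in> L" "f \<in> L \<Longrightarrow> - f \<in> L"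
  "f \<in> K \<Longrightarrow> f \<in> L"
  using presentsD(1,3) by (auto intro: tideal_0 tideal_add tideal_mult tideal_uminus)

lemma presents_eq_iff:
  assumes f: "f \<in> L" and g: "g \<in> L"
  shows "\<phi> f = \<phi> g \<longleftrightarrow> f - g \<in> K"
proof
  assume eq: "\<phi> f = \<phi> g"
  have mg: "- g \<in> L" using g presentsD(1) by (rule tideal_uminus[rotated])
  \<comment> \<open>Only sums and multiples are known to be respected, so
    \<open>\<phi> (- g)\<close> is added on both sides in place of a subtraction in
    \<open>M\<close>.\<close>
  have "\<phi> (f + - g) = \<phi> (g + - g)"
    using presentsD(7)[OF f mg] presentsD(7)[OF g mg] eq by simp
  then show "f - g \<in> K"
    using presentsD(6)[of "f - g"] tideal_diff[OF presentsD(1) f g] by simp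
next
  assume "f - g \<in> K"
  then have fg: "\<phi> (f - g) = \<phi> 0" "f - g \<in> L" using presentsD(3,6) by auto
  have "\<phi> f = \<phi> (f - g) \<oplus>\<^bsub>M\<^esub> \<phi> g" using presentsD(7)[OF fg(2) g] by simp
  also have "\<dots> = \<phi> 0 \<oplus>\<^bsub>M\<^esub> \<phi> g" by (simp only: fg)
  also have "\<dots> = \<phi> g" using presentsD(7)[OF tideal_0[OF presentsD(1)] g] by simp
  finally show "\<phi> f = \<phi> g" .
qed

text \<open>No module axiom is assumed of \<open>M\<close>: all of them are carried over from
  \<open>L\<close> along the additive surjection \<open>\<phi>\<close>.\<close>

lemma presents_module: "module type_ring M"
proof (rule moduleI)
  show "cring (type_ring :: 'r ring)" ..
  show "abelian_group M"
  proof (rule abelian_groupI)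
    fix x assume "x \<in> carrier M"
    then obtain f where f: "x = \<phi> f" "f \<in> L" using presentsD(4) by auto
    then show "\<exists>y\<in>carrier M. y \<oplus>\<^bsub>M\<^esub> x = \<zero>\<^bsub>M\<^esub>"
      using f presents_closed(4) presentsD(4,5,7)
      by (intro bexI[of _ "\<phi> (- f)"]) simp_all
  qed (auto simp: presentsD(4,5,7) presents_closed ac_simps)
qed (auto simp: presentsD(4,7,8) presents_closed algebra_simps)

lemma presents_image_iff:
  assumes "K \<subseteq> T" "tideal T" "T \<subseteq> L" "f \<in> L"
  shows "\<phi> f \<in> \<phi> ` T \<longleftrightarrow> f \<in> T"
proof
  assume "\<phi> f \<in> \<phi> ` T"
  then obtain g where g: "\<phi> f = \<phi> g" "g \<in> T" by auto
  then have "f - g \<in> T" using presents_eq_iff[of f g] assms by auto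
  then show "f \<in> T" using tideal_add[OF assms(2) _ g(2), of "f - g"] by simp
qed simp

lemma presents_image_subset_iff:
  assumes "K \<subseteq> T" "tideal T" "T \<subseteq> L" "S \<subseteq> L"
  shows "\<phi> ` S \<subseteq> \<phi> ` T \<longleftrightarrow> S \<subseteq> T"
  unfolding image_subset_iff using presents_image_iff[OF assms(1-3)] assms(4) by blast

lemma presents_submodule:
  assumes "K \<subseteq> T" "tideal T" "T \<subseteq> L"
  shows "submodule (\<phi> ` T) type_ring M"
proof -
  interpret module type_ring M by (rule presents_module)
  note T = tideal_add[OF assms(2)] tideal_mult[OF assms(2)] tideal_0[OF assms(2)]
  have inv: "\<ominus>\<^bsub>M\<^esub> \<phi> f = \<phi> (- f)" if "f \<in> L" for f
    by (rule M.minus_equality) (use that in \<open>auto simp: presentsD(4,5,7) presents_closed\<close>)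
  have TL: "f \<in> T \<Longrightarrow> f \<in> L" for f using assms(3) by blast
  show ?thesis
    by (rule submoduleI)
      (use T(3) tideal_uminus[OF assms(2)] in
        \<open>auto simp: presentsD(4,5,7,8) inv T TL presents_closed\<close>)
qed

lemma presents_submodule_vimage:
  assumes N: "submodule N type_ring M"
  defines "T \<equiv> {f \<in> L. \<phi> f \<in> N}"
  shows "K \<subseteq> T" "tideal T" "T \<subseteq> L" "N = \<phi> ` T"
proof -
  interpret module type_ring M by (rule presents_module)
  note NE = submoduleE[OF N]
  have zN: "\<phi> 0 \<in> N"
    using NE(2) submodule.axioms(1)[OF N] subgroup.one_closed presentsD(5) by fastforce
  have "\<phi> f = \<phi> 0" if "f \<in> K" for f using that presentsD(6)[OF presents_closed(5)] by blast
  then show "K \<subseteq> T" using presents_closed(5) zN by (auto simp: T_def)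
  show "T \<subseteq> L" by (auto simp: T_def)
  show "N = \<phi> ` T" using NE(1) presentsD(4) by (auto simp: T_def)
  show "tideal T"
    unfolding tideal_iff T_def using zN NE(4,5)
    by (auto simp: presents_closed simp flip: presentsD(7,8))
qed

lemma presents_sub_module:
  assumes "K \<subseteq> T" "tideal T" "T \<subseteq> L"
  shows "presents \<phi> (sub_module M (\<phi> ` T)) T K"
  unfolding presents_def using presentsD(2,5,6,7,8) assms by (auto simp: subset_iff)

text \<open>Third isomorphism theorem, \<open>(L/K)/(T/K) = L/T\<close>. It keeps every subquotient
  of \<open>R/J\<close> in the form of an ideal modulo an ideal. Equality of cosets is expressed by
  differences of representatives, so the operations on cosets reduce to closure properties of
  \<open>T\<close>.\<close>

lemma presents_quot_module:
  assumes T: "K \<subseteq> T" "tideal T" "T \<subseteq> L"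
  shows "presents (\<lambda>f. \<phi> ` T +>\<^bsub>M\<^esub> \<phi> f) (quot_module M (\<phi> ` T)) L T"
proof -
  have coset: "\<phi> ` T +>\<^bsub>M\<^esub> \<phi> f = {\<phi> (t + f) |t. t \<in> T}" if "f \<in> L" for f
    using that T(3) by (force simp: a_r_coset_def' presentsD(7) subset_iff) 
  have mem: "\<phi> g \<in> \<phi> ` T +>\<^bsub>M\<^esub> \<phi> f \<longleftrightarrow> g - f \<in> T" if fL: "f \<in> L" and gL: "g \<in> L" for f g
  proof
    assume "\<phi> g \<in> \<phi> ` T +>\<^bsub>M\<^esub> \<phi> f"
    then obtain t where t: "\<phi> g = \<phi> (t + f)" "t \<in> T" using coset[OF fL] by auto
    then have "g - (t + f) \<in> T"
      using presents_eq_iff[OF gL, of "t + f"] fL T presents_closed(2)[of t f] by auto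
    then show "g - f \<in> T" using tideal_add[OF T(2) _ t(2), of "g - (t + f)"] by simp
  next
    assume "g - f \<in> T"
    then show "\<phi> g \<in> \<phi> ` T +>\<^bsub>M\<^esub> \<phi> f" using coset[OF fL] by (force intro!: exI[of _ "g - f"])
  qed
  have LT: "\<And>t f. t \<in> T \<Longrightarrow> f \<in> L \<Longrightarrow> t + f \<in> L"
    using T(3) tideal_add[OF presentsD(1)] by blast
  have sub: "\<phi> ` T +>\<^bsub>M\<^esub> \<phi> f \<subseteq> \<phi> ` L" if "f \<in> L" for f
    using coset that LT by auto
  have eq: "\<phi> ` T +>\<^bsub>M\<^esub> \<phi> f = \<phi> ` T +>\<^bsub>M\<^esub> \<phi> g \<longleftrightarrow> f - g \<in> T" if "f \<in> L" "g \<in> L" for f g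
  proof
    assume "\<phi> ` T +>\<^bsub>M\<^esub> \<phi> f = \<phi> ` T +>\<^bsub>M\<^esub> \<phi> g"
    then show "f - g \<in> T" using mem[of f f] mem[of g f] that tideal_0[OF T(2)] by simp
  next
    assume fg: "f - g \<in> T"
    have "h - f \<in> T \<longleftrightarrow> h - g \<in> T" for h
      using tideal_add_cancel[OF T(2) fg, of "h - f"] by simp
    then have "x \<in> \<phi> ` T +>\<^bsub>M\<^esub> \<phi> f \<longleftrightarrow> x \<in> \<phi> ` T +>\<^bsub>M\<^esub> \<phi> g" if "x \<in> \<phi> ` L" for x
      using mem[OF \<open>f \<in> L\<close>] mem[OF \<open>g \<in> L\<close>] that by auto
    then show "\<phi> ` T +>\<^bsub>M\<^esub> \<phi> f = \<phi> ` T +>\<^bsub>M\<^esub> \<phi> g"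
      using sub[OF \<open>f \<in> L\<close>] sub[OF \<open>g \<in> L\<close>] by blast
  qed
  have zero: "\<phi> ` T +>\<^bsub>M\<^esub> \<phi> 0 = \<phi> ` T"
    using coset[OF tideal_0[OF presentsD(1)]] by (auto simp: image_def)
  show ?thesis
    unfolding presents_def
  proof (intro conjI ballI allI)
    show "tideal L" "tideal T" "T \<subseteq> L" using T presentsD by auto
    show "carrier (quot_module M (\<phi> ` T)) = (\<lambda>f. \<phi> ` T +>\<^bsub>M\<^esub> \<phi> f) ` L"
      by (auto simp: quot_module_def A_RCOSETS_def' presentsD(4))
    show "\<zero>\<^bsub>quot_module M (\<phi> ` T)\<^esub> = \<phi> ` T +>\<^bsub>M\<^esub> \<phi> 0"
      by (simp add: quot_module_def zero)
    show "\<phi> ` T +>\<^bsub>M\<^esub> \<phi> f = \<zero>\<^bsub>quot_module M (\<phi> ` T)\<^esub> \<longleftrightarrow> f \<in> T" if "f \<in> L" for f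
      using eq[OF that tideal_0[OF presentsD(1)]] by (simp add: quot_module_def zero)
  next
    fix f g assume fg: "f \<in> L" "g \<in> L"
    have "\<phi> ` T +>\<^bsub>M\<^esub> \<phi> f <+>\<^bsub>M\<^esub> (\<phi> ` T +>\<^bsub>M\<^esub> \<phi> g) =
        {\<phi> (t + f) \<oplus>\<^bsub>M\<^esub> \<phi> (s + g) |t s. t \<in> T \<and> s \<in> T}"
      using coset fg by (auto simp: set_add_def')
    also have "\<dots> = {\<phi> ((t + f) + (s + g)) |t s. t \<in> T \<and> s \<in> T}"
      using presentsD(7)[OF LT LT, OF _ fg(1) _ fg(2)] by (intro Collect_cong) metis
    also have "\<dots> = {\<phi> (t + (f + g)) |t. t \<in> T}"
    proof safe
      fix t s assume "t \<in> T" "s \<in> T"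
      then show "\<exists>u. \<phi> (t + f + (s + g)) = \<phi> (u + (f + g)) \<and> u \<in> T"
        using tideal_add[OF T(2)] by (intro exI[of _ "t + s"]) (auto simp: algebra_simps)
    next
      fix t assume "t \<in> T"
      then show "\<exists>ta s. \<phi> (t + (f + g)) = \<phi> (ta + f + (s + g)) \<and> ta \<in> T \<and> s \<in> T"
        using tideal_0[OF T(2)] by (intro exI[of _ t] exI[of _ 0]) (auto simp: algebra_simps)
    qed
    also have "\<dots> = \<phi> ` T +>\<^bsub>M\<^esub> \<phi> (f + g)"
      using coset fg tideal_add[OF presentsD(1)] by auto
    finally show "\<phi> ` T +>\<^bsub>M\<^esub> \<phi> (f + g) =
        (\<phi> ` T +>\<^bsub>M\<^esub> \<phi> f) \<oplus>\<^bsub>quot_module M (\<phi> ` T)\<^esub> (\<phi> ` T +>\<^bsub>M\<^esub> \<phi> g)"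
      by (simp add: quot_module_def)
  next
    fix r f assume f: "f \<in> L"
    have "\<phi> ` T +>\<^bsub>M\<^esub> (r \<odot>\<^bsub>M\<^esub> x) = \<phi> ` T +>\<^bsub>M\<^esub> \<phi> (r * f)" if x: "x \<in> \<phi> ` T +>\<^bsub>M\<^esub> \<phi> f" for x
    proof -
      obtain t where t: "x = \<phi> (t + f)" "t \<in> T" using x coset[OF f] by auto
      have "r * (t + f) - r * f \<in> T"
        using tideal_mult[OF T(2) t(2), of r] by (simp add: algebra_simps)
      then show ?thesis
        using t LT[OF t(2) f] eq[of "r * (t + f)" "r * f"] f tideal_mult[OF presentsD(1)]
          presentsD(8)[of "t + f" r] by simp
    qed
    moreover have "\<phi> f \<in> \<phi> ` T +>\<^bsub>M\<^esub> \<phi> f" using mem[OF f f] tideal_0[OF T(2)] by simp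
    ultimately have "(\<Union>x\<in>\<phi> ` T +>\<^bsub>M\<^esub> \<phi> f. \<phi> ` T +>\<^bsub>M\<^esub> (r \<odot>\<^bsub>M\<^esub> x)) = \<phi> ` T +>\<^bsub>M\<^esub> \<phi> (r * f)"
      by blast
    then show "\<phi> ` T +>\<^bsub>M\<^esub> \<phi> (r * f) = r \<odot>\<^bsub>quot_module M (\<phi> ` T)\<^esub> (\<phi> ` T +>\<^bsub>M\<^esub> \<phi> f)"
      by (simp add: quot_module_def)
  qed
qed

text \<open>The image of the final ideal contains all products with elements of \<open>as\<close>;
  conversely, any submodule containing these products pulls back to an ideal above \<open>K\<close>
  that absorbs them, and \<open>ideal_steps\<close> is the least such ideal.\<close>

lemma presents_set_smult: "set_smult type_ring (set as) M = \<phi> ` ideal_steps as L K"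
proof -
  interpret module type_ring M by (rule presents_module)
  let ?T = "ideal_steps as L K"
  have T: "K \<subseteq> ?T" "tideal ?T" "?T \<subseteq> L"
    by (rule ideal_steps_superset[OF presentsD(1)] tideal_ideal_steps[OF presentsD(1,2)]
        ideal_steps_subset[OF presentsD(1,3)])+
  have "{a \<odot>\<^bsub>M\<^esub> x |a x. a \<in> set as \<and> x \<in> carrier M} \<subseteq> \<phi> ` ?T"
    using ideal_steps_mult[OF presentsD(1,2)] presentsD(4,8) by auto
  then have 1: "set_smult type_ring (set as) M \<subseteq> \<phi> ` ?T"
    unfolding set_smult_def gen_submodule_def using presents_submodule[OF T] by blast
  have "\<phi> ` ?T \<subseteq> N" if N: "submodule N type_ring M"
    and "{a \<odot>\<^bsub>M\<^esub> x |a x. a \<in> set as \<and> x \<in> carrier M} \<subseteq> N" for N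
  proof -
    let ?Z = "{f \<in> L. \<phi> f \<in> N}"
    note Z = presents_submodule_vimage[OF N]
    have "a * x \<in> ?Z" if ax: "a \<in> set as" "x \<in> L" for a x
    proof -
      have "\<phi> x \<in> carrier M" using ax presentsD(4) by simp
      then have "a \<odot>\<^bsub>M\<^esub> \<phi> x \<in> N" using \<open>_ \<subseteq> N\<close> ax(1) by blast
      then show ?thesis using ax presentsD(8) presents_closed(3) by simp
    qed
    then have "?T \<subseteq> ?Z" using Z by (intro ideal_steps_least) auto
    then show ?thesis by auto
  qed
  then have "\<phi> ` ?T \<subseteq> set_smult type_ring (set as) M"
    unfolding set_smult_def gen_submodule_def by blast
  with 1 show ?thesis by blast
qed

lemma presents_regular_sequence:
  "regular_sequence type_ring M as \<longleftrightarrow> weakly_regular as L K \<and> ideal_steps as L K \<noteq> L"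
proof -
  have T: "K \<subseteq> ideal_steps bs L K" "tideal (ideal_steps bs L K)" "ideal_steps bs L K \<subseteq> L" for bs
    by (rule ideal_steps_superset[OF presentsD(1)] tideal_ideal_steps[OF presentsD(1,2)]
        ideal_steps_subset[OF presentsD(1,3)])+
  have nz: "module_nonzerodivisor (quot_module M (set_smult type_ring (set bs) M)) a \<longleftrightarrow>
      (\<forall>x\<in>L. a * x \<in> ideal_steps bs L K \<longrightarrow> x \<in> ideal_steps bs L K)" for a bs
  proof -
    let ?T = "ideal_steps bs L K"
    note q = presents_quot_module[OF T[of bs]]
    have "(\<phi> ` ?T +>\<^bsub>M\<^esub> \<phi> f = \<zero>\<^bsub>quot_module M (\<phi> ` ?T)\<^esub>) = (f \<in> ?T)" if "f \<in> L" for f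
      using q that by (auto simp: presents_def)
    moreover have "a \<odot>\<^bsub>quot_module M (\<phi> ` ?T)\<^esub> (\<phi> ` ?T +>\<^bsub>M\<^esub> \<phi> f) = \<phi> ` ?T +>\<^bsub>M\<^esub> \<phi> (a * f)"
      if "f \<in> L" for f
      using q that by (auto simp: presents_def)
    moreover have "carrier (quot_module M (\<phi> ` ?T)) = (\<lambda>f. \<phi> ` ?T +>\<^bsub>M\<^esub> \<phi> f) ` L"
      using q by (auto simp: presents_def)
    ultimately show ?thesis
      unfolding module_nonzerodivisor_def presents_set_smult
      using tideal_mult[OF presentsD(1)] by auto
  qed
  have eq: "\<phi> ` ideal_steps as L K = carrier M \<longleftrightarrow> ideal_steps as L K = L"
    using presents_image_subset_iff[OF T, of L as] T(3)[of as] presentsD(4) by auto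
  show ?thesis
    unfolding regular_sequence_def weakly_regular_nth nz unfolding presents_set_smult[of as] eq by simp
qed

lemma presents_annihilator: "annihilator type_ring M = colon K L"
  by (auto simp: annihilator_def colon_def presentsD(4,5,6,8) presents_closed)

lemma presents_zero_iff: "carrier M = {\<zero>\<^bsub>M\<^esub>} \<longleftrightarrow> L = K"
proof -
  have "carrier M = {\<zero>\<^bsub>M\<^esub>} \<longleftrightarrow> (\<forall>f\<in>L. \<phi> f = \<phi> 0)"
    using presents_closed(1) presentsD(4,5) by auto
  then show ?thesis using presentsD(3,6) by auto
qed

lemma presents_finsum:
  assumes "finite F" "\<And>d. d \<in> F \<Longrightarrow> c d \<in> L"
  shows "finsum M (\<lambda>d. \<phi> (c d)) F = \<phi> (\<Sum>d\<in>F. c d)"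
proof -
  interpret module type_ring M by (rule presents_module)
  show ?thesis
    using assms
  proof (induction F)
    case empty
    then show ?case using presentsD(5) by simp
  next
    case (insert d F)
    have "finsum M (\<lambda>d. \<phi> (c d)) (insert d F) = \<phi> (c d) \<oplus>\<^bsub>M\<^esub> finsum M (\<lambda>d. \<phi> (c d)) F"
      using insert presentsD(4) by (intro M.finsum_insert) auto
    then show ?case
      using insert presentsD(7)[of "c d" "\<Sum>d\<in>F. c d"] tideal_sum[OF presentsD(1), of F c] by simp
  qed
qed

end

lemma presents_ring_module: "presents (\<lambda>f. f) (ring_module (type_ring :: 'r::comm_ring_1 ring)) UNIV {0}"
  by (auto simp: presents_def ring_module_def tideal_iff)

section \<open>Krull dimension of a quotient ring through chains of primes above the ideal\<close>

definition prime_chain :: "'r::comm_ring_1 set \<Rightarrow> nat \<Rightarrow> (nat \<Rightarrow> 'r set) \<Rightarrow> bool" where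
  "prime_chain A k P \<longleftrightarrow> (\<forall>i\<le>k. tprime (P i) \<and> A \<subseteq> P i) \<and> (\<forall>i<k. P i \<subset> P (Suc i))"

definition quot_dim :: "'r::comm_ring_1 set \<Rightarrow> enat" where
  "quot_dim A = Sup {enat k |k. \<exists>P. prime_chain A k P}"

text \<open>Primes of the quotient ring correspond to primes above \<open>A\<close>, by preimages in
  one direction and images in the other; strict inclusions survive because an ideal above
  \<open>A\<close> is a union of cosets.\<close>

lemma krull_dim_quot:
  assumes A: "tideal (A :: 'r::comm_ring_1 set)"
  shows "krull_dim (type_ring Quot A) = quot_dim A"
proof -
  interpret A: ideal A "type_ring :: 'r ring" by fact
  interpret R: cring "type_ring :: 'r ring" ..
  let ?Q = "type_ring Quot A"
  let ?h = "\<lambda>r. A +>\<^bsub>type_ring\<^esub> r"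
  have hom: "ring_hom_ring type_ring ?Q ?h" by (rule A.rcos_ring_hom_ring)
  have carr: "carrier ?Q = range ?h"
    by (auto simp: FactRing_def A_RCOSETS_def')
  have cQ: "cring ?Q" by (rule A.quotient_is_cring) (rule R.is_cring)
  have coset: "?h r = {a + r |a. a \<in> A}" for r by (auto simp: a_r_coset_def')
  have eq: "?h r = ?h s \<longleftrightarrow> r - s \<in> A" for r s
  proof
    assume "?h r = ?h s"
    moreover have "r \<in> ?h r" using tideal_0[OF A] by (auto simp: coset)
    ultimately show "r - s \<in> A" by (auto simp: coset)
  next
    assume rs: "r - s \<in> A"
    have "x \<in> ?h r \<longleftrightarrow> x \<in> ?h s" for x
    proof -
      have mem: "x \<in> ?h r \<longleftrightarrow> x - r \<in> A" for r
        by (auto simp: coset intro!: exI[of _ "x - r"])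
      show ?thesis unfolding mem using tideal_add_cancel[OF A rs, of "x - r"] by simp
    qed
    then show "?h r = ?h s" by blast
  qed
  have mult: "?h r \<otimes>\<^bsub>?Q\<^esub> ?h s = ?h (r * s)" for r s
    using ring_hom_mult[OF A.rcos_ring_hom, of r s] by simp
  have im: "?h r \<in> ?h ` P \<longleftrightarrow> r \<in> P" if "tideal P" "A \<subseteq> P" for P r
  proof
    assume "?h r \<in> ?h ` P"
    then obtain s where "s \<in> P" "?h r = ?h s" by blast
    then have "r - s \<in> P" "s \<in> P" using eq that by auto
    then show "r \<in> P" using tideal_add[OF that(1), of "r - s" s] by simp
  qed simp
  have "(\<exists>P. (\<forall>i\<le>k. primeideal (P i) ?Q) \<and> (\<forall>i<k. P i \<subset> P (Suc i))) \<longleftrightarrow>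
      (\<exists>P. prime_chain A k P)" for k
  proof
    assume "\<exists>P. (\<forall>i\<le>k. primeideal (P i) ?Q) \<and> (\<forall>i<k. P i \<subset> P (Suc i))"
    then obtain P where P: "\<And>i. i \<le> k \<Longrightarrow> primeideal (P i) ?Q" "\<And>i. i < k \<Longrightarrow> P i \<subset> P (Suc i)"
      by blast
    define Q where "Q i = {r. ?h r \<in> P i}" for i
    have sub: "P i \<subseteq> range ?h" if "i \<le> k" for i
      using P(1)[OF that] carr
        additive_subgroup.a_subset[OF ideal.axioms(1)[OF primeideal.axioms(1)]] by blast
    have "tprime (Q i)" if "i \<le> k" for i
      using ring_hom_ring.primeideal_vimage[OF hom R.is_cring P(1)[OF that]]
      by (simp add: Q_def flip: tprime_iff)
    moreover have "A \<subseteq> Q i" if "i \<le> k" for i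
    proof
      fix a assume "a \<in> A"
      then have "?h a = ?h 0" using eq by simp
      also have "\<dots> = \<zero>\<^bsub>?Q\<^esub>" by (simp add: FactRing_def coset)
      finally show "a \<in> Q i"
        using additive_subgroup.zero_closed[OF ideal.axioms(1)[OF primeideal.axioms(1)[OF P(1)[OF that]]]]
        by (simp add: Q_def)
    qed
    moreover have "Q i \<subset> Q (Suc i)" if "i < k" for i
      using P(2)[OF that] sub[of "Suc i"] that by (auto simp: Q_def)
    ultimately show "\<exists>P. prime_chain A k P" unfolding prime_chain_def by blast
  next
    assume "\<exists>P. prime_chain A k P"
    then obtain P where P: "\<And>i. i \<le> k \<Longrightarrow> tprime (P i)" "\<And>i. i \<le> k \<Longrightarrow> A \<subseteq> P i"
      "\<And>i. i < k \<Longrightarrow> P i \<subset> P (Suc i)" unfolding prime_chain_def by blast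
    have "primeideal (?h ` P i) ?Q" if i: "i \<le> k" for i
    proof (rule primeidealI)
      have Pi: "tideal (P i)" using P(1) i by (simp add: tprime_def)
      note im = im[OF Pi P(2)[OF i]]
      show "ideal (?h ` P i) ?Q" by (rule ring.ring_ideal_imp_quot_ideal[OF cring.axioms(1)[OF R.is_cring]]) (use A Pi in auto)
      show "cring ?Q" by fact
      show "carrier ?Q \<noteq> ?h ` P i"
        using carr im P(1)[OF i] unfolding tprime_def by (metis rangeI)
      fix x y assume xy: "x \<in> carrier ?Q" "y \<in> carrier ?Q" "x \<otimes>\<^bsub>?Q\<^esub> y \<in> ?h ` P i"
      obtain r where r: "x = ?h r" using xy(1) unfolding carr by (rule imageE)
      obtain s where s: "y = ?h s" using xy(2) unfolding carr by (rule imageE)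
      have "r * s \<in> P i" using xy(3) unfolding r s mult im .
      then show "x \<in> ?h ` P i \<or> y \<in> ?h ` P i"
        unfolding r s im using P(1)[OF i] by (simp add: tprime_mult)
    qed
    moreover have "?h ` P i \<subset> ?h ` P (Suc i)" if i: "i < k" for i
    proof -
      obtain r where r: "r \<in> P (Suc i)" "r \<notin> P i" using P(3)[OF i] by blast
      have "?h r \<notin> ?h ` P i" using im[OF tprime_tideal[OF P(1)] P(2), of i r] i r by simp
      then show ?thesis using r P(3)[OF i] by blast
    qed
    ultimately show "\<exists>P. (\<forall>i\<le>k. primeideal (P i) ?Q) \<and> (\<forall>i<k. P i \<subset> P (Suc i))"
      by (intro exI[of _ "\<lambda>i. ?h ` P i"]) simp
  qed
  then show ?thesis unfolding krull_dim_def quot_dim_def by simp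
qed

section \<open>Depth, the Cohen--Macaulay property and filtrations for pairs of ideals\<close>

definition pair_depth :: "'r::comm_ring_1 set \<Rightarrow> 'r set \<Rightarrow> 'r set \<Rightarrow> enat" where
  "pair_depth m L K =
     Sup {enat (length as) |as. set as \<subseteq> m \<and> weakly_regular as L K \<and> ideal_steps as L K \<noteq> L}"

definition pair_CM :: "'r::comm_ring_1 set \<Rightarrow> 'r set \<Rightarrow> 'r set \<Rightarrow> bool" where
  "pair_CM m L K \<longleftrightarrow> L = K \<or> pair_depth m L K = quot_dim (colon K L)"

lemma presents_module_dim:
  "presents \<phi> M L K \<Longrightarrow> module_dim type_ring M = quot_dim (colon K L)"
  by (simp add: module_dim_def presents_annihilator krull_dim_quot tideal_colon presentsD(2))

lemma presents_cohen_macaulay: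
  "presents \<phi> M L K \<Longrightarrow> cohen_macaulay type_ring m M \<longleftrightarrow> pair_CM m L K"
  unfolding cohen_macaulay_def pair_CM_def module_depth_def pair_depth_def
  by (simp add: presents_module_dim presents_regular_sequence presents_zero_iff)

text \<open>Submodules of \<open>R/J\<close> are replaced by their preimages, ideals above
  \<open>J\<close>. The grading is dealt with outside: it is inherited by the monomial ideals of the
  constructions, while the obstruction is found in an arbitrary chain of ideals.\<close>

definition CM_filtration :: "'r::comm_ring_1 set \<Rightarrow> 'r set \<Rightarrow> nat \<Rightarrow> (nat \<Rightarrow> 'r set) \<Rightarrow> bool" where
  "CM_filtration m J r L \<longleftrightarrow> L 0 = J \<and> L r = UNIV \<and> (\<forall>i\<le>r. tideal (L i)) \<and>
     (\<forall>i<r. L i \<subset> L (Suc i)) \<and> (\<forall>i<r. pair_CM m (L (Suc i)) (L i)) \<and>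
     (\<forall>i j. i < j \<and> j < r \<longrightarrow>
       quot_dim (colon (L i) (L (Suc i))) < quot_dim (colon (L j) (L (Suc j))))"

lemma chain_subset:
  assumes "\<And>i. i < r \<Longrightarrow> L i \<subseteq> L (Suc i)" "i \<le> j" "j \<le> (r::nat)"
  shows "L i \<subseteq> (L j :: 'a set)"
  using assms(2,3)
proof (induction j rule: dec_induct)
  case (step n)
  then show ?case using assms(1)[of n] by auto
qed simp

context
  fixes J :: "'r::comm_ring_1 set"
  assumes J: "tideal J"
begin

abbreviation "ring_mod_ideal \<equiv> quot_module (ring_module type_ring) J"

abbreviation "to_coset f \<equiv> J +>\<^bsub>type_ring\<^esub> f"

lemma presents_ring_mod_ideal: "presents to_coset ring_mod_ideal UNIV J"
proof -
  have "J +>\<^bsub>ring_module type_ring\<^esub> f = to_coset f" for f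
    by (simp add: a_r_coset_def' ring_module_def)
  then show ?thesis
    using presents_quot_module[OF presents_ring_module, of J] J tideal_0[OF J] by simp
qed

lemma presents_subquotient:
  assumes "J \<subseteq> K" "K \<subseteq> L" "tideal K" "tideal L"
  shows "\<exists>\<psi>. presents \<psi> (quot_module (sub_module ring_mod_ideal (to_coset ` L)) (to_coset ` K)) L K"
  using presents_quot_module[OF presents_sub_module[OF presents_ring_mod_ideal, of L], of K] assms
  by auto

lemma CM_filtration_subquotient:
  assumes J0: "L 0 = J" and ideals: "\<forall>i\<le>r. tideal (L i)"
    and sub: "\<forall>i<r. L i \<subseteq> L (Suc i)" and i: "i < r"
  shows "cohen_macaulay type_ring m
      (quot_module (sub_module ring_mod_ideal (to_coset ` L (Suc i))) (to_coset ` L i)) \<longleftrightarrow>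
      pair_CM m (L (Suc i)) (L i)"
    and "module_dim type_ring
      (quot_module (sub_module ring_mod_ideal (to_coset ` L (Suc i))) (to_coset ` L i)) =
      quot_dim (colon (L i) (L (Suc i)))"
proof -
  have "J \<subseteq> L i" using chain_subset[of r L 0 i] sub J0 i by auto
  then obtain \<psi> where "presents \<psi>
      (quot_module (sub_module ring_mod_ideal (to_coset ` L (Suc i))) (to_coset ` L i)) (L (Suc i)) (L i)"
    using presents_subquotient[of "L i" "L (Suc i)"] ideals sub i by auto
  then show "cohen_macaulay type_ring m
      (quot_module (sub_module ring_mod_ideal (to_coset ` L (Suc i))) (to_coset ` L i)) \<longleftrightarrow>
      pair_CM m (L (Suc i)) (L i)"
    and "module_dim type_ring
      (quot_module (sub_module ring_mod_ideal (to_coset ` L (Suc i))) (to_coset ` L i)) =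
      quot_dim (colon (L i) (L (Suc i)))"
    by (rule presents_cohen_macaulay presents_module_dim)+
qed

lemma sequentially_CM_imp_filtration:
  assumes "sequentially_CM type_ring m ring_mod_ideal D"
  shows "\<exists>r L. CM_filtration m J r L"
proof -
  note pr = presents_ring_mod_ideal
  show ?thesis
    using assms unfolding sequentially_CM_def
  proof (elim exE conjE)
    fix r N
    assume N0: "N 0 = {\<zero>\<^bsub>ring_mod_ideal\<^esub>}" and Nr: "N r = carrier ring_mod_ideal"
      and grd: "\<forall>i\<le>r. graded_submodule type_ring ring_mod_ideal D (N i)"
      and sub: "\<forall>i<r. N i \<subset> N (Suc i)"
      and cm: "\<forall>i<r.
        cohen_macaulay type_ring m (quot_module (sub_module ring_mod_ideal (N (Suc i))) (N i))"
      and dims: "\<forall>i j. i < j \<and> j < r \<longrightarrow>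
        module_dim type_ring (quot_module (sub_module ring_mod_ideal (N (Suc i))) (N i))
        < module_dim type_ring (quot_module (sub_module ring_mod_ideal (N (Suc j))) (N j))"
    define L where "L i = {f \<in> UNIV. to_coset f \<in> N i}" for i
    have NL: "J \<subseteq> L i" "tideal (L i)" "N i = to_coset ` L i" if "i \<le> r" for i
      using presents_submodule_vimage[OF pr, of "N i"] grd that
      unfolding L_def graded_submodule_def by blast+
    have L0: "L 0 = J"
      using presentsD(5,6)[OF pr] by (auto simp: L_def N0)
    have Lr: "L r = UNIV"
      using presentsD(4)[OF pr] by (auto simp: L_def Nr)
    have Lsub: "L i \<subset> L (Suc i)" if "i < r" for i
      using sub NL(3)[of i] NL(3)[of "Suc i"] that by (auto simp: L_def)
    have *: "N i = to_coset ` L i" "N (Suc i) = to_coset ` L (Suc i)" if "i < r" for i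
      using NL(3)[of i] NL(3)[of "Suc i"] that by simp_all
    have "\<forall>i\<le>r. tideal (L i)" "\<forall>i<r. L i \<subseteq> L (Suc i)" using NL(2) Lsub by blast+
    note sq = CM_filtration_subquotient[of L r, OF L0 this]
    have "CM_filtration m J r L"
      unfolding CM_filtration_def
    proof (intro conjI allI impI)
      fix i assume i: "i < r"
      show "pair_CM m (L (Suc i)) (L i)" using cm i *[OF i] sq(1)[OF i] by metis
    next
      fix i j assume ij: "i < j \<and> j < r"
      then have i: "i < r" and j: "j < r" by auto
      show "quot_dim (colon (L i) (L (Suc i))) < quot_dim (colon (L j) (L (Suc j)))"
        using dims ij *[OF i] *[OF j] sq(2)[OF i] sq(2)[OF j] by metis
    qed (use L0 Lr NL Lsub in auto)
    then show ?thesis by blast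
  qed
qed

lemma filtration_imp_sequentially_CM:
  assumes L: "CM_filtration m J r L"
    and gr: "\<And>i x. i \<le> r \<Longrightarrow> x \<in> L i \<Longrightarrow>
      \<exists>F c. finite F \<and> (\<forall>d\<in>F. c d \<in> L i \<inter> D d) \<and> x = (\<Sum>d\<in>F. c d)"
  shows "sequentially_CM type_ring m ring_mod_ideal (\<lambda>d. to_coset ` D d)"
proof -
  note pr = presents_ring_mod_ideal
  have L0: "L 0 = J" and Lr: "L r = UNIV" and id: "\<And>i. i \<le> r \<Longrightarrow> tideal (L i)"
    and sub: "\<And>i. i < r \<Longrightarrow> L i \<subset> L (Suc i)"
    and cm: "\<And>i. i < r \<Longrightarrow> pair_CM m (L (Suc i)) (L i)"
    and dims: "\<And>i j. i < j \<Longrightarrow> j < r \<Longrightarrow>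
      quot_dim (colon (L i) (L (Suc i))) < quot_dim (colon (L j) (L (Suc j)))"
    using L unfolding CM_filtration_def by blast+
  have J_sub: "J \<subseteq> L i" if "i \<le> r" for i
    using chain_subset[of r L 0 i] sub L0 that by auto
  have "\<forall>i\<le>r. tideal (L i)" "\<forall>i<r. L i \<subseteq> L (Suc i)" using id sub by blast+
  note sq = CM_filtration_subquotient[of L r, OF L0 this]
  have strict: "to_coset ` L i \<subset> to_coset ` L (Suc i)" if i: "i < r" for i
    using presents_image_subset_iff[OF pr, of "L i" "L (Suc i)"] J_sub[of i] id[of i] sub[OF i] i
    by auto
  have graded: "graded_submodule type_ring ring_mod_ideal (\<lambda>d. to_coset ` D d) (to_coset ` L i)"
    if i: "i \<le> r" for i
    unfolding graded_submodule_def
  proof (intro conjI ballI)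
    show "submodule (to_coset ` L i) type_ring ring_mod_ideal"
      using presents_submodule[OF pr J_sub[OF i] id[OF i]] by simp
    fix x assume "x \<in> to_coset ` L i"
    then obtain f where f: "x = to_coset f" "f \<in> L i" by blast
    obtain F c where c: "finite F" "\<And>d. d \<in> F \<Longrightarrow> c d \<in> L i \<inter> D d" "f = (\<Sum>d\<in>F. c d)"
      using gr[OF i f(2)] by blast
    show "\<exists>F c. finite F \<and> (\<forall>d\<in>F. c d \<in> to_coset ` L i \<inter> to_coset ` D d) \<and>
        x = finsum ring_mod_ideal c F"
    proof (intro exI conjI)
      show "finite F" by fact
      show "\<forall>d\<in>F. to_coset (c d) \<in> to_coset ` L i \<inter> to_coset ` D d" using c(2) by blast
      show "x = finsum ring_mod_ideal (\<lambda>d. to_coset (c d)) F"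
        using presents_finsum[OF pr c(1), of c] c(3) f(1) by simp
    qed
  qed
  show ?thesis
    unfolding sequentially_CM_def
  proof (rule exI[of _ r], rule exI[of _ "\<lambda>i. to_coset ` L i"], intro conjI allI impI)
    show "to_coset ` L 0 = {\<zero>\<^bsub>ring_mod_ideal\<^esub>}"
      using presentsD(5,6)[OF pr] tideal_0[OF J] unfolding L0 by auto
    show "to_coset ` L r = carrier ring_mod_ideal"
      using presentsD(4)[OF pr] Lr by simp
    fix i j assume ij: "i < j \<and> j < r"
    then have i: "i < r" and j: "j < r" by auto
    show "module_dim type_ring
          (quot_module (sub_module ring_mod_ideal (to_coset ` L (Suc i))) (to_coset ` L i))
         < module_dim type_ring
          (quot_module (sub_module ring_mod_ideal (to_coset ` L (Suc j))) (to_coset ` L j))"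
      unfolding sq(2)[OF i] sq(2)[OF j] using dims ij by simp
  next
    fix i assume i: "i < r"
    show "cohen_macaulay type_ring m
        (quot_module (sub_module ring_mod_ideal (to_coset ` L (Suc i))) (to_coset ` L i))"
      unfolding sq(1)[OF i] by (rule cm[OF i])
  qed (use strict graded in auto)
qed

end

text \<open>Common to a weakly regular sequence on \<open>L / K\<close> and, for \<open>L = UNIV\<close>, to elements
  \<open>a\<^sub>i \<in> P\<^sub>i\<^sub>+\<^sub>1 - P\<^sub>i\<close> of a chain of prime ideals.\<close>

fun cancel_chain :: "'r::comm_ring_1 list \<Rightarrow> 'r set \<Rightarrow> 'r set \<Rightarrow> 'r set \<Rightarrow> bool" where
  "cancel_chain [] L K Z \<longleftrightarrow> K \<subseteq> Z"
| "cancel_chain (a # as) L K Z \<longleftrightarrow> (\<exists>K'. tideal K' \<and> K \<subseteq> K' \<and>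
     (\<forall>x\<in>L. a * x \<in> K \<longrightarrow> x \<in> K) \<and> (\<forall>x\<in>L. a * x \<in> K') \<and> cancel_chain as L K' Z)"

lemma weakly_regular_cancel_chain:
  "tideal L \<Longrightarrow> tideal K \<Longrightarrow> weakly_regular as L K \<Longrightarrow> cancel_chain as L K (ideal_steps as L K)"
proof (induction as arbitrary: K)
  case (Cons a as)
  then show ?case
    by (auto intro!: exI[of _ "ideal_step a L K"]
        simp: tideal_ideal_step ideal_step_mult dest: subsetD[OF ideal_step_superset])
qed simp

text \<open>From each prime one element outside the preceding prime is taken: it cancels modulo the
  smaller prime and multiplies everything into the larger one.\<close>

lemma prime_chain_cancel_chain:
  assumes "prime_chain A k P"
  shows "\<exists>as. length as = k \<and> cancel_chain as UNIV (P 0) (P k)"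
  using assms
proof (induction k arbitrary: P)
  case (Suc k)
  then have P: "tprime (P i)" "A \<subseteq> P i" if "i \<le> Suc k" for i
    using that by (auto simp: prime_chain_def)
  have sub: "P i \<subset> P (Suc i)" if "i < Suc k" for i
    using Suc.prems that by (auto simp: prime_chain_def)
  have "prime_chain A k (\<lambda>i. P (Suc i))" using P sub by (auto simp: prime_chain_def)
  then obtain as where as: "length as = k" "cancel_chain as UNIV (P 1) (P (Suc k))"
    using Suc.IH by fastforce
  obtain a where a: "a \<in> P 1" "a \<notin> P 0" using sub[of 0] by auto
  have "cancel_chain (a # as) UNIV (P 0) (P (Suc k))"
    using as a sub[of 0] P[of 0] tprime_tideal[OF P(1)[of 1]]
    by (auto intro!: exI[of _ "P 1"] simp: tprime_mult tideal_mult2)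
  then show ?case using as(1) by (intro exI[of _ "a # as"]) simp
qed (auto intro: exI[of _ "[]"])

fun power_monomial :: "'r::comm_ring_1 list \<Rightarrow> nat list \<Rightarrow> 'r" where
  "power_monomial (a # as) (n # ns) = a ^ n * power_monomial as ns"
| "power_monomial _ _ = 1"

text \<open>Read off the lexicographically smallest exponent: its power of the first element cancels, and
  the remaining terms with a larger power of that element die in the next member of the chain.\<close>

lemma cancel_chain_relation:
  assumes "cancel_chain as L K Z" "tideal L" "tideal K" "x \<in> L"
    and "finite E" "E \<noteq> {}" "\<And>m. m \<in> E \<Longrightarrow> length m = length as \<and> c m dvd 1"
    and "(\<Sum>m\<in>E. c m * power_monomial as m * x) \<in> K"
  shows "x \<in> Z"
  using assms
proof (induction as arbitrary: K E c)
  case Nil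
  then have "E = {[]}" by fastforce
  with Nil have "c [] * x \<in> K" and "c [] dvd 1" by auto
  then obtain u where "c [] * u = 1" by (auto simp: dvd_def)
  then have "x = u * (c [] * x)" by (simp flip: mult.assoc add: mult.commute)
  also have "\<dots> \<in> K" using \<open>c [] * x \<in> K\<close> Nil.prems(3) by (rule tideal_mult[rotated])
  finally show ?case using Nil.prems(1) by auto
next
  case (Cons a as)
  from Cons.prems(1) obtain K' where K': "tideal K'" "K \<subseteq> K'" "\<And>x. x \<in> L \<Longrightarrow> a * x \<in> K \<Longrightarrow> x \<in> K"
    "\<And>x. x \<in> L \<Longrightarrow> a * x \<in> K'" "cancel_chain as L K' Z" by auto
  have cancel: "y \<in> K" if "a ^ n * y \<in> K" "y \<in> L" for n y
    using that
  proof (induction n)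
    case (Suc n)
    then show ?case using K'(3)[of "a ^ n * y"] tideal_mult[OF \<open>tideal L\<close>] by (simp add: mult.assoc)
  qed simp
  define n where "n = Min (hd ` E)"
  define E1 where "E1 = {m \<in> E. hd m = n}"
  \<comment> \<open>Outside \<open>E1\<close> the exponent \<open>hd m\<close> exceeds
    \<open>n\<close>, so the truncated difference is exact and \<open>a ^ Suc n\<close> splits
    off.\<close>
  define y where "y = (\<Sum>m\<in>E - E1. c m * a ^ (hd m - Suc n) * power_monomial as (tl m) * x)"
  define z where "z = (\<Sum>m\<in>E1. c m * power_monomial as (tl m) * x)"
  have n_le: "n \<le> hd m" if "m \<in> E" for m using Cons.prems(5) that by (simp add: n_def)
  have n_in: "n \<in> hd ` E" unfolding n_def using Cons.prems(5,6) by (intro Min_in) auto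
  have split: "m = hd m # tl m" if "m \<in> E" for m
    using Cons.prems(7)[OF that] by (cases m) auto
  have y: "y \<in> L" and z: "z \<in> L"
    unfolding y_def z_def by (intro tideal_sum[OF \<open>tideal L\<close>] tideal_mult[OF \<open>tideal L\<close>] \<open>x \<in> L\<close>)+
  have pm: "power_monomial (a # as) m = a ^ hd m * power_monomial as (tl m)" if "m \<in> E" for m
    using split[OF that] by (metis power_monomial.simps(1))
  have "(\<Sum>m\<in>E. c m * power_monomial (a # as) m * x) =
      (\<Sum>m\<in>E1. c m * power_monomial (a # as) m * x) +
      (\<Sum>m\<in>E - E1. c m * power_monomial (a # as) m * x)"
    using Cons.prems(5) by (subst sum.subset_diff[of E1]) (auto simp: E1_def)
  also have "(\<Sum>m\<in>E1. c m * power_monomial (a # as) m * x) = a ^ n * z"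
    unfolding z_def sum_distrib_left by (rule sum.cong) (auto simp: E1_def pm algebra_simps)
  also have "(\<Sum>m\<in>E - E1. c m * power_monomial (a # as) m * x) = a ^ n * (a * y)"
    unfolding y_def sum_distrib_left
  proof (rule sum.cong)
    fix m assume m: "m \<in> E - E1"
    then have "hd m = n + Suc (hd m - Suc n)" using n_le[of m] by (auto simp: E1_def)
    then have "a ^ hd m = a ^ n * a * a ^ (hd m - Suc n)"
      by (metis power_add power_Suc mult.assoc)
    then show "c m * power_monomial (a # as) m * x =
        a ^ n * (a * (c m * a ^ (hd m - Suc n) * power_monomial as (tl m) * x))"
      using m by (simp add: pm algebra_simps)
  qed simp
  finally have "a ^ n * (z + a * y) \<in> K" using Cons.prems(8) by (simp add: distrib_left)
  then have "z + a * y \<in> K"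
    using cancel tideal_add[OF \<open>tideal L\<close> z] tideal_mult[OF \<open>tideal L\<close> y] by blast
  then have "z \<in> K'" using K'(2) K'(4)[OF y] tideal_diff[OF K'(1), of "z + a * y" "a * y"] by auto
  \<comment> \<open>All members of \<open>E1\<close> start with \<open>n\<close>, so dropping the
    head is injective and leaves a shorter relation with unit coefficients, now modulo
    \<open>K'\<close>.\<close>
  moreover have "z = (\<Sum>m\<in>tl ` E1. c (n # m) * power_monomial as m * x)"
  proof -
    have cons: "n # tl m = m" if "m \<in> E1" for m using that split[of m] by (simp add: E1_def)
    moreover have "inj_on tl E1" by (rule inj_on_inverseI[of _ "\<lambda>m. n # m"]) (rule cons)
    ultimately show ?thesis unfolding z_def by (simp add: sum.reindex)
  qed
  moreover have "tl ` E1 \<noteq> {}" using n_in by (auto simp: E1_def)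
  moreover have "length m = length as \<and> c (n # m) dvd 1" if "m \<in> tl ` E1" for m
    using that Cons.prems(7) split by (fastforce simp: E1_def)
  moreover have "finite (tl ` E1)" using Cons.prems(5) by (simp add: E1_def)
  ultimately show ?case
    using Cons.IH[OF K'(5) Cons.prems(2) K'(1) Cons.prems(4), of "tl ` E1" "\<lambda>m. c (n # m)"] by simp
qed

section \<open>Weakly regular sequences\<close>

definition ideal_sum :: "'r::comm_ring_1 set \<Rightarrow> 'r set \<Rightarrow> 'r set" where
  "ideal_sum I J = {x + y |x y. x \<in> I \<and> y \<in> J}"

lemma ideal_step_1: "ideal_step 1 I J = ideal_sum I J"
  by (simp add: ideal_step_def ideal_sum_def)

lemma tideal_ideal_sum: "tideal I \<Longrightarrow> tideal J \<Longrightarrow> tideal (ideal_sum I J)"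
  by (metis ideal_step_1 tideal_ideal_step)

lemma ideal_sumE:
  assumes "z \<in> ideal_sum I J"
  obtains x y where "z = x + y" "x \<in> I" "y \<in> J"
  using assms by (auto simp: ideal_sum_def)

lemma ideal_sumI: "x \<in> I \<Longrightarrow> y \<in> J \<Longrightarrow> x + y \<in> ideal_sum I J"
  by (auto simp: ideal_sum_def)

text \<open>Second isomorphism theorem, \<open>(L + K)/K = L/(L \<inter> K)\<close>. One step
  replaces \<open>K\<close> by \<open>aL + K\<close>, and the modular law turns its intersection
  with \<open>L\<close> into \<open>aL + (L \<inter> K)\<close>, so the induction continues.\<close>

lemma weakly_regular_second_iso:
  assumes "tideal L" "tideal K" "weakly_regular as L (L \<inter> K)"
  shows "weakly_regular as (ideal_sum L K) K"
  using assms
proof (induction as arbitrary: K)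
  case (Cons a as)
  let ?S = "ideal_sum L K" and ?K' = "ideal_step a (ideal_sum L K) K"
  note L = tidealD[OF \<open>tideal L\<close>] and K = tidealD[OF \<open>tideal K\<close>]
  have K': "?K' = ideal_step a L K"
  proof
    show "?K' \<subseteq> ideal_step a L K"
    proof
      fix z assume "z \<in> ?K'"
      then obtain l k k' where z: "z = a * (l + k) + k'" "l \<in> L" "k \<in> K" "k' \<in> K"
        by (auto elim!: ideal_stepE ideal_sumE)
      then have "z = a * l + (a * k + k')" by (simp add: algebra_simps)
      then show "z \<in> ideal_step a L K" using z K by (metis ideal_stepI)
    qed
    show "ideal_step a L K \<subseteq> ?K'"
      using ideal_sumI[OF _ K(1), of _ L] by (auto elim!: ideal_stepE intro!: ideal_stepI)
  qed
  have int: "L \<inter> ideal_step a L K = ideal_step a L (L \<inter> K)"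
  proof
    show "L \<inter> ideal_step a L K \<subseteq> ideal_step a L (L \<inter> K)"
    proof
      fix z assume z: "z \<in> L \<inter> ideal_step a L K"
      then obtain l k where lk: "z = a * l + k" "l \<in> L" "k \<in> K" by (auto elim: ideal_stepE)
      then have "z - a * l = k" by simp
      then have "k \<in> L"
        using tideal_diff[OF \<open>tideal L\<close> _ tideal_mult[OF \<open>tideal L\<close> lk(2)], of z a] z by simp
      then show "z \<in> ideal_step a L (L \<inter> K)" using lk by (auto intro: ideal_stepI)
    qed
    show "ideal_step a L (L \<inter> K) \<subseteq> L \<inter> ideal_step a L K"
      using L by (auto elim!: ideal_stepE intro: ideal_stepI)
  qed
  have sum: "ideal_sum L (ideal_step a L K) = ?S"
  proof
    show "ideal_sum L (ideal_step a L K) \<subseteq> ?S"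
    proof
      fix z assume "z \<in> ideal_sum L (ideal_step a L K)"
      then obtain l l' k where z: "z = l + (a * l' + k)" "l \<in> L" "l' \<in> L" "k \<in> K"
        by (auto elim!: ideal_stepE ideal_sumE)
      then have eq: "z = (l + a * l') + k" by (simp add: algebra_simps)
      show "z \<in> ?S"
        unfolding eq by (intro ideal_sumI tideal_add[OF \<open>tideal L\<close>] tideal_mult[OF \<open>tideal L\<close>] z)
    qed
    show "?S \<subseteq> ideal_sum L (ideal_step a L K)"
      using ideal_step_superset[OF \<open>tideal L\<close>, of K a] by (auto elim!: ideal_sumE intro!: ideal_sumI)
  qed
  have nzd: "x \<in> K" if x: "x \<in> ?S" "a * x \<in> K" for x
  proof -
    obtain l k where lk: "x = l + k" "l \<in> L" "k \<in> K" using x(1) by (rule ideal_sumE)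
    have "a * x - a * k = a * l" using lk by (simp add: algebra_simps)
    then have "a * l \<in> K" using tideal_diff[OF \<open>tideal K\<close> x(2) tideal_mult[OF \<open>tideal K\<close> lk(3)], of a] by simp
    then have "a * l \<in> L \<inter> K" using tideal_mult[OF \<open>tideal L\<close> lk(2)] by simp
    then have "l \<in> K" using Cons.prems(3) lk(2) by simp
    then show ?thesis using lk K by blast
  qed
  have "weakly_regular as (ideal_sum L (ideal_step a L K)) (ideal_step a L K)"
    using Cons.prems by (intro Cons.IH) (simp_all add: int tideal_ideal_step)
  then show ?case using nzd by (simp add: K' sum)
qed simp

text \<open>The ends of \<open>0 -> L1/L0 -> L2/L0 -> L2/L1 -> 0\<close> control the middle. Since
  \<open>a\<close> is a nonzerodivisor on \<open>L2/L1\<close>, the sequence stays exact modulo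
  \<open>a\<close>; its new submodule is presented by a sum of ideals, which is where the second
  isomorphism theorem enters.\<close>

lemma weakly_regular_extension:
  assumes "tideal L2" "tideal L1" "tideal L0" "L0 \<subseteq> L1" "L1 \<subseteq> L2"
    and "weakly_regular as L1 L0" "weakly_regular as L2 L1"
  shows "weakly_regular as L2 L0"
  using assms
proof (induction as arbitrary: L1 L0)
  case (Cons a as)
  let ?K0 = "ideal_step a L2 L0" and ?K1 = "ideal_step a L2 L1"
  note id = tidealD[OF \<open>tideal L2\<close>] tidealD[OF \<open>tideal L1\<close>] tidealD[OF \<open>tideal L0\<close>]
  have nz2: "x \<in> L1" if "x \<in> L2" "a * x \<in> L1" for x using Cons.prems(7) that by simp
  have nz1: "x \<in> L0" if "x \<in> L1" "a * x \<in> L0" for x using Cons.prems(6) that by simp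
  have int: "L1 \<inter> ?K0 = ideal_step a L1 L0"
  proof
    show "L1 \<inter> ?K0 \<subseteq> ideal_step a L1 L0"
    proof
      fix z assume z: "z \<in> L1 \<inter> ?K0"
      then obtain l k where lk: "z = a * l + k" "l \<in> L2" "k \<in> L0" by (auto elim: ideal_stepE)
      then have "z - k = a * l" by simp
      then have "a * l \<in> L1" using tideal_diff[OF \<open>tideal L1\<close>, of z k] z lk(3) Cons.prems(4) by auto
      then show "z \<in> ideal_step a L1 L0" using lk nz2 by (auto intro: ideal_stepI)
    qed
    show "ideal_step a L1 L0 \<subseteq> L1 \<inter> ?K0"
      using Cons.prems(4,5) id by (auto elim!: ideal_stepE intro!: ideal_stepI)
  qed
  have sum: "ideal_sum L1 ?K0 = ?K1"
  proof
    show "ideal_sum L1 ?K0 \<subseteq> ?K1"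
    proof
      fix z assume "z \<in> ideal_sum L1 ?K0"
      then obtain l l' k where z: "z = l + (a * l' + k)" "l \<in> L1" "l' \<in> L2" "k \<in> L0"
        by (auto elim!: ideal_stepE ideal_sumE)
      then have eq: "z = a * l' + (l + k)" by (simp add: algebra_simps)
      show "z \<in> ?K1"
        unfolding eq by (intro ideal_stepI tideal_add[OF \<open>tideal L1\<close>] z subsetD[OF Cons.prems(4)])
    qed
    show "?K1 \<subseteq> ideal_sum L1 ?K0"
    proof
      fix z assume "z \<in> ?K1"
      then obtain l k where z: "z = a * l + k" "l \<in> L2" "k \<in> L1" by (auto elim: ideal_stepE)
      then have "z = k + (a * l + 0)" by simp
      then show "z \<in> ideal_sum L1 ?K0" using z id by (metis ideal_sumI ideal_stepI)
    qed
  qed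
  have id': "tideal ?K0" "tideal ?K1" using Cons.prems by (auto intro: tideal_ideal_step)
  have "weakly_regular as L1 (L1 \<inter> ?K0)" unfolding int using Cons.prems(6) by simp
  then have "weakly_regular as ?K1 ?K0"
    using weakly_regular_second_iso[OF \<open>tideal L1\<close> id'(1)] by (simp add: sum)
  moreover have "?K0 \<subseteq> ?K1" "?K1 \<subseteq> L2"
    using Cons.prems(4,5) id by (auto elim!: ideal_stepE intro!: ideal_stepI)
  moreover have "weakly_regular as L2 ?K1" using Cons.prems(7) by simp
  ultimately have "weakly_regular as L2 ?K0"
    using Cons.IH[OF Cons.prems(1) id'(2,1)] by simp
  moreover have "x \<in> L0" if "x \<in> L2" "a * x \<in> L0" for x
    using nz1 nz2 that Cons.prems(4) by blast
  ultimately show ?case by simp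
qed simp

text \<open>The cyclic module \<open>(gR + K)/K\<close> is \<open>R/(K : g)\<close>, and the
  induction works because \<open>(K + agR) : g = aR + (K : g)\<close>.\<close>

lemma weakly_regular_principal:
  assumes "tideal K" "weakly_regular as UNIV (colon K {g})"
  shows "weakly_regular as (ideal_step g UNIV K) K"
  using assms
proof (induction as arbitrary: K)
  case (Cons a as)
  let ?L = "ideal_step g UNIV K" and ?K' = "ideal_step (a * g) UNIV K"
  note K = tidealD[OF \<open>tideal K\<close>]
  have K': "ideal_step a ?L K = ?K'"
  proof
    show "ideal_step a ?L K \<subseteq> ?K'"
    proof
      fix z assume "z \<in> ideal_step a ?L K"
      then obtain r k k' where z: "z = a * (g * r + k) + k'" "k \<in> K" "k' \<in> K"
        by (auto elim!: ideal_stepE)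
      then have "z = a * g * r + (a * k + k')" by (simp add: algebra_simps)
      then show "z \<in> ?K'" using z K by (metis UNIV_I ideal_stepI)
    qed
    show "?K' \<subseteq> ideal_step a ?L K"
    proof
      fix z assume "z \<in> ?K'"
      then obtain r k where z: "z = a * g * r + k" "k \<in> K" by (auto elim: ideal_stepE)
      then have "z = a * (g * r + 0) + k" by (simp add: algebra_simps)
      then show "z \<in> ideal_step a ?L K" using z K by (metis UNIV_I ideal_stepI)
    qed
  qed
  have L': "ideal_step g UNIV ?K' = ?L"
  proof
    show "ideal_step g UNIV ?K' \<subseteq> ?L"
    proof
      fix z assume "z \<in> ideal_step g UNIV ?K'"
      then obtain r s k where z: "z = g * r + (a * g * s + k)" "k \<in> K" by (auto elim!: ideal_stepE)
      then have "z = g * (r + a * s) + k" by (simp add: algebra_simps)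
      then show "z \<in> ?L" using z by (metis UNIV_I ideal_stepI)
    qed
    show "?L \<subseteq> ideal_step g UNIV ?K'"
      using ideal_step_superset[OF tideal_UNIV, of K "a * g"]
      by (auto elim!: ideal_stepE intro!: ideal_stepI)
  qed
  have col: "colon ?K' {g} = ideal_step a UNIV (colon K {g})"
  proof
    show "colon ?K' {g} \<subseteq> ideal_step a UNIV (colon K {g})"
    proof
      fix r assume "r \<in> colon ?K' {g}"
      then obtain s k where sk: "r * g = a * g * s + k" "k \<in> K"
        by (auto simp: colon_def elim: ideal_stepE)
      then have "(r - a * s) * g = k" by (simp add: algebra_simps)
      then have "r - a * s \<in> colon K {g}" using sk(2) by (simp add: colon_def)
      then have "a * s + (r - a * s) \<in> ideal_step a UNIV (colon K {g})" by (intro ideal_stepI) auto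
      then show "r \<in> ideal_step a UNIV (colon K {g})" by simp
    qed
    show "ideal_step a UNIV (colon K {g}) \<subseteq> colon ?K' {g}"
    proof
      fix r assume "r \<in> ideal_step a UNIV (colon K {g})"
      then obtain s k where sk: "r = a * s + k" "k * g \<in> K"
        by (auto simp: colon_def elim: ideal_stepE)
      have "r * g = a * g * s + k * g" using sk(1) by (simp add: algebra_simps)
      also have "\<dots> \<in> ?K'" using sk(2) by (intro ideal_stepI) auto
      finally show "r \<in> colon ?K' {g}" by (simp add: colon_def)
    qed
  qed
  have nzd: "x \<in> K" if x: "x \<in> ?L" "a * x \<in> K" for x
  proof -
    obtain r k where rk: "x = g * r + k" "k \<in> K" using x(1) by (auto elim: ideal_stepE)
    have "a * r * g = a * x - a * k" using rk by (simp add: algebra_simps)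
    then have "a * r \<in> colon K {g}" using x rk K by (auto simp: colon_def)
    then have "r \<in> colon K {g}" using Cons.prems(2) by simp
    then show ?thesis using rk K by (auto simp: colon_def mult.commute)
  qed
  have "weakly_regular as (ideal_step g UNIV ?K') ?K'"
    using Cons.prems by (intro Cons.IH) (auto simp: col tideal_ideal_step tideal_UNIV)
  then show ?case using nzd by (simp add: K' L')
qed simp

lemma ideal_step_UNIV_iff: "x \<in> ideal_step a UNIV K \<longleftrightarrow> (\<exists>u. x - a * u \<in> K)"
proof
  assume "x \<in> ideal_step a UNIV K"
  then obtain u y where "x = a * u + y" "y \<in> K" by (auto elim: ideal_stepE)
  then show "\<exists>u. x - a * u \<in> K" by (intro exI[of _ u]) simp
next
  assume "\<exists>u. x - a * u \<in> K"
  then obtain u where "x - a * u \<in> K" by blast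
  then have "a * u + (x - a * u) \<in> ideal_step a UNIV K" by (intro ideal_stepI) auto
  then show "x \<in> ideal_step a UNIV K" by simp
qed

text \<open>Induction on the exponent: if \<open>c x\<close> is a multiple of
  \<open>b ^ Suc n\<close> modulo \<open>K\<close>, regularity of \<open>c\<close> modulo
  \<open>b\<close> gives \<open>x = b y\<close>, and cancelling \<open>b\<close> lowers the
  exponent.\<close>

lemma weakly_regular_power2:
  assumes K: "tideal K" and reg: "weakly_regular [b, c] UNIV K"
  shows "weakly_regular [b ^ n, c] UNIV K"
proof -
  note id = tidealD[OF K]
  have B: "x \<in> K" if "b * x \<in> K" for x using reg that by simp
  have C: "\<exists>u. x - b * u \<in> K" if "c * x - b * u \<in> K" for x u
    using reg that by (auto simp: ideal_step_UNIV_iff)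
  have "x \<in> K" if "b ^ n * x \<in> K" for x
    using that by (induction n arbitrary: x) (auto simp: mult.assoc intro: B)
  moreover have "\<exists>u. x - b ^ n * u \<in> K" if "c * x - b ^ n * u \<in> K" for x u
    using that
  proof (induction n arbitrary: x u)
    case 0
    show ?case using id(1) by (intro exI[of _ x]) simp
  next
    case (Suc n)
    then have "c * x - b * (b ^ n * u) \<in> K" by (simp add: mult.assoc)
    then obtain y where y: "x - b * y \<in> K" using C by blast
    have "b * (c * y - b ^ n * u) = (c * x - b ^ Suc n * u) - c * (x - b * y)"
      by (simp add: algebra_simps)
    then have "c * y - b ^ n * u \<in> K" using Suc.prems y id by (auto intro: B)
    then obtain v where "y - b ^ n * v \<in> K" using Suc.IH by blast
    then have "(x - b * y) + b * (y - b ^ n * v) \<in> K" using y id by blast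
    then show ?case by (intro exI[of _ v]) (simp add: algebra_simps)
  qed
  ultimately show ?thesis by (auto simp: ideal_step_UNIV_iff)
qed

text \<open>Only the first element is raised, since a power of the second comes from the shorter
  statement modulo the first. The induction writes \<open>x = b w + a y\<close> modulo
  \<open>K\<close> and has to remove one factor \<open>a\<close> in the presence of the terms with
  \<open>b\<close>.\<close>

lemma weakly_regular_power3:
  assumes K: "tideal K" and reg: "weakly_regular [a, b, c] UNIV K"
  shows "weakly_regular [a ^ n, b, c] UNIV K"
proof -
  note id = tidealD[OF K]
  have A: "x \<in> K" if "a * x \<in> K" for x using reg that by simp
  have B: "\<exists>u. x - a * u \<in> K" if "b * x - a * u \<in> K" for x u
    using reg that by (auto simp: ideal_step_UNIV_iff)
  have C: "\<exists>v u. x - b * v - a * u \<in> K" if "c * x - b * v - a * u \<in> K" for x u v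
  proof -
    have "c * x \<in> ideal_step b UNIV (ideal_step a UNIV K)"
      unfolding ideal_step_UNIV_iff using that by blast
    then have "x \<in> ideal_step b UNIV (ideal_step a UNIV K)" using reg by simp
    then show ?thesis unfolding ideal_step_UNIV_iff .
  qed
  have "x \<in> K" if "a ^ n * x \<in> K" for x
    using that by (induction n arbitrary: x) (auto simp: mult.assoc intro: A)
  moreover have "\<exists>u. x - a ^ n * u \<in> K" if "b * x - a ^ n * u \<in> K" for x u
    using that
  proof (induction n arbitrary: x u)
    case 0
    show ?case using id(1) by (intro exI[of _ x]) simp
  next
    case (Suc n)
    then have "b * x - a * (a ^ n * u) \<in> K" by (simp add: mult.assoc)
    then obtain y where y: "x - a * y \<in> K" using B by blast
    have "a * (b * y - a ^ n * u) = (b * x - a ^ Suc n * u) - b * (x - a * y)"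
      by (simp add: algebra_simps)
    then have "b * y - a ^ n * u \<in> K" using Suc.prems y id by (auto intro: A)
    then obtain v where "y - a ^ n * v \<in> K" using Suc.IH by blast
    then have "(x - a * y) + a * (y - a ^ n * v) \<in> K" using y id by blast
    then show ?case by (intro exI[of _ v]) (simp add: algebra_simps)
  qed
  moreover have "\<exists>v u. x - b * v - a ^ n * u \<in> K" if "c * x - b * v - a ^ n * u \<in> K" for x u v
    using that
  proof (induction n arbitrary: x u v)
    case 0
    show ?case using id(1) by (intro exI[of _ 0] exI[of _ x]) simp
  next
    case (Suc n)
    then have "c * x - b * v - a * (a ^ n * u) \<in> K" by (simp add: mult.assoc)
    then obtain y w where y: "x - b * w - a * y \<in> K" using C by blast
    \<comment> \<open>The two expressions for \<open>c x\<close> give a relation between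
      \<open>b\<close> and \<open>a\<close>. As \<open>b\<close> is regular modulo \<open>a\<close>,
      the coefficient \<open>v - c * w\<close> of \<open>b\<close> is a multiple
      \<open>a * z\<close> modulo \<open>K\<close>, and then \<open>a\<close> cancels.\<close>
    have "b * (v - c * w) - a * (c * y - a ^ n * u) =
        c * (x - b * w - a * y) - (c * x - b * v - a ^ Suc n * u)"
      by (simp add: algebra_simps)
    then have "b * (v - c * w) - a * (c * y - a ^ n * u) \<in> K" using Suc.prems y id by auto
    then obtain z where z: "v - c * w - a * z \<in> K" using B by blast
    have "a * (c * y - b * z - a ^ n * u) =
        (c * x - b * v - a ^ Suc n * u) - c * (x - b * w - a * y) + b * (v - c * w - a * z)"
      by (simp add: algebra_simps)
    then have "c * y - b * z - a ^ n * u \<in> K" using Suc.prems y z id by (auto intro: A)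
    then obtain q p where "y - b * q - a ^ n * p \<in> K" using Suc.IH by blast
    then have "(x - b * w - a * y) + a * (y - b * q - a ^ n * p) \<in> K" using y id by blast
    also have "(x - b * w - a * y) + a * (y - b * q - a ^ n * p) =
        x - b * (w + a * q) - a ^ Suc n * p"
      by (simp add: algebra_simps)
    finally show ?case by blast
  qed
  ultimately show ?thesis by (auto simp: ideal_step_UNIV_iff)
qed

section \<open>Squarefree monomial ideals and dimension\<close>

abbreviation "pkeys \<equiv> Poly_Mapping.keys"
abbreviation "pcoeff \<equiv> Poly_Mapping.lookup"
abbreviation "single \<equiv> Poly_Mapping.single"

lemma keys_add_nat: "pkeys (u + v :: 'v \<Rightarrow>\<^sub>0 nat) = pkeys u \<union> pkeys v"
  by (auto simp: in_keys_iff lookup_add)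

lemma expand_poly: "f = (\<Sum>u\<in>pkeys f. single u (pcoeff f u))"
  by (rule poly_mapping_eqI) (simp add: lookup_sum lookup_single when_def in_keys_iff)

definition poly_restrict :: "('a \<Rightarrow> bool) \<Rightarrow> ('a \<Rightarrow>\<^sub>0 'b::comm_monoid_add) \<Rightarrow> ('a \<Rightarrow>\<^sub>0 'b)" where
  "poly_restrict P f = (\<Sum>u\<in>{u \<in> pkeys f. P u}. single u (pcoeff f u))"

lemma coeff_poly_restrict: "pcoeff (poly_restrict P f) u = (if P u then pcoeff f u else 0)"
  by (simp add: poly_restrict_def lookup_sum lookup_single when_def in_keys_iff)

lemma keys_poly_restrict: "pkeys (poly_restrict P f) = {u \<in> pkeys f. P u}"
  by (auto simp: in_keys_iff coeff_poly_restrict split: if_splits)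

lemma poly_restrict_split: "f = poly_restrict P f + poly_restrict (\<lambda>u. \<not> P u) f"
  by (rule poly_mapping_eqI) (simp add: lookup_add coeff_poly_restrict)

lemma coeff_monomial_mult:
  fixes f :: "('v, 'k::field) mpol"
  shows "pcoeff (monomial s * f) (s + u) = pcoeff f u"
proof -
  have "monomial s * f = (\<Sum>w\<in>pkeys f. single (s + w) (pcoeff f w))"
    by (subst expand_poly[of f]) (simp add: monomial_def sum_distrib_left mult_single)
  then show ?thesis
    by (simp add: lookup_sum lookup_single when_def in_keys_iff)
qed

lemma keys_monomial_mult:
  fixes f :: "('v, 'k::field) mpol"
  shows "pkeys (monomial s * f) = (+) s ` pkeys f"
proof
  show "pkeys (monomial s * f) \<subseteq> (+) s ` pkeys f"
    using keys_mult[of "monomial s" f] by (auto simp: monomial_def)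
  show "(+) s ` pkeys f \<subseteq> pkeys (monomial s * f)"
    by (auto simp: in_keys_iff coeff_monomial_mult)
qed

lemma keys_monomial [simp]: "pkeys (monomial u :: ('v, 'k::field) mpol) = {u}"
  by (simp add: monomial_def)

lemma monomial_add: "monomial (u + v) = monomial u * (monomial v :: ('v, 'k::field) mpol)"
  by (simp add: monomial_def mult_single)

lemma monomial_0 [simp]: "monomial 0 = 1"
  by (simp add: monomial_def)

lemma single_eq_monomial: "single u c = single 0 c * (monomial u :: ('v, 'k::field) mpol)"
  by (simp add: monomial_def mult_single)

lemma tideal_monomials:
  fixes I :: "('v, 'k::field) mpol set"
  assumes I: "tideal I" and "\<And>u. u \<in> pkeys f \<Longrightarrow> monomial u \<in> I"
  shows "f \<in> I"
proof -
  have "(\<Sum>u\<in>pkeys f. single u (pcoeff f u)) \<in> I"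
    using assms(2) by (intro tideal_sum[OF I]) (subst single_eq_monomial, auto intro: tideal_mult[OF I])
  then show ?thesis by (simp flip: expand_poly)
qed

definition upset :: "'v set set \<Rightarrow> bool" where
  "upset U \<longleftrightarrow> (\<forall>S\<in>U. \<forall>T. S \<subseteq> T \<longrightarrow> T \<in> U)"

text \<open>The sets outside \<open>U\<close> are the faces of the Stanley--Reisner complex.\<close>

definition squarefree_ideal :: "'v set set \<Rightarrow> ('v, 'k::field) mpol set" where
  "squarefree_ideal U = {f. \<forall>u\<in>pkeys f. pkeys u \<in> U}"

lemma tideal_squarefree_ideal:
  assumes "upset U"
  shows "tideal (squarefree_ideal U)"
  unfolding tideal_iff
proof (intro conjI ballI allI)
  fix f g :: "('a, 'b) mpol" assume "f \<in> squarefree_ideal U" "g \<in> squarefree_ideal U"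
  then show "f + g \<in> squarefree_ideal U"
    using keys_add[of f g] by (auto simp: squarefree_ideal_def)
next
  fix r f :: "('a, 'b) mpol" assume f: "f \<in> squarefree_ideal U"
  show "r * f \<in> squarefree_ideal U"
    unfolding squarefree_ideal_def
  proof safe
    fix u assume "u \<in> pkeys (r * f)"
    then obtain a b where ab: "u = a + b" "b \<in> pkeys f" using keys_mult[of r f] by blast
    then have "pkeys b \<in> U" using f by (auto simp: squarefree_ideal_def)
    then show "pkeys u \<in> U" using assms ab by (auto simp: upset_def keys_add_nat)
  qed
qed (simp add: squarefree_ideal_def)

lemma monomial_in_squarefree_ideal [simp]: "monomial u \<in> squarefree_ideal U \<longleftrightarrow> pkeys u \<in> U"
  by (simp add: squarefree_ideal_def)

lemma squarefree_ideal_mono: "U \<subseteq> V \<Longrightarrow> squarefree_ideal U \<subseteq> squarefree_ideal V"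
  by (auto simp: squarefree_ideal_def)

text \<open>The prime generated by the variables in \<open>V\<close>; its faces are the sets
  disjoint from \<open>V\<close>. As an instance of \<open>squarefree_ideal\<close> it shares the
  calculus of ideals given by upsets.\<close>

definition face_ideal :: "'v set \<Rightarrow> ('v, 'k::field) mpol set" where
  "face_ideal V = squarefree_ideal {S. S \<inter> V \<noteq> {}}"

lemma tideal_face_ideal: "tideal (face_ideal V)"
  unfolding face_ideal_def by (rule tideal_squarefree_ideal) (auto simp: upset_def)

text \<open>Dropping all terms with a variable in \<open>V\<close> is the retraction onto the
  polynomial ring in the other variables, which is a domain.\<close>

lemma tprime_face_ideal:
  "tprime (face_ideal V :: ('v::{finite,linorder}, 'k::field) mpol set)"
  unfolding tprime_def
proof (intro conjI allI impI)
  show "tideal (face_ideal V :: ('v, 'k) mpol set)" by (rule tideal_face_ideal)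
  show "(1 :: ('v, 'k) mpol) \<notin> face_ideal V"
    by (simp add: face_ideal_def squarefree_ideal_def)
  fix a b :: "('v, 'k) mpol" assume ab: "a * b \<in> face_ideal V"
  define r where "r f = poly_restrict (\<lambda>u. pkeys u \<inter> V = {}) f" for f :: "('v, 'k) mpol"
  define s where "s f = poly_restrict (\<lambda>u. pkeys u \<inter> V \<noteq> {}) f" for f :: "('v, 'k) mpol"
  have split: "f = r f + s f" for f
    unfolding r_def s_def by (rule poly_restrict_split)
  have s: "s f \<in> face_ideal V" for f
    by (auto simp: s_def face_ideal_def squarefree_ideal_def keys_poly_restrict)
  note id = tidealD[OF tideal_face_ideal[of V, where ?'b = 'k]]
  have s': "s f = f - r f" for f using split[of f] by (metis add_diff_cancel_left')
  have "r a * r b = a * b - (r a * s b + s a * b)" unfolding s' by (simp add: algebra_simps)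
  also have "\<dots> \<in> face_ideal V" by (rule id(6)[OF ab id(2)[OF id(3)[OF s] id(4)[OF s]]])
  finally have "pkeys u \<inter> V \<noteq> {}" if "u \<in> pkeys (r a * r b)" for u
    using that by (auto simp: face_ideal_def squarefree_ideal_def)
  moreover have "pkeys u \<inter> V = {}" if u: "u \<in> pkeys (r a * r b)" for u
  proof -
    obtain p q where pq: "u = p + q" "p \<in> pkeys (r a)" "q \<in> pkeys (r b)"
      using u keys_mult[of "r a" "r b"] by blast
    then have "pkeys p \<inter> V = {}" "pkeys q \<inter> V = {}" by (simp_all add: r_def keys_poly_restrict)
    then show ?thesis by (auto simp: pq(1) keys_add_nat)
  qed
  ultimately have "pkeys (r a * r b) = {}" by blast
  then have "r a * r b = 0" by simp
  \<comment> \<open>The linear order on the variables enters here: it makes the exponents an ordered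
    monoid, so that polynomials have no zero divisors.\<close>
  then have "r a = 0 \<or> r b = 0" by simp
  then show "a \<in> face_ideal V \<or> b \<in> face_ideal V"
    using split[of a] split[of b] s[of a] s[of b] by force
qed

lemma face_ideal_mono: "V \<subseteq> W \<Longrightarrow> face_ideal V \<subseteq> face_ideal W"
  unfolding face_ideal_def by (rule squarefree_ideal_mono) auto

lemma pvar_in_face_ideal [simp]: "pvar i \<in> face_ideal V \<longleftrightarrow> i \<in> V"
  by (simp add: face_ideal_def pvar_def)

lemma squarefree_ideal_subset_face_ideal:
  "squarefree_ideal U \<subseteq> face_ideal V" if "- V \<notin> U" "upset U"
proof -
  have "S \<inter> V \<noteq> {}" if "S \<in> U" for S
    using that \<open>- V \<notin> U\<close> \<open>upset U\<close> unfolding upset_def by (metis Int_commute disjoint_eq_subset_Compl)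
  then show ?thesis unfolding face_ideal_def by (intro squarefree_ideal_mono) auto
qed

section \<open>Linear algebra and algebraic dependence modulo a squarefree ideal\<close>

lemma linear_dependence:
  fixes v :: "'a \<Rightarrow> 'b \<Rightarrow> 'k::field"
  assumes "finite G" "finite E" "card G < card E"
  shows "\<exists>c. (\<exists>m\<in>E. c m \<noteq> 0) \<and> (\<forall>g\<in>G. (\<Sum>m\<in>E. c m * v m g) = 0)"
  using assms
proof (induction G arbitrary: E v)
  case empty
  then obtain m where "m \<in> E" by fastforce
  then show ?case by (intro exI[of _ "\<lambda>_. 1"]) auto
next
  case (insert g G)
  show ?case
  proof (cases "\<forall>m\<in>E. v m g = 0")
    case True
    obtain c where "\<exists>m\<in>E. c m \<noteq> 0" "\<forall>g\<in>G. (\<Sum>m\<in>E. c m * v m g) = 0"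
      using insert by (metis card_insert_disjoint Suc_lessD)
    then show ?thesis using True by (intro exI[of _ c]) simp
  next
    case False
    then obtain m0 where m0: "m0 \<in> E" "v m0 g \<noteq> 0" by blast
    define E' where "E' = E - {m0}"
    define w where "w m h = v m h - v m g / v m0 g * v m0 h" for m h
    have "card G < card E'" using insert m0 by (simp add: E'_def)
    then obtain c where c: "\<exists>m\<in>E'. c m \<noteq> 0" "\<And>h. h \<in> G \<Longrightarrow> (\<Sum>m\<in>E'. c m * w m h) = 0"
      using insert.IH[of E' w] insert.prems by (auto simp: E'_def)
    \<comment> \<open>Gaussian elimination with pivot \<open>v m0 g\<close>: this value of the
      eliminated unknown makes equation \<open>g\<close> hold.\<close>
    define c0 where "c0 = - (\<Sum>m\<in>E'. c m * v m g) / v m0 g"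
    define c' where "c' = c(m0 := c0)"
    have sum: "(\<Sum>m\<in>E. c' m * v m h) = c0 * v m0 h + (\<Sum>m\<in>E'. c m * v m h)" for h
    proof -
      have "(\<Sum>m\<in>E. c' m * v m h) = c' m0 * v m0 h + (\<Sum>m\<in>E'. c' m * v m h)"
        unfolding E'_def using insert.prems(1) m0(1) by (rule sum.remove)
      also have "(\<Sum>m\<in>E'. c' m * v m h) = (\<Sum>m\<in>E'. c m * v m h)"
        by (rule sum.cong) (auto simp: c'_def E'_def)
      finally show ?thesis by (simp add: c'_def)
    qed
    have "(\<Sum>m\<in>E. c' m * v m h) = 0" if "h \<in> insert g G" for h
    proof (cases "h = g")
      case True
      then show ?thesis using sum m0 by (simp add: c0_def)
    next
      case False
      have "c0 * v m0 h = - ((\<Sum>m\<in>E'. c m * v m g) * (v m0 h / v m0 g))" by (simp add: c0_def)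
      also have "(\<Sum>m\<in>E'. c m * v m g) * (v m0 h / v m0 g) =
          (\<Sum>m\<in>E'. c m * (v m g / v m0 g * v m0 h))"
        unfolding sum_distrib_right by (rule sum.cong) auto
      finally have "(\<Sum>m\<in>E. c' m * v m h) =
          (\<Sum>m\<in>E'. c m * v m h) - (\<Sum>m\<in>E'. c m * (v m g / v m0 g * v m0 h))"
        unfolding sum by simp
      also have "\<dots> = (\<Sum>m\<in>E'. c m * w m h)"
        by (simp add: w_def right_diff_distrib sum_subtractf)
      finally show ?thesis using c(2) False that by simp
    qed
    moreover have "\<exists>m\<in>E. c' m \<noteq> 0" using c(1) by (auto simp: c'_def E'_def)
    ultimately show ?thesis by blast
  qed
qed

lemma mdeg_add: "mdeg (u + v) = mdeg u + mdeg v"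
  by (simp add: mdeg_def lookup_add sum.distrib)

lemma lookup_le_mdeg: "pcoeff u i \<le> mdeg (u :: 'v::finite mpol_exp)"
  unfolding mdeg_def by (rule member_le_sum) auto

lemma mdeg_power_monomial:
  fixes as :: "('v::finite, 'k::field) mpol list"
  assumes "\<And>a u. a \<in> set as \<Longrightarrow> u \<in> pkeys a \<Longrightarrow> mdeg u \<le> D"
    and "\<And>n. n \<in> set ns \<Longrightarrow> n \<le> N" "u \<in> pkeys (power_monomial as ns)"
  shows "mdeg u \<le> length as * (N * D)"
  using assms
proof (induction as ns arbitrary: u rule: power_monomial.induct)
  case (1 a as n ns)
  have pow: "mdeg w \<le> n * D" if "w \<in> pkeys (a ^ n)" for w n
    using that
  proof (induction n arbitrary: w)
    case (Suc n)
    then obtain p q where pq: "w = p + q" "p \<in> pkeys a" "q \<in> pkeys (a ^ n)"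
      using keys_mult[of a "a ^ n"] by auto
    then show ?case using Suc.IH[of q] 1(2)[of a p] by (simp add: mdeg_add)
  qed (simp add: mdeg_def)
  from 1(4) obtain p q where pq: "u = p + q" "p \<in> pkeys (a ^ n)" "q \<in> pkeys (power_monomial as ns)"
    using keys_mult[of "a ^ n" "power_monomial as ns"] by auto
  have "mdeg q \<le> length as * (N * D)" using 1(1)[of q] 1(2,3) pq(3) by auto
  moreover have "mdeg p \<le> N * D"
    using pow[OF pq(2)] 1(3)[of n] by (meson le_trans list.set_intros(1) mult_le_mono1)
  ultimately show ?case by (simp add: pq(1) mdeg_add)
qed (auto simp: mdeg_def)

lemma finite_bounded_exps: "finite {u :: 'v::finite mpol_exp. pkeys u \<subseteq> S \<and> (\<forall>i. pcoeff u i \<le> D)}"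
  and card_bounded_exps:
    "card {u :: 'v::finite mpol_exp. pkeys u \<subseteq> S \<and> (\<forall>i. pcoeff u i \<le> D)} \<le> (D + 1) ^ card S"
proof -
  let ?X = "{u :: 'v mpol_exp. pkeys u \<subseteq> S \<and> (\<forall>i. pcoeff u i \<le> D)}"
  let ?Y = "S \<rightarrow>\<^sub>E {..D}"
  let ?h = "\<lambda>u :: 'v mpol_exp. restrict (pcoeff u) S"
  have "inj_on ?h ?X"
  proof (rule inj_onI)
    fix u v assume uv: "u \<in> ?X" "v \<in> ?X" "?h u = ?h v"
    show "u = v"
    proof (rule poly_mapping_eqI)
      fix i show "pcoeff u i = pcoeff v i"
      proof (cases "i \<in> S")
        case True then show ?thesis using uv(3) by (metis restrict_apply')
      next
        case False
        then have "i \<notin> pkeys u" "i \<notin> pkeys v" using uv by auto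
        then show ?thesis by (simp add: in_keys_iff)
      qed
    qed
  qed
  moreover have "?h ` ?X \<subseteq> ?Y" by auto
  moreover have "finite ?Y" by (intro finite_PiE) auto
  ultimately show "finite ?X" "card ?X \<le> (D + 1) ^ card S"
    using inj_on_finite[of ?h ?X ?Y] card_inj_on_le[of ?h ?X ?Y] by (auto simp: card_PiE)
qed

text \<open>A count. With exponents up to \<open>N\<close> there are \<open>(N + 1) ^ k\<close>
  products of the \<open>k\<close> given elements, and modulo the ideal they lie in the span of the
  monomials of degree at most \<open>k * N * D\<close> supported on faces. The number of these is at
  most a constant times \<open>(N + 1) ^ d\<close>, and \<open>d < k\<close>.\<close>

lemma algebraic_dependence:
  fixes as :: "('v::finite, 'k::field) mpol list"
  assumes d: "\<And>S. S \<notin> U \<Longrightarrow> card S \<le> d" and len: "d < length as"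
  shows "\<exists>E c. finite E \<and> E \<noteq> {} \<and> (\<forall>m\<in>E. length m = length as \<and> c m dvd 1) \<and>
    (\<Sum>m\<in>E. c m * power_monomial as m) \<in> squarefree_ideal U"
proof -
  define k where "k = length as"
  define D where "D = Max (insert 0 (\<Union>a\<in>set as. mdeg ` pkeys a))"
  have D: "mdeg u \<le> D" if "a \<in> set as" "u \<in> pkeys a" for a u
    unfolding D_def using that by (intro Max_ge) auto
  \<comment> \<open>The power of two bounds the number of faces, and \<open>(k * D + 1) ^ d\<close>
    accounts for passing from the degree bound \<open>T\<close> to \<open>N\<close>. Taking
    \<open>N = C\<close> gives \<open>C < N + 1\<close>, which decides the comparison.\<close>
  define C where "C = 2 ^ card (UNIV :: 'v set) * (k * D + 1) ^ d"
  define N where "N = C"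
  define T where "T = k * (N * D)"
  define E0 where "E0 = {m. set m \<subseteq> {..N} \<and> length m = k}"
  define G where "G = {u :: 'v mpol_exp. mdeg u \<le> T \<and> pkeys u \<notin> U}"
  have E0: "finite E0" "card E0 = (N + 1) ^ k"
    unfolding E0_def by (simp_all add: finite_lists_length_eq card_lists_length_eq)
  let ?B = "\<lambda>S. {u :: 'v mpol_exp. pkeys u \<subseteq> S \<and> (\<forall>i. pcoeff u i \<le> T)}"
  have G: "G \<subseteq> (\<Union>S\<in>- U. ?B S)"
    unfolding G_def using lookup_le_mdeg le_trans by blast
  have finG: "finite G"
    by (rule finite_subset[OF G]) (auto simp: finite_bounded_exps)
  have "card G \<le> card (\<Union>S\<in>- U. ?B S)"
    using G by (intro card_mono) (auto simp: finite_bounded_exps)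
  also have "\<dots> \<le> (\<Sum>S\<in>- U. card (?B S))" by (rule card_UN_le) simp
  also have "\<dots> \<le> (\<Sum>S\<in>- U. (T + 1) ^ d)"
  proof (rule sum_mono)
    fix S assume "S \<in> - U"
    then have "(T + 1) ^ card S \<le> (T + 1) ^ d" using d by (intro power_increasing) auto
    then show "card (?B S) \<le> (T + 1) ^ d" using card_bounded_exps[of S T] by linarith
  qed
  also have "\<dots> = card (- U) * (T + 1) ^ d" by simp
  also have "\<dots> \<le> 2 ^ card (UNIV :: 'v set) * (T + 1) ^ d"
    using card_mono[of "Pow (UNIV :: 'v set)" "- U"] by (simp add: card_Pow)
  also have "\<dots> \<le> 2 ^ card (UNIV :: 'v set) * ((k * D + 1) * (N + 1)) ^ d"
  proof -
    have "T + 1 \<le> (k * D + 1) * (N + 1)" by (simp add: T_def)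
    then show ?thesis by (intro mult_le_mono power_mono) auto
  qed
  also have "\<dots> = C * (N + 1) ^ d" unfolding C_def power_mult_distrib by (simp only: mult.assoc)
  also have "\<dots> < (N + 1) * (N + 1) ^ d" by (simp add: N_def)
  also have "\<dots> = (N + 1) ^ Suc d" by simp
  also have "\<dots> \<le> card E0" unfolding E0 using len by (intro power_increasing) (auto simp: k_def)
  finally obtain c where c: "\<exists>m\<in>E0. c m \<noteq> 0"
      "\<And>g. g \<in> G \<Longrightarrow> (\<Sum>m\<in>E0. c m * pcoeff (power_monomial as m) g) = 0"
    using linear_dependence[OF finG E0(1), of "\<lambda>m. pcoeff (power_monomial as m)"] by blast
  \<comment> \<open>Only nonzero scalars are kept, so that all coefficients are units, as the
    cancellation argument requires.\<close>
  define E where "E = {m \<in> E0. c m \<noteq> 0}"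
  define c' where "c' m = (single 0 (c m) :: ('v, 'k) mpol)" for m
  let ?f = "\<Sum>m\<in>E. c' m * power_monomial as m"
  have c'_coeff: "pcoeff (c' m * f) u = c m * pcoeff f u" for m f u
    unfolding c'_def by (subst expand_poly[of f])
      (simp add: sum_distrib_left mult_single lookup_sum lookup_single when_def in_keys_iff)
  have f: "pcoeff ?f u = (\<Sum>m\<in>E0. c m * pcoeff (power_monomial as m) u)" for u
    unfolding lookup_sum c'_coeff by (rule sum.mono_neutral_left) (auto simp: E_def E0)
  have "?f \<in> squarefree_ideal U"
    unfolding squarefree_ideal_def
  proof safe
    fix u assume u: "u \<in> pkeys ?f"
    have "u \<notin> G" using u f[of u] c(2)[of u] by (auto simp: in_keys_iff)
    moreover have "mdeg u \<le> T"
    proof -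
      have "pcoeff ?f u \<noteq> 0" using u by (simp add: in_keys_iff)
      then obtain m where m: "m \<in> E" "pcoeff (power_monomial as m) u \<noteq> 0"
        unfolding lookup_sum c'_coeff by (metis (no_types, lifting) mult_zero_right sum.neutral)
      then show ?thesis
        unfolding T_def k_def using D mdeg_power_monomial[of as D m N u]
        by (auto simp: E_def E0_def in_keys_iff)
    qed
    ultimately show "pkeys u \<in> U" by (simp add: G_def)
  qed
  moreover have "c' m dvd 1" if "m \<in> E" for m
  proof -
    have "c' m * single 0 (inverse (c m)) = 1"
      using that by (simp add: c'_def E_def mult_single)
    then show ?thesis by (metis dvd_triv_left)
  qed
  moreover have "finite E" "E \<noteq> {}" using E0 c(1) by (auto simp: E_def)
  ultimately show ?thesis by (intro exI[of _ E] exI[of _ c']) (auto simp: E_def E0_def k_def)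
qed

text \<open>The dependence relation lies in the annihilator of \<open>L/K\<close>, so it kills every
  \<open>x\<close> in \<open>L\<close> modulo \<open>K\<close>, and reading it along the chain
  forces \<open>x\<close> into \<open>Z\<close>.\<close>

lemma cancel_chain_long:
  fixes as :: "('v::finite, 'k::field) mpol list"
  assumes "cancel_chain as L K Z" "tideal L" "tideal K" "squarefree_ideal U \<subseteq> colon K L"
    and "\<And>S. S \<notin> U \<Longrightarrow> card S \<le> d" "d < length as"
  shows "L \<subseteq> Z"
proof
  fix x assume x: "x \<in> L"
  have "\<exists>E c. finite E \<and> E \<noteq> {} \<and> (\<forall>m\<in>E. length m = length as \<and> c m dvd 1) \<and>
      (\<Sum>m\<in>E. c m * power_monomial as m) \<in> squarefree_ideal U"
    by (rule algebraic_dependence) (use assms(5,6) in auto)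
  then obtain E c where Ec: "finite E" "E \<noteq> {}" "\<forall>m\<in>E. length m = length as \<and> c m dvd 1"
    "(\<Sum>m\<in>E. c m * power_monomial as m) \<in> squarefree_ideal U"
    by (elim exE conjE)
  have rel: "(\<Sum>m\<in>E. c m * power_monomial as m * x) \<in> K"
  proof -
    have "(\<Sum>m\<in>E. c m * power_monomial as m) * x \<in> K"
      using subsetD[OF assms(4) Ec(4)] x by (simp add: colon_def)
    then show ?thesis by (simp add: sum_distrib_right)
  qed
  show "x \<in> Z" by (rule cancel_chain_relation[OF assms(1-3) x Ec(1,2) _ rel]) (use Ec(3) in auto)
qed

lemma quot_dim_le:
  fixes A :: "('v::finite, 'k::field) mpol set"
  assumes "squarefree_ideal U \<subseteq> A" "\<And>S. S \<notin> U \<Longrightarrow> card S \<le> d"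
  shows "quot_dim A \<le> enat d"
  unfolding quot_dim_def
proof (rule Sup_least, safe)
  fix k P assume P: "prime_chain A k P"
  show "enat k \<le> enat d"
  proof (rule ccontr)
    assume "\<not> ?thesis"
    then have k: "d < k" by simp
    obtain as where as: "length as = k" "cancel_chain as UNIV (P 0) (P k)"
      using prime_chain_cancel_chain[OF P] by blast
    have P0: "tprime (P 0)" "A \<subseteq> P 0" "tprime (P k)" using P by (auto simp: prime_chain_def)
    have "squarefree_ideal U \<subseteq> colon (P 0) UNIV"
      using assms(1) P0(2) tideal_mult2[OF tprime_tideal[OF P0(1)]] by (auto simp: colon_def)
    then have "UNIV \<subseteq> P k"
      using cancel_chain_long[OF as(2) tideal_UNIV tprime_tideal[OF P0(1)] _ assms(2)] as(1) k by auto
    then show False using P0(3) by (auto simp: tprime_def)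
  qed
qed

lemma pair_depth_le:
  fixes L :: "('v::finite, 'k::field) mpol set"
  assumes "tideal L" "tideal K" "K \<subseteq> L" "squarefree_ideal U \<subseteq> colon K L"
    and "\<And>S. S \<notin> U \<Longrightarrow> card S \<le> d"
  shows "pair_depth m L K \<le> enat d"
  unfolding pair_depth_def
proof (rule Sup_least)
  fix x assume "x \<in> {enat (length as) |as.
    set as \<subseteq> m \<and> weakly_regular as L K \<and> ideal_steps as L K \<noteq> L}"
  then obtain as where x: "x = enat (length as)"
    and as: "weakly_regular as L K" "ideal_steps as L K \<noteq> L" by blast
  show "x \<le> enat d"
  proof (rule ccontr)
    assume "\<not> ?thesis"
    then have "d < length as" by (simp add: x)
    then have "L \<subseteq> ideal_steps as L K"
      using weakly_regular_cancel_chain[OF assms(1,2) as(1)] assms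
      by (intro cancel_chain_long[of as L K _ U d]) auto
    then show False using as(2) ideal_steps_subset[OF assms(1,3), of as] by blast
  qed
qed

text \<open>Adjoining the variables outside \<open>V\<close> one at a time gives a chain of
  coordinate primes with \<open>card (- V)\<close> steps.\<close>

lemma quot_dim_ge:
  fixes A :: "('v::{finite,linorder}, 'k::field) mpol set"
  assumes "A \<subseteq> face_ideal V"
  shows "enat (card (- V)) \<le> quot_dim A"
proof -
  obtain xs where xs: "set xs = - V" "distinct xs" using finite_distinct_list[of "- V"] by auto
  define P where "P i = (face_ideal (V \<union> set (take i xs)) :: ('v, 'k) mpol set)" for i
  have "prime_chain A (length xs) P"
    unfolding prime_chain_def
  proof (intro conjI allI impI)
    fix i
    show "tprime (P i)" by (simp add: P_def tprime_face_ideal)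
    show "A \<subseteq> P i" using assms face_ideal_mono[of V "V \<union> set (take i xs)"] by (auto simp: P_def)
    assume i: "i < length xs"
    have "P i \<subseteq> P (Suc i)"
      unfolding P_def using i by (intro face_ideal_mono) (auto simp: take_Suc_conv_app_nth)
    moreover have "pvar (xs ! i) \<in> P (Suc i)"
      using i by (simp add: P_def take_Suc_conv_app_nth)
    moreover have "pvar (xs ! i) \<notin> P i"
    proof -
      have "xs ! i \<notin> V" using xs i nth_mem by auto
      moreover have "xs ! i \<notin> set (take i xs)"
        using xs(2) i by (auto simp: in_set_conv_nth nth_eq_iff_index_eq)
      ultimately show ?thesis by (simp add: P_def)
    qed
    ultimately show "P i \<subset> P (Suc i)" by blast
  qed
  then have "enat (length xs) \<le> quot_dim A" unfolding quot_dim_def by (intro Sup_upper) blast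
  then show ?thesis using distinct_card[OF xs(2)] xs(1) by simp
qed

section \<open>Ideals generated by monomials\<close>

lemma Idl_least: "tideal I \<Longrightarrow> S \<subseteq> I \<Longrightarrow> Idl\<^bsub>type_ring\<^esub> S \<subseteq> I"
  by (auto simp: genideal_def)

lemma Idl_superset: "S \<subseteq> Idl\<^bsub>type_ring\<^esub> S"
  by (auto simp: genideal_def)

lemma tideal_Idl: "tideal (Idl\<^bsub>type_ring\<^esub> (S :: 'r::comm_ring_1 set))"
proof -
  interpret cring "type_ring :: 'r ring" ..
  show ?thesis by (rule genideal_ideal) simp
qed

lemma Idl_monomials:
  fixes S :: "'v mpol_exp set"
  shows "Idl\<^bsub>mpol_ring\<^esub> (monomial ` S :: ('v, 'k::field) mpol set) =
    {f. \<forall>u\<in>pkeys f. \<exists>s\<in>S. \<exists>t. u = s + t}"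
proof
  let ?I = "{f :: ('v, 'k) mpol. \<forall>u\<in>pkeys f. \<exists>s\<in>S. \<exists>t. u = s + t}"
  have "tideal ?I"
    unfolding tideal_iff
  proof (intro conjI ballI allI)
    fix f g assume fg: "f \<in> ?I" "g \<in> ?I"
    then show "f + g \<in> ?I" using keys_add[of f g] by blast
  next
    fix r f assume f: "f \<in> ?I"
    show "r * f \<in> ?I"
    proof safe
      fix u assume "u \<in> pkeys (r * f)"
      then obtain a b where ab: "u = a + b" "b \<in> pkeys f" using keys_mult[of r f] by blast
      then obtain s t where "s \<in> S" "b = s + t" using f by blast
      then show "\<exists>s\<in>S. \<exists>t. u = s + t"
        using ab by (intro bexI[of _ s] exI[of _ "a + t"]) (auto simp: ac_simps)
    qed
  qed simp
  then show "Idl\<^bsub>mpol_ring\<^esub> (monomial ` S) \<subseteq> ?I"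
    by (rule Idl_least) (auto intro!: exI[of _ 0] simp: add_0_right)
  show "?I \<subseteq> Idl\<^bsub>mpol_ring\<^esub> (monomial ` S)"
  proof
    fix f assume f: "f \<in> ?I"
    show "f \<in> Idl\<^bsub>mpol_ring\<^esub> (monomial ` S)"
    proof (rule tideal_monomials[OF tideal_Idl])
      fix u assume "u \<in> pkeys f"
      then obtain s t where "s \<in> S" "u = t + s" using f by (auto simp: add.commute)
      then show "monomial u \<in> Idl\<^bsub>mpol_ring\<^esub> (monomial ` S)"
        using Idl_superset[of "monomial ` S"] tideal_mult[OF tideal_Idl] by (auto simp: monomial_add)
    qed
  qed
qed

lemma exp_split_single:
  fixes u :: "'v mpol_exp"
  assumes "i \<in> pkeys u"
  shows "\<exists>t. u = single i 1 + t"
proof (intro exI)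
  show "u = single i 1 + (u - single i 1)"
    by (rule poly_mapping_eqI) (use assms in \<open>auto simp: lookup_add lookup_minus lookup_single when_def in_keys_iff\<close>)
qed

lemma Idl_pvars:
  "Idl\<^bsub>mpol_ring\<^esub> (pvar ` V) = (face_ideal V :: ('v, 'k::field) mpol set)"
proof -
  have 1: "pvar ` V = (monomial ` ((\<lambda>i. single i 1) ` V) :: ('v, 'k) mpol set)"
    by (simp add: image_image pvar_def)
  have "(\<exists>s\<in>(\<lambda>i. single i 1) ` V. \<exists>t. u = s + t) \<longleftrightarrow> pkeys u \<inter> V \<noteq> {}" for u :: "'v mpol_exp"
    using exp_split_single[of _ u] by (auto simp: keys_add_nat)
  then show ?thesis
    unfolding 1 Idl_monomials by (simp add: face_ideal_def squarefree_ideal_def)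
qed

lemma graded_max_ideal_eq: "graded_max_ideal = face_ideal UNIV"
  unfolding graded_max_ideal_def by (rule Idl_pvars)

definition sqfree_exp :: "'v::finite set \<Rightarrow> 'v mpol_exp" where
  "sqfree_exp S = (\<Sum>i\<in>S. single i 1)"

lemma coeff_sqfree_exp: "pcoeff (sqfree_exp S) i = (if i \<in> S then 1 else 0)"
  by (simp add: sqfree_exp_def lookup_sum lookup_single when_def)

lemma keys_sqfree_exp [simp]: "pkeys (sqfree_exp S) = S"
  by (auto simp: in_keys_iff coeff_sqfree_exp split: if_splits)

lemma sqfree_exp_dvd_iff: "(\<exists>t. u = sqfree_exp S + t) \<longleftrightarrow> S \<subseteq> pkeys u"
proof
  assume "S \<subseteq> pkeys u"
  then have "u = sqfree_exp S + (u - sqfree_exp S)"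
    by (intro poly_mapping_eqI) (auto simp: lookup_add lookup_minus coeff_sqfree_exp in_keys_iff)
  then show "\<exists>t. u = sqfree_exp S + t" ..
qed (auto simp: keys_add_nat)

text \<open>A divisor with full support already uses every exponent of the squarefree monomial,
  which leaves nothing for \<open>p\<close>.\<close>

lemma sqfree_exp_split:
  assumes "sqfree_exp S = p + q" "pkeys q = S"
  shows "p = 0" "q = sqfree_exp S"
proof -
  have "pcoeff p i = 0" for i
  proof -
    have "pcoeff p i + pcoeff q i = (if i \<in> S then 1 else 0)"
      using assms(1) by (metis coeff_sqfree_exp lookup_add)
    moreover have "i \<in> S \<longleftrightarrow> pcoeff q i \<noteq> 0" using assms(2) by (auto simp: in_keys_iff)
    ultimately show ?thesis by (auto split: if_splits)
  qed
  then show "p = 0" by (intro poly_mapping_eqI) simp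
  then show "q = sqfree_exp S" using assms(1) by simp
qed

text \<open>Combinatorially this passes to the star of \<open>\<sigma>\<close>: a set is a face of
  the colon ideal when its union with \<open>\<sigma>\<close> is a face.\<close>

lemma colon_monomial:
  "colon (squarefree_ideal U) {monomial (sqfree_exp \<sigma>)} = squarefree_ideal {S. S \<union> \<sigma> \<in> U}"
  by (auto simp: colon_def squarefree_ideal_def mult.commute[of _ "monomial _"] keys_monomial_mult
      keys_add_nat Un_commute)

text \<open>Adjoining one squarefree monomial deletes from the complex exactly the faces that
  contain \<open>\<sigma>\<close>.\<close>

lemma ideal_step_monomial:
  assumes "upset U"
  shows "ideal_step (monomial (sqfree_exp \<sigma>)) UNIV (squarefree_ideal U) =
    (squarefree_ideal (U \<union> {S. \<sigma> \<subseteq> S}) :: ('v::finite, 'k::field) mpol set)"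
proof -
  have up: "upset (U \<union> {S. \<sigma> \<subseteq> S})" using assms by (auto simp: upset_def)
  show ?thesis
  proof
    show "ideal_step (monomial (sqfree_exp \<sigma>)) UNIV (squarefree_ideal U) \<subseteq>
        (squarefree_ideal (U \<union> {S. \<sigma> \<subseteq> S}) :: ('v, 'k) mpol set)"
      using tidealD[OF tideal_squarefree_ideal[OF up, where ?'b = 'k]]
        squarefree_ideal_mono[of U "U \<union> {S. \<sigma> \<subseteq> S}", where ?'b = 'k]
      by (auto elim!: ideal_stepE)
    show "squarefree_ideal (U \<union> {S. \<sigma> \<subseteq> S}) \<subseteq>
        (ideal_step (monomial (sqfree_exp \<sigma>)) UNIV (squarefree_ideal U) :: ('v, 'k) mpol set)"
    proof
      fix f :: "('v, 'k) mpol" assume f: "f \<in> squarefree_ideal (U \<union> {S. \<sigma> \<subseteq> S})"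
      let ?I = "ideal_step (monomial (sqfree_exp \<sigma>)) UNIV (squarefree_ideal U) :: ('v, 'k) mpol set"
      have "tideal ?I" by (intro tideal_ideal_step tideal_UNIV tideal_squarefree_ideal assms)
      then show "f \<in> ?I"
      proof (rule tideal_monomials)
        fix u assume "u \<in> pkeys f"
        then consider "pkeys u \<in> U" | "\<sigma> \<subseteq> pkeys u" using f by (auto simp: squarefree_ideal_def)
        then show "monomial u \<in> ?I"
        proof cases
          case 1
          then have "monomial u \<in> (squarefree_ideal U :: ('v, 'k) mpol set)" by simp
          then show ?thesis using ideal_step_superset[OF tideal_UNIV] by blast
        next
          case 2
          then obtain t where t: "u = sqfree_exp \<sigma> + t" using sqfree_exp_dvd_iff by blast
          show ?thesis
            unfolding t monomial_add by (intro ideal_step_mult tideal_squarefree_ideal assms UNIV_I)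
        qed
      qed
    qed
  qed
qed

lemma colon_squarefree_superset:
  assumes "upset U'" "\<And>S T. S \<in> U \<Longrightarrow> T \<in> W \<Longrightarrow> S \<union> T \<in> U'"
  shows "squarefree_ideal W \<subseteq> colon (squarefree_ideal U') (squarefree_ideal U)"
proof
  fix f :: "('a, 'b) mpol" assume f: "f \<in> squarefree_ideal W"
  show "f \<in> colon (squarefree_ideal U') (squarefree_ideal U)"
    unfolding colon_def squarefree_ideal_def
  proof safe
    fix g :: "('a, 'b) mpol" and u assume g: "\<forall>u\<in>pkeys g. pkeys u \<in> U" and "u \<in> pkeys (f * g)"
    then obtain a b where ab: "u = a + b" "a \<in> pkeys f" "b \<in> pkeys g" using keys_mult[of f g] by blast
    then show "pkeys u \<in> U'"
      using assms(2)[of "pkeys b" "pkeys a"] f g by (auto simp: squarefree_ideal_def keys_add_nat Un_commute)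
  qed
qed

lemma upsetD: "upset U \<Longrightarrow> S \<in> U \<Longrightarrow> S \<subseteq> T \<Longrightarrow> T \<in> U"
  by (auto simp: upset_def)

text \<open>It suffices to test on the single monomial of \<open>\<sigma>\<close>, whose colon ideal
  has \<open>F\<close> as a face.\<close>

lemma colon_squarefree_subset:
  fixes U :: "'v::finite set set"
  assumes "\<sigma> \<in> U" "F \<union> \<sigma> \<notin> U'" "upset U'"
  shows "colon (squarefree_ideal U') (squarefree_ideal U) \<subseteq> face_ideal (- F)"
proof -
  have "colon (squarefree_ideal U') (squarefree_ideal U) \<subseteq>
      colon (squarefree_ideal U') {monomial (sqfree_exp \<sigma>)}"
    using assms(1) by (auto simp: colon_def)
  also have "\<dots> = squarefree_ideal {S. S \<union> \<sigma> \<in> U'}" by (rule colon_monomial)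
  also have "\<dots> \<subseteq> face_ideal (- F)"
  proof (rule squarefree_ideal_subset_face_ideal)
    show "upset {S. S \<union> \<sigma> \<in> U'}"
      unfolding upset_def by (auto intro: upsetD[OF assms(3)])
  qed (use assms(2) in simp)
  finally show ?thesis .
qed

text \<open>The monomial of a minimal element of \<open>U\<close> has coefficient zero in every multiple, by an element
  of the graded maximal ideal, of an element of the ideal of \<open>U\<close>.\<close>

lemma ideal_steps_neq:
  fixes as :: "('v::finite, 'k::field) mpol list"
  assumes up: "upset U" "upset U'" "U' \<subseteq> U"
    and \<sigma>: "\<sigma> \<in> U" "\<sigma> \<notin> U'" "\<And>\<tau>. \<tau> \<subset> \<sigma> \<Longrightarrow> \<tau> \<notin> U"
    and as: "set as \<subseteq> graded_max_ideal"
  shows "ideal_steps as (squarefree_ideal U) (squarefree_ideal U') \<noteq> squarefree_ideal U"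
proof
  assume eq: "ideal_steps as (squarefree_ideal U) (squarefree_ideal U') = squarefree_ideal U"
  let ?Z = "{f :: ('v, 'k) mpol. f \<in> squarefree_ideal U \<and> sqfree_exp \<sigma> \<notin> pkeys f}"
  have split: "p = 0 \<and> q = sqfree_exp \<sigma>" if "sqfree_exp \<sigma> = p + q" "pkeys q \<in> U" for p q
  proof -
    have "pkeys q \<subseteq> \<sigma>" using arg_cong[OF that(1), of pkeys] by (simp add: keys_add_nat)
    then have "pkeys q = \<sigma>" using \<sigma>(3)[of "pkeys q"] that(2) by blast
    then show ?thesis using sqfree_exp_split[OF that(1)] by blast
  qed
  note id = tidealD[OF tideal_squarefree_ideal[OF up(1), where ?'b = 'k]]
  have Z: "tideal ?Z"
    unfolding tideal_iff
  proof (intro conjI ballI allI)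
    fix x y assume "x \<in> ?Z" "y \<in> ?Z"
    then show "x + y \<in> ?Z" using keys_add[of x y] id by blast
  next
    fix r x assume x: "x \<in> ?Z"
    have "sqfree_exp \<sigma> \<notin> pkeys (r * x)"
    proof
      assume "sqfree_exp \<sigma> \<in> pkeys (r * x)"
      then obtain p q where "sqfree_exp \<sigma> = p + q" "q \<in> pkeys x" using keys_mult[of r x] by blast
      then show False using split[of p q] x by (auto simp: squarefree_ideal_def)
    qed
    then show "r * x \<in> ?Z" using x id by blast
  qed (use id in simp)
  have "ideal_steps as (squarefree_ideal U) (squarefree_ideal U') \<subseteq> ?Z"
  proof (rule ideal_steps_least[OF Z])
    show "squarefree_ideal U' \<subseteq> ?Z" using up(3) \<sigma>(2) by (auto simp: squarefree_ideal_def)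
    fix a x :: "('v, 'k) mpol" assume a: "a \<in> set as" and x: "x \<in> squarefree_ideal U"
    have "sqfree_exp \<sigma> \<notin> pkeys (a * x)"
    proof
      assume "sqfree_exp \<sigma> \<in> pkeys (a * x)"
      then obtain p q where pq: "sqfree_exp \<sigma> = p + q" "p \<in> pkeys a" "q \<in> pkeys x"
        using keys_mult[of a x] by blast
      then have "p = 0" using split[of p q] x by (auto simp: squarefree_ideal_def)
      then show False
        using pq(2) a as by (auto simp: graded_max_ideal_eq face_ideal_def squarefree_ideal_def)
    qed
    then show "a * x \<in> ?Z" using x id by blast
  qed
  moreover have "monomial (sqfree_exp \<sigma>) \<in> (squarefree_ideal U :: ('v, 'k) mpol set)" using \<sigma>(1) by simp
  ultimately show False using eq by fastforce
qed

text \<open>The sequence \<open>as\<close> bounds the depth from below. By \<open>dim\<close> every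
  monomial in more than \<open>length as\<close> variables annihilates the module, which bounds
  depth and dimension from above, and \<open>F\<close> attains the dimension by a chain of
  coordinate primes. The minimal \<open>\<sigma>\<close> ensures that the module is not zero modulo
  \<open>as\<close>.\<close>

lemma squarefree_pair_CM:
  fixes as :: "('v::{finite,linorder}, 'k::field) mpol list"
  assumes up: "upset U" "upset U'" "U' \<subseteq> U"
    and \<sigma>: "\<sigma> \<in> U" "\<sigma> \<notin> U'" "\<And>\<tau>. \<tau> \<subset> \<sigma> \<Longrightarrow> \<tau> \<notin> U"
    and dim: "\<And>S T. S \<in> U \<Longrightarrow> length as < card T \<Longrightarrow> S \<union> T \<in> U'"
    and F: "\<tau> \<in> U" "F \<union> \<tau> \<notin> U'" "card F = length as"
    and as: "set as \<subseteq> graded_max_ideal"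
      "weakly_regular as (squarefree_ideal U) (squarefree_ideal U')"
  defines "L \<equiv> squarefree_ideal U :: ('v, 'k) mpol set"
    and "K \<equiv> squarefree_ideal U' :: ('v, 'k) mpol set"
  shows "pair_CM graded_max_ideal L K" "quot_dim (colon K L) = enat (length as)"
proof -
  let ?W = "{T :: 'v set. length as < card T}"
  have id: "tideal L" "tideal K" "K \<subseteq> L"
    using up by (auto simp: L_def K_def tideal_squarefree_ideal squarefree_ideal_mono)
  have W: "squarefree_ideal ?W \<subseteq> colon K L"
    unfolding L_def K_def using dim by (intro colon_squarefree_superset up) auto
  have dim1: "quot_dim (colon K L) \<le> enat (length as)"
    by (rule quot_dim_le[OF W]) auto
  have "colon K L \<subseteq> face_ideal (- F)"
    unfolding L_def K_def using F up by (intro colon_squarefree_subset)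
  then have "enat (card (- (- F))) \<le> quot_dim (colon K L)" by (rule quot_dim_ge)
  then show qd: "quot_dim (colon K L) = enat (length as)" using dim1 F(3) by simp
  have "pair_depth graded_max_ideal L K \<le> enat (length as)"
    by (rule pair_depth_le[OF id W]) auto
  moreover have "enat (length as) \<le> pair_depth graded_max_ideal L K"
    unfolding pair_depth_def using as ideal_steps_neq[OF up \<sigma> as(1)]
    by (intro Sup_upper) (auto simp: L_def K_def)
  ultimately show "pair_CM graded_max_ideal L K" unfolding pair_CM_def qd by simp
qed

lemma ideal_step_face:
  fixes \<theta> :: "('v::finite, 'k::field) mpol"
  assumes "\<theta> - pvar i \<in> face_ideal V"
  shows "ideal_step \<theta> UNIV (face_ideal V) = face_ideal (insert i V)"
proof
  note id = tidealD[OF tideal_face_ideal]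
  let ?I = "ideal_step \<theta> UNIV (face_ideal V)"
  have "pvar i \<in> face_ideal (insert i V)" by simp
  moreover have sub: "face_ideal V \<subseteq> (face_ideal (insert i V) :: ('v, 'k) mpol set)"
    by (rule face_ideal_mono) auto
  ultimately have "(\<theta> - pvar i) + pvar i \<in> face_ideal (insert i V)"
    using assms id(2) by blast
  then have "\<theta> \<in> face_ideal (insert i V)" by simp
  then show "?I \<subseteq> face_ideal (insert i V)"
    using sub by (auto elim!: ideal_stepE intro!: tideal_add[OF tideal_face_ideal]
        tideal_mult2[OF tideal_face_ideal])
  have I: "tideal ?I" by (intro tideal_ideal_step tideal_UNIV tideal_face_ideal)
  have V: "face_ideal V \<subseteq> ?I" by (rule ideal_step_superset[OF tideal_UNIV])
  \<comment> \<open>Subtracting from \<open>\<theta>\<close> its deviation from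
    \<open>pvar i\<close> recovers the variable itself.\<close>
  have "\<theta> * 1 + - (\<theta> - pvar i) \<in> ?I" using id(5)[OF assms] by (intro ideal_stepI) auto
  then have "pvar i \<in> ?I" by simp
  then have "pvar ` insert i V \<subseteq> ?I" using V by auto
  then have "Idl\<^bsub>mpol_ring\<^esub> (pvar ` insert i V) \<subseteq> ?I" by (rule Idl_least[OF I])
  then show "face_ideal (insert i V) \<subseteq> ?I" by (simp only: Idl_pvars)
qed

text \<open>Modulo the coordinate prime the new element is the variable \<open>i\<close>, a
  nonzerodivisor, and dividing by it adjoins \<open>i\<close> to the prime.\<close>

lemma weakly_regular_face_Cons:
  fixes \<theta> :: "('v::{finite,linorder}, 'k::field) mpol"
  assumes "\<theta> - pvar i \<in> face_ideal V" "i \<notin> V" "weakly_regular as UNIV (face_ideal (insert i V))"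
  shows "weakly_regular (\<theta> # as) UNIV (face_ideal V)"
proof -
  have "\<theta> \<notin> face_ideal V"
    using assms(1,2) tideal_diff[OF tideal_face_ideal[of V], of \<theta> "\<theta> - pvar i"] by auto
  then show ?thesis using assms(3) ideal_step_face[OF assms(1)]
    by (auto simp: tprime_mult[OF tprime_face_ideal])
qed

text \<open>Modulo \<open>e1\<close> the product \<open>pvar i * pvar j\<close> becomes
  \<open>- (pvar i ^ 2)\<close>, so regularity of \<open>e2\<close> modulo \<open>e1\<close> follows
  from that of \<open>pvar i\<close>, applied twice. The latter is seen by working modulo
  \<open>pvar i\<close>, where \<open>e1\<close> becomes \<open>pvar j\<close>.\<close>

lemma weakly_regular_face_edge:
  fixes e1 e2 :: "('v::{finite,linorder}, 'k::field) mpol"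
  assumes ij: "i \<notin> V" "j \<notin> V" "i \<noteq> j"
    and e1: "e1 - (pvar i + pvar j) \<in> face_ideal V"
    and e2: "e2 - pvar i * pvar j \<in> face_ideal V"
  shows "weakly_regular [e1, e2] UNIV (face_ideal V)"
proof -
  let ?P = "face_ideal V :: ('v, 'k) mpol set"
  note id = tidealD[OF tideal_face_ideal[of V, where ?'b = 'k]]
  have prime: "tprime ?P" by (rule tprime_face_ideal)
  define xi xj where "xi = (pvar i :: ('v, 'k) mpol)" and "xj = (pvar j :: ('v, 'k) mpol)"
  have x: "xi \<notin> ?P" "xj \<notin> ?P" using ij by (auto simp: xi_def xj_def)
  define p1 p2 where "p1 = e1 - (xi + xj)" and "p2 = e2 - xi * xj"
  have p: "p1 \<in> ?P" "p2 \<in> ?P" using e1 e2 by (auto simp: p1_def p2_def xi_def xj_def)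
  have e1': "e1 = xi + xj + p1" and e2': "e2 = xi * xj + p2" by (simp_all add: p1_def p2_def)
  have "pvar i + pvar j \<notin> ?P"
  proof
    assume "pvar i + pvar j \<in> ?P"
    then have "pvar i + pvar j \<in> (face_ideal (insert i V) :: ('v, 'k) mpol set)"
      using face_ideal_mono[of V "insert i V"] by blast
    then have "pvar j \<in> (face_ideal (insert i V) :: ('v, 'k) mpol set)"
      using tideal_diff[OF tideal_face_ideal, of "pvar i + pvar j" "insert i V" "pvar i"] by simp
    then show False using ij by simp
  qed
  then have e1n: "e1 \<notin> ?P" using e1 id(6)[of e1 "e1 - (pvar i + pvar j)"] by auto
  have A: "\<exists>u. f - e1 * u \<in> ?P" if "xi * f - e1 * g \<in> ?P" for f g
  proof -
    have gj: "xj * g \<in> face_ideal (insert i V)"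
    proof -
      have "face_ideal V \<subseteq> (face_ideal (insert i V) :: ('v, 'k) mpol set)"
        by (rule face_ideal_mono) auto
      then have "xi * f - e1 * g \<in> face_ideal (insert i V)" "p1 \<in> face_ideal (insert i V)"
        using that p by auto
      moreover have "xi \<in> face_ideal (insert i V)" by (simp add: xi_def)
      moreover have "xj * g = xi * (f - g) - p1 * g - (xi * f - e1 * g)"
        by (simp add: e1' algebra_simps)
      ultimately show ?thesis using tidealD(4,6)[OF tideal_face_ideal[of "insert i V"]] by metis
    qed
    have "xj \<notin> face_ideal (insert i V)" using ij by (simp add: xj_def)
    then have "g \<in> face_ideal (insert i V)" using gj by (simp add: tprime_mult[OF tprime_face_ideal])
    also have "face_ideal (insert i V) = ideal_step xi UNIV ?P"
      by (rule ideal_step_face[symmetric]) (simp add: xi_def id)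
    finally obtain u where u: "g - xi * u \<in> ?P" by (auto simp: ideal_step_UNIV_iff)
    have "xi * (f - e1 * u) = (xi * f - e1 * g) + e1 * (g - xi * u)"
      by (simp add: algebra_simps)
    also have "\<dots> \<in> ?P" using that u id by blast
    finally show ?thesis using x(1) prime by (auto simp: tprime_mult)
  qed
  have B: "\<exists>u. f - e1 * u \<in> ?P" if "e2 * f - e1 * g \<in> ?P" for f g
  proof -
    have "xi * (xi * f) - e1 * (xi * f - g) = - (e2 * f - e1 * g) + p2 * f - p1 * (xi * f)"
      by (simp add: e1' e2' algebra_simps)
    also have "\<dots> \<in> ?P" by (rule id(6)[OF id(2)[OF id(5)[OF that] id(4)[OF p(2)]] id(4)[OF p(1)]])
    finally obtain w where "xi * f - e1 * w \<in> ?P" using A by blast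
    then show ?thesis using A by blast
  qed
  show ?thesis
    using e1n prime B by (auto simp: tprime_mult ideal_step_UNIV_iff)
qed

text \<open>One step of a shelling: adding the facet \<open>F\<close> with restriction set \<open>\<sigma>\<close>.\<close>

lemma weakly_regular_shelling_step:
  fixes as :: "('v::finite, 'k::field) mpol list"
  assumes "upset U" "\<And>S. S \<union> \<sigma> \<in> U \<longleftrightarrow> \<not> S \<subseteq> F" "weakly_regular as UNIV (face_ideal (- F))"
  shows "weakly_regular as (squarefree_ideal (U \<union> {S. \<sigma> \<subseteq> S})) (squarefree_ideal U)"
proof -
  have "{S. S \<union> \<sigma> \<in> U} = {S. S \<inter> - F \<noteq> {}}" using assms(2) by auto
  then have "colon (squarefree_ideal U) {monomial (sqfree_exp \<sigma>)} = (face_ideal (- F) :: ('v, 'k) mpol set)"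
    unfolding colon_monomial face_ideal_def by simp
  then show ?thesis
    using weakly_regular_principal[OF tideal_squarefree_ideal[OF assms(1)], of as "monomial (sqfree_exp \<sigma>)"]
      assms(3) by (simp add: ideal_step_monomial[OF assms(1)])
qed

section \<open>Filtrations by squarefree ideals\<close>

lemma squarefree_ideal_graded:
  fixes x :: "('v::finite, 'k::field) mpol"
  assumes "x \<in> squarefree_ideal U"
  shows "\<exists>F c. finite F \<and> (\<forall>d\<in>F. c d \<in> squarefree_ideal U \<inter> homogeneous_component d) \<and> x = (\<Sum>d\<in>F. c d)"
proof (intro exI conjI)
  let ?F = "(\<lambda>u. int (mdeg u)) ` pkeys x"
  let ?c = "\<lambda>d. poly_restrict (\<lambda>u. int (mdeg u) = d) x"
  show "finite ?F" by simp
  show "\<forall>d\<in>?F. ?c d \<in> squarefree_ideal U \<inter> homogeneous_component d"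
    using assms by (auto simp: squarefree_ideal_def homogeneous_component_def keys_poly_restrict)
  show "x = (\<Sum>d\<in>?F. ?c d)"
    by (rule poly_mapping_eqI) (force simp: lookup_sum coeff_poly_restrict in_keys_iff)
qed

lemma squarefree_ideal_UNIV [simp]: "squarefree_ideal UNIV = UNIV"
  by (simp add: squarefree_ideal_def)

lemma SCM_ideal_imp_filtration:
  assumes "SCM_ideal J" "tideal J"
  shows "\<exists>r L. CM_filtration graded_max_ideal J r L"
  using assms sequentially_CM_imp_filtration unfolding SCM_ideal_def by blast

lemma filtration_imp_SCM_ideal:
  assumes "tideal J" "CM_filtration graded_max_ideal J r (\<lambda>i. squarefree_ideal (U i))"
  shows "SCM_ideal J"
  unfolding SCM_ideal_def
  by (rule filtration_imp_sequentially_CM[OF assms]) (rule squarefree_ideal_graded)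

lemma squarefree_ideal_strict:
  assumes "U \<subset> V"
  shows "squarefree_ideal U \<subset> (squarefree_ideal V :: ('v::finite, 'k::field) mpol set)"
proof -
  obtain S where "S \<in> V" "S \<notin> U" using assms by blast
  then have "monomial (sqfree_exp S) \<notin> (squarefree_ideal U :: ('v, 'k) mpol set)"
    "monomial (sqfree_exp S) \<in> (squarefree_ideal V :: ('v, 'k) mpol set)" by simp_all
  then show ?thesis using squarefree_ideal_mono[of U V] assms by blast
qed

lemma SCM_ideal_one_step:
  fixes U :: "'v::finite set set"
  defines "J \<equiv> squarefree_ideal U :: ('v, 'k::field) mpol set"
  assumes "upset U" "U \<noteq> UNIV" "pair_CM graded_max_ideal UNIV J"
  shows "SCM_ideal J"
proof (rule filtration_imp_SCM_ideal)
  have "J \<subset> UNIV"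
    using squarefree_ideal_strict[of U UNIV, where ?'k = 'k] assms(3) by (auto simp: J_def)
  then show "CM_filtration graded_max_ideal J 1 (\<lambda>i. squarefree_ideal (if i = 0 then U else UNIV))"
    using assms by (auto simp: CM_filtration_def tideal_squarefree_ideal tideal_UNIV)
  show "tideal J" using assms by (simp add: tideal_squarefree_ideal)
qed

lemma SCM_ideal_two_steps:
  fixes U V :: "'v::finite set set"
  defines "J \<equiv> squarefree_ideal U :: ('v, 'k::field) mpol set" and "I \<equiv> squarefree_ideal V"
  assumes "upset U" "upset V" "U \<subset> V" "V \<noteq> UNIV"
    and "pair_CM graded_max_ideal I J" "pair_CM graded_max_ideal UNIV I"
    and "quot_dim (colon J I) < quot_dim (colon I UNIV)"
  shows "SCM_ideal J"
proof (rule filtration_imp_SCM_ideal)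
  let ?U = "\<lambda>i :: nat. if i = 0 then U else if i = 1 then V else UNIV"
  let ?L = "\<lambda>i. squarefree_ideal (?U i) :: ('v, 'k) mpol set"
  have sub: "J \<subset> I" "I \<subset> UNIV"
    using squarefree_ideal_strict[OF \<open>U \<subset> V\<close>, where ?'k = 'k]
      squarefree_ideal_strict[of V UNIV, where ?'k = 'k] assms(6) by (auto simp: I_def J_def)
  have id: "tideal J" "tideal I" using assms by (auto simp: tideal_squarefree_ideal)
  have L: "?L i = (if i = 0 then J else if i = 1 then I else UNIV)" for i :: nat
    by (simp add: I_def J_def)
  show "CM_filtration graded_max_ideal J 2 ?L"
    unfolding CM_filtration_def L using sub id assms(7-9)
    by (auto simp: tideal_UNIV less_Suc_eq numeral_2_eq_2)
  show "tideal J" by fact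
qed

section \<open>Shellings\<close>

text \<open>Over a small field no two linear forms restrict to a system of parameters on every edge of a
  complete graph; the first two elementary symmetric polynomials do.\<close>

definition esym1 :: "('v::finite, 'k::field) mpol" where
  "esym1 = (\<Sum>i\<in>UNIV. pvar i)"

definition esym2 :: "('v::finite, 'k::field) mpol" where
  "esym2 = (\<Sum>S\<in>{S. card S = 2}. monomial (sqfree_exp S))"

lemma esym_in_max: "set [esym1, esym2] \<subseteq> (graded_max_ideal :: ('v::finite, 'k::field) mpol set)"
proof -
  have "esym1 \<in> (face_ideal UNIV :: ('v, 'k) mpol set)"
    unfolding esym1_def by (intro tideal_sum[OF tideal_face_ideal]) simp
  moreover have "esym2 \<in> (face_ideal UNIV :: ('v, 'k) mpol set)"
    unfolding esym2_def by (intro tideal_sum[OF tideal_face_ideal]) (auto simp: face_ideal_def)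
  ultimately show ?thesis by (simp add: graded_max_ideal_eq)
qed

lemma weakly_regular_esym:
  fixes F :: "'v::{finite,linorder} set"
  assumes "card F = 2"
  shows "weakly_regular [esym1, esym2] UNIV (face_ideal (- F) :: ('v, 'k::field) mpol set)"
proof -
  obtain i j where F: "F = {i, j}" "i \<noteq> j" using assms by (auto simp: card_2_iff)
  show ?thesis
  proof (rule weakly_regular_face_edge)
    show "i \<notin> - F" "j \<notin> - F" "i \<noteq> j" using F by auto
    have "esym1 - (pvar i + pvar j) = (\<Sum>k\<in>UNIV - F. pvar k :: ('v, 'k) mpol)"
      unfolding esym1_def using F by (subst sum.subset_diff[of F]) auto
    also have "\<dots> \<in> face_ideal (- F)" by (intro tideal_sum[OF tideal_face_ideal]) simp
    finally show "esym1 - (pvar i + pvar j) \<in> (face_ideal (- F) :: ('v, 'k) mpol set)" .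
    have "pvar i * pvar j = (monomial (sqfree_exp F) :: ('v, 'k) mpol)"
      using F by (simp add: pvar_def sqfree_exp_def flip: monomial_add)
    then have "esym2 - pvar i * pvar j =
        (\<Sum>S\<in>{S. card S = 2} - {F}. monomial (sqfree_exp S) :: ('v, 'k) mpol)"
      unfolding esym2_def using assms by (subst sum.remove[of _ F]) auto
    also have "\<dots> \<in> face_ideal (- F)"
    proof (intro tideal_sum[OF tideal_face_ideal])
      fix S assume S: "S \<in> {S. card S = 2} - {F}"
      have "\<not> S \<subseteq> F" using S assms card_subset_eq[of F S] by auto
      then show "monomial (sqfree_exp S) \<in> (face_ideal (- F) :: ('v, 'k) mpol set)"
        by (auto simp: face_ideal_def)
    qed
    finally show "esym2 - pvar i * pvar j \<in> (face_ideal (- F) :: ('v, 'k) mpol set)" .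
  qed
qed

abbreviation (input) "large n \<equiv> {S. n \<le> card S}"

lemma upset_large: "upset (large n :: 'v::finite set set)"
  unfolding upset_def
proof (intro ballI allI impI)
  fix S T :: "'v set" assume "S \<in> large n" "S \<subseteq> T"
  then show "T \<in> large n" using card_mono[of T S] by simp
qed

lemma upset_Un: "upset U \<Longrightarrow> upset V \<Longrightarrow> upset (U \<union> V)"
  by (auto simp: upset_def)

lemma upset_superset: "upset {S. \<exists>\<sigma>\<in>A. \<sigma> \<subseteq> S}"
  unfolding upset_def by (auto intro: order_trans)

lemma upset_Int: "upset U \<Longrightarrow> upset V \<Longrightarrow> upset (U \<inter> V)"
  by (auto simp: upset_def)

lemma weakly_regular_squarefree_trans:
  assumes "upset U" "upset V" "upset W" "U \<subseteq> V" "V \<subseteq> W"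
    and "weakly_regular as (squarefree_ideal V) (squarefree_ideal U)"
    and "weakly_regular as (squarefree_ideal W) (squarefree_ideal V)"
  shows "weakly_regular as (squarefree_ideal W) (squarefree_ideal U)"
  using tideal_squarefree_ideal[OF assms(3)] tideal_squarefree_ideal[OF assms(2)]
    tideal_squarefree_ideal[OF assms(1)] squarefree_ideal_mono[OF assms(4)]
    squarefree_ideal_mono[OF assms(5)] assms(6,7)
  by (rule weakly_regular_extension)

text \<open>Each entry is a facet \<open>F\<close> with its restriction set \<open>\<sigma>\<close>:
  the condition says that the faces containing \<open>\<sigma>\<close> form the interval from
  \<open>\<sigma>\<close> to \<open>F\<close>. As \<open>U\<close> grows the complex is dismantled,
  so the list runs through a shelling backwards.\<close>

fun shelling :: "('v set \<times> 'v set) list \<Rightarrow> 'v set set \<Rightarrow> bool" where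
  "shelling [] U \<longleftrightarrow> True"
| "shelling ((\<sigma>, F) # xs) U \<longleftrightarrow> (\<forall>S. S \<union> \<sigma> \<in> U \<longleftrightarrow> \<not> S \<subseteq> F) \<and> shelling xs (U \<union> {S. \<sigma> \<subseteq> S})"

text \<open>The relative module is filtered by the quotients of the single steps, each of them a
  coordinate ring of one facet up to a shift; a sequence regular on every facet is regular on the
  whole by extension.\<close>

lemma weakly_regular_shelling:
  fixes as :: "('v::finite, 'k::field) mpol list"
  assumes "upset U" "shelling xs U" "xs \<noteq> []"
    and "\<And>F. F \<in> snd ` set xs \<Longrightarrow> weakly_regular as UNIV (face_ideal (- F))"
  shows "weakly_regular as (squarefree_ideal (U \<union> {S. \<exists>\<sigma>\<in>fst ` set xs. \<sigma> \<subseteq> S})) (squarefree_ideal U)"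
  using assms
proof (induction xs arbitrary: U)
  case (Cons x xs)
  obtain \<sigma> F where x: "x = (\<sigma>, F)" by (cases x)
  let ?U = "U \<union> {S. \<sigma> \<subseteq> S}"
  let ?V = "U \<union> {S. \<exists>\<sigma>\<in>fst ` set (x # xs). \<sigma> \<subseteq> S}"
  have step: "weakly_regular as (squarefree_ideal ?U) (squarefree_ideal U)"
    using Cons.prems by (intro weakly_regular_shelling_step[of U \<sigma> F]) (auto simp: x)
  have up: "upset ?U" "upset ?V"
    using upset_Un[OF Cons.prems(1) upset_superset[of "{\<sigma>}"]]
    by (simp, intro upset_Un[OF Cons.prems(1) upset_superset])
  have V: "?V = ?U \<union> {S. \<exists>\<sigma>\<in>fst ` set xs. \<sigma> \<subseteq> S}" by (auto simp: x)
  show ?case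
  proof (cases "xs = []")
    case True
    then have "?V = ?U" by (auto simp: x)
    then show ?thesis using step by simp
  next
    case False
    have "weakly_regular as (squarefree_ideal ?V) (squarefree_ideal ?U)"
      unfolding V using Cons.prems False up by (intro Cons.IH) (auto simp: x)
    then show ?thesis
      by (intro weakly_regular_squarefree_trans[OF Cons.prems(1) up _ _ step]) (auto simp: x)
  qed
qed simp

lemma weakly_regular_esym_shelling:
  assumes "upset U" "shelling xs U" "xs \<noteq> []" "\<forall>F\<in>snd ` set xs. card F = 2"
  shows "weakly_regular [esym1, esym2]
      (squarefree_ideal (U \<union> {S. \<exists>\<sigma>\<in>fst ` set xs. \<sigma> \<subseteq> S}))
      (squarefree_ideal U :: ('v::{finite,linorder}, 'k::field) mpol set)"
  by (rule weakly_regular_shelling[OF assms(1-3)], rule weakly_regular_esym) (use assms(4) in blast)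

text \<open>In \<open>I\<close> relative to \<open>I \<inter> large 3\<close> every pair in
  \<open>I\<close> is a facet, because its proper supersets have at least three elements. So any
  pair can be removed with itself as restriction set, and in any order.\<close>

lemma weakly_regular_add_pairs:
  fixes I Q :: "'v::{finite,linorder} set set"
  assumes I: "upset I" and Q: "\<And>\<sigma>. \<sigma> \<in> Q \<Longrightarrow> card \<sigma> = 2 \<and> \<sigma> \<in> I"
  shows "upset (I \<inter> large 3 \<union> Q)"
    and "weakly_regular [esym1, esym2] (squarefree_ideal (I \<inter> large 3 \<union> Q))
      (squarefree_ideal (I \<inter> large 3) :: ('v, 'k::field) mpol set)"
proof -
  have super: "T \<in> I \<inter> large 3" if "\<sigma> \<in> I" "card \<sigma> = 2" "\<sigma> \<subset> T" for \<sigma> T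
    using that psubset_card_mono[OF _ that(3)] upsetD[OF I, of \<sigma> T] by auto
  have up: "upset (I \<inter> large 3 \<union> Y)" if "\<And>\<sigma>. \<sigma> \<in> Y \<Longrightarrow> card \<sigma> = 2 \<and> \<sigma> \<in> I" for Y
    unfolding upset_def
  proof safe
    fix S T :: "'v set" assume ST: "S \<subseteq> T" "T \<notin> Y"
    { assume "S \<in> I" "3 \<le> card S"
      then show "T \<in> I" "3 \<le> card T"
        using upsetD[OF I _ ST(1)] card_mono[OF _ ST(1)] by auto }
    { assume "S \<in> Y"
      then show "T \<in> I" "3 \<le> card T" using that[of S] super[of S T] ST by auto }
  qed
  then show "upset (I \<inter> large 3 \<union> Q)" using Q by blast
  have "finite Q" by simp
  then show "weakly_regular [esym1, esym2] (squarefree_ideal (I \<inter> large 3 \<union> Q))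
      (squarefree_ideal (I \<inter> large 3) :: ('v, 'k) mpol set)"
    using Q
  proof (induction Q)
    case empty
    \<comment> \<open>The empty case concerns the zero module, on which every sequence is weakly
      regular.\<close>
    have "weakly_regular as L L" if "tideal L" for as and L :: "('v, 'k) mpol set"
      using that
    proof -
      have "ideal_steps bs L L = L" for bs
        using ideal_steps_superset[OF that] ideal_steps_subset[OF that] by blast
      then show ?thesis by (simp add: weakly_regular_nth)
    qed
    then show ?case
      unfolding Un_empty_right using tideal_squarefree_ideal[OF upset_Int[OF I upset_large]] by blast
  next
    case (insert \<sigma> Q)
    let ?U = "I \<inter> large 3 \<union> Q"
    have U: "upset ?U" using insert.prems by (intro up) auto
    have \<sigma>: "\<sigma> \<in> I" "card \<sigma> = 2" "\<sigma> \<notin> ?U" using insert by auto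
    have eq: "?U \<union> {S. \<sigma> \<subseteq> S} = I \<inter> large 3 \<union> insert \<sigma> Q"
      using super[OF \<sigma>(1,2)] by blast
    have "S \<union> \<sigma> \<in> ?U \<longleftrightarrow> \<not> S \<subseteq> \<sigma>" for S
    proof
      assume "S \<union> \<sigma> \<in> ?U" then show "\<not> S \<subseteq> \<sigma>" using \<sigma>(3) by (auto simp: Un_absorb1)
    next
      assume "\<not> S \<subseteq> \<sigma>" then show "S \<union> \<sigma> \<in> ?U" using super[OF \<sigma>(1,2), of "S \<union> \<sigma>"] by blast
    qed
    then have "weakly_regular [esym1, esym2] (squarefree_ideal (?U \<union> {S. \<sigma> \<subseteq> S}))
        (squarefree_ideal ?U :: ('v, 'k) mpol set)"
      by (intro weakly_regular_shelling_step[of _ _ \<sigma>] U weakly_regular_esym \<sigma>(2))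
    moreover have "weakly_regular [esym1, esym2] (squarefree_ideal ?U)
        (squarefree_ideal (I \<inter> large 3) :: ('v, 'k) mpol set)"
      using insert by blast
    moreover have "upset (I \<inter> large 3 \<union> insert \<sigma> Q)" using insert.prems by (intro up) auto
    moreover have "?U \<subseteq> I \<inter> large 3 \<union> insert \<sigma> Q" by blast
    ultimately show ?case
      unfolding eq using weakly_regular_squarefree_trans[OF upset_Int[OF I upset_large] U _ Un_upper1]
      by blast
  qed
qed

text \<open>The faces of this factor have at most two elements and the pair \<open>F\<close> is one
  of them, so two elements are the right length for a regular sequence; \<open>\<sigma>\<close> is a
  minimal face.\<close>

lemma pair_CM_large:
  fixes I :: "'v::{finite,linorder} set set"
  assumes I: "upset I" and \<sigma>: "\<sigma> \<in> I" "card \<sigma> < 3" "\<And>\<tau>. \<tau> \<subset> \<sigma> \<Longrightarrow> \<tau> \<notin> I"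
    and F: "F \<in> I" "card F = 2"
    and reg: "weakly_regular [esym1, esym2] (squarefree_ideal I)
      (squarefree_ideal (I \<inter> large 3) :: ('v, 'k::field) mpol set)"
  shows "pair_CM graded_max_ideal (squarefree_ideal I)
      (squarefree_ideal (I \<inter> large 3) :: ('v, 'k) mpol set)"
    and "quot_dim (colon (squarefree_ideal (I \<inter> large 3)) (squarefree_ideal I :: ('v, 'k) mpol set)) = 2"
proof -
  have dim: "S \<union> T \<in> I \<inter> large 3" if "S \<in> I" "length [esym1, esym2 :: ('v, 'k) mpol] < card T" for S T
    using that upsetD[OF I, of S "S \<union> T"] card_mono[of "S \<union> T" T] by auto
  note * = squarefree_pair_CM[OF I upset_Int[OF I upset_large] Int_lower1 \<sigma>(1) _ \<sigma>(3) dim F(1) _ _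
      esym_in_max reg, of F]
  show "pair_CM graded_max_ideal (squarefree_ideal I)
      (squarefree_ideal (I \<inter> large 3) :: ('v, 'k) mpol set)"
    by (rule *(1)) (use \<sigma> F in auto)
  show "quot_dim (colon (squarefree_ideal (I \<inter> large 3)) (squarefree_ideal I :: ('v, 'k) mpol set)) = 2"
    by (subst *(2)) (use \<sigma> F in \<open>auto simp: numeral_eq_enat\<close>)
qed

lemma weakly_regular_pvars:
  "distinct xs \<Longrightarrow> set xs \<inter> V = {} \<Longrightarrow>
    weakly_regular (map pvar xs) UNIV (face_ideal V :: ('v::{finite,linorder}, 'k::field) mpol set)"
proof (induction xs arbitrary: V)
  case (Cons x xs)
  then have "weakly_regular (map pvar xs) UNIV (face_ideal (insert x V) :: ('v, 'k) mpol set)"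
    by (intro Cons.IH) auto
  then show ?case
    using Cons.prems tideal_0[OF tideal_face_ideal[of V, where ?'b = 'k]]
    unfolding list.map by (intro weakly_regular_face_Cons) auto
qed simp

text \<open>Reduces questions about subsets of the five variables to their 32 membership
  patterns.\<close>

lemma card5:
  assumes "distinct [a, b, c, d, e]" "UNIV = {a, b, c, d, e}"
  shows "card S = of_bool (a \<in> S) + of_bool (b \<in> S) + of_bool (c \<in> S) + of_bool (d \<in> S) + of_bool (e \<in> S)"
proof -
  have "finite (UNIV :: 'a set)" unfolding assms(2) by simp
  then have "card S = (\<Sum>x\<in>UNIV. of_bool (x \<in> S))" by simp
  then show ?thesis unfolding assms(2) using assms(1) by (simp add: add.assoc)
qed

section \<open>Ideals in five variables and their filtrations\<close>

context
  fixes a b c d e :: "'v::{finite,linorder}"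
  assumes dist: "distinct [a, b, c, d, e]" and univ: "UNIV = {a, b, c, d, e}"
begin

lemma all5: "(\<forall>x. P x) \<longleftrightarrow> P a \<and> P b \<and> P c \<and> P d \<and> P e"
proof -
  have "(\<forall>x. P x) \<longleftrightarrow> (\<forall>x\<in>UNIV. P x)" by simp
  then show ?thesis unfolding univ by simp
qed

lemma subset5: "S \<subseteq> T \<longleftrightarrow> (a \<in> S \<longrightarrow> a \<in> T) \<and> (b \<in> S \<longrightarrow> b \<in> T) \<and> (c \<in> S \<longrightarrow> c \<in> T) \<and>
    (d \<in> S \<longrightarrow> d \<in> T) \<and> (e \<in> S \<longrightarrow> e \<in> T)"
  by (simp add: subset_iff all5)

lemma dist5: "a \<noteq> b" "a \<noteq> c" "a \<noteq> d" "a \<noteq> e" "b \<noteq> c" "b \<noteq> d" "b \<noteq> e" "c \<noteq> d" "c \<noteq> e" "d \<noteq> e"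
  "b \<noteq> a" "c \<noteq> a" "d \<noteq> a" "e \<noteq> a" "c \<noteq> b" "d \<noteq> b" "e \<noteq> b" "d \<noteq> c" "e \<noteq> c" "e \<noteq> d"
  using dist by auto

abbreviation (input) "meets_ab \<equiv> {S. a \<in> S \<or> b \<in> S}"
abbreviation (input) "two_of_abc \<equiv> {S. a \<in> S \<and> b \<in> S \<or> a \<in> S \<and> c \<in> S \<or> b \<in> S \<and> c \<in> S}"

lemma upset5: "upset meets_ab" "upset two_of_abc" "upset {S. a \<in> S}"
  "upset {S. a \<in> S \<and> (b \<in> S \<or> c \<in> S)}"
  by (auto simp: upset_def)

text \<open>The complex is the complete graph on five vertices. The edges missing \<open>a\<close>
  come off first, each as its own restriction set; what remains is the star of edges at
  \<open>a\<close>.\<close>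

lemma SCM_uniform: "SCM_ideal (squarefree_ideal (large 3) :: ('v, 'k::field) mpol set)"
proof (rule SCM_ideal_one_step[OF upset_large])
  have up: "upset (UNIV :: 'v set set)" by (simp add: upset_def)
  let ?Q = "{S. card S = 2 \<and> a \<notin> S}"
  let ?U = "large 3 \<union> ?Q"
  have Q: "upset ?U" "weakly_regular [esym1, esym2] (squarefree_ideal ?U)
      (squarefree_ideal (large 3) :: ('v, 'k) mpol set)"
    using weakly_regular_add_pairs(1)[OF up, of ?Q] weakly_regular_add_pairs(2)[OF up, of ?Q, where ?'k = 'k]
    by simp_all
  \<comment> \<open>In order of removal: \<open>{a, b}\<close> comes last, with empty restriction
    set, because it is the first facet of the shelling.\<close>
  let ?xs = "[({e}, {a, e}), ({d}, {a, d}), ({c}, {a, c}), ({}, {a, b})]"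
  have sh: "shelling ?xs ?U"
    unfolding shelling.simps
  proof (intro conjI allI TrueI)
    fix S
    show "S \<union> {e} \<in> ?U \<longleftrightarrow> \<not> S \<subseteq> {a, e}"
      by (cases "a \<in> S"; cases "b \<in> S"; cases "c \<in> S"; cases "d \<in> S"; cases "e \<in> S";
          simp add: card5[OF dist univ] subset5 dist5)
    show "S \<union> {d} \<in> ?U \<union> {S. {e} \<subseteq> S} \<longleftrightarrow> \<not> S \<subseteq> {a, d}"
      by (cases "a \<in> S"; cases "b \<in> S"; cases "c \<in> S"; cases "d \<in> S"; cases "e \<in> S";
          simp add: card5[OF dist univ] subset5 dist5)
    show "S \<union> {c} \<in> ?U \<union> {S. {e} \<subseteq> S} \<union> {S. {d} \<subseteq> S} \<longleftrightarrow> \<not> S \<subseteq> {a, c}"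
      by (cases "a \<in> S"; cases "b \<in> S"; cases "c \<in> S"; cases "d \<in> S"; cases "e \<in> S";
          simp add: card5[OF dist univ] subset5 dist5)
    show "S \<union> {} \<in> ?U \<union> {S. {e} \<subseteq> S} \<union> {S. {d} \<subseteq> S} \<union> {S. {c} \<subseteq> S} \<longleftrightarrow> \<not> S \<subseteq> {a, b}"
      by (cases "a \<in> S"; cases "b \<in> S"; cases "c \<in> S"; cases "d \<in> S"; cases "e \<in> S";
          simp add: card5[OF dist univ] subset5 dist5)
  qed
  have "weakly_regular [esym1, esym2] (squarefree_ideal (?U \<union> {S. \<exists>\<sigma>\<in>fst ` set ?xs. \<sigma> \<subseteq> S}))
      (squarefree_ideal ?U :: ('v, 'k) mpol set)"
    by (rule weakly_regular_esym_shelling[OF Q(1) sh]) (use dist5 in auto)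
  moreover have "?U \<union> {S. \<exists>\<sigma>\<in>fst ` set ?xs. \<sigma> \<subseteq> S} = UNIV" by auto
  ultimately have w: "weakly_regular [esym1, esym2] (squarefree_ideal UNIV)
      (squarefree_ideal ?U :: ('v, 'k) mpol set)"
    by metis
  have reg: "weakly_regular [esym1, esym2] (squarefree_ideal UNIV)
      (squarefree_ideal (UNIV \<inter> large 3) :: ('v, 'k) mpol set)"
    unfolding Int_UNIV_left by (rule weakly_regular_squarefree_trans[OF upset_large Q(1) up _ _ Q(2) w]) auto
  have "pair_CM graded_max_ideal (squarefree_ideal UNIV)
      (squarefree_ideal (UNIV \<inter> large 3) :: ('v, 'k) mpol set)"
    by (rule pair_CM_large(1)[OF up _ _ _ _ _ reg, of "{}" "{a, b}"]) (use dist5 in auto)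
  then show "pair_CM graded_max_ideal UNIV (squarefree_ideal (large 3) :: ('v, 'k) mpol set)" by simp
  have "({} :: 'v set) \<notin> large 3" by simp
  then show "large 3 \<noteq> (UNIV :: 'v set set)" by blast
qed

text \<open>The quotient is the polynomial ring in \<open>c\<close>, \<open>d\<close>,
  \<open>e\<close>, with the variables as regular sequence.\<close>

lemma pair_CM_meets_ab:
  "pair_CM graded_max_ideal UNIV (squarefree_ideal meets_ab :: ('v, 'k::field) mpol set)"
  "quot_dim (colon (squarefree_ideal meets_ab :: ('v, 'k) mpol set) UNIV) = 3"
proof -
  have up: "upset (UNIV :: 'v set set)" by (simp add: upset_def)
  let ?as = "map pvar [c, d, e] :: ('v, 'k) mpol list"
  have "meets_ab = {S. S \<inter> {a, b} \<noteq> {}}" by auto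
  then have face: "squarefree_ideal meets_ab = (face_ideal {a, b} :: ('v, 'k) mpol set)"
    by (simp add: face_ideal_def)
  have reg: "weakly_regular ?as (squarefree_ideal UNIV) (squarefree_ideal meets_ab)"
    using weakly_regular_pvars[of "[c, d, e]" "{a, b}", where ?'k = 'k] dist5 by (simp add: face)
  have max: "set ?as \<subseteq> graded_max_ideal" by (simp add: graded_max_ideal_eq)
  have dim: "S \<union> T \<in> meets_ab" if "S \<in> UNIV" "length ?as < card T" for S T
    using that by (auto simp: card5[OF dist univ, of T] of_bool_def split: if_splits)
  have *: "({} :: 'v set) \<notin> meets_ab" "{c, d, e} \<union> {} \<notin> meets_ab" "card {c, d, e} = length ?as"
    using dist5 by auto
  note r = squarefree_pair_CM[OF up upset5(1) subset_UNIV UNIV_I *(1) _ dim UNIV_I *(2,3) max reg]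
  show "pair_CM graded_max_ideal UNIV (squarefree_ideal meets_ab :: ('v, 'k) mpol set)"
    using r(1) by simp
  show "quot_dim (colon (squarefree_ideal meets_ab :: ('v, 'k) mpol set) UNIV) = 3"
    using r(2) by (simp add: numeral_eq_enat)
qed

text \<open>The facets \<open>{a, d, e}\<close>, \<open>{b, d, e}\<close>, \<open>{c, d, e}\<close>
  form a double cone over three points. On each of them \<open>pvar d\<close>, \<open>pvar e\<close>
  and \<open>pvar a + pvar b + pvar c\<close> restrict to the three variables of the facet, over
  every field.\<close>

lemma pair_CM_two_of_abc:
  "pair_CM graded_max_ideal UNIV (squarefree_ideal two_of_abc :: ('v, 'k::field) mpol set)"
  "quot_dim (colon (squarefree_ideal two_of_abc :: ('v, 'k) mpol set) UNIV) = 3"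
proof -
  have up: "upset (UNIV :: 'v set set)" by (simp add: upset_def)
  let ?as = "[pvar d, pvar e, pvar a + pvar b + pvar c] :: ('v, 'k) mpol list"
  let ?xs = "[({a}, {a, d, e}), ({b}, {b, d, e}), ({}, {c, d, e})]"
  have sh: "shelling ?xs two_of_abc"
    by (simp add: subset5 dist5; blast)
  have facet: "weakly_regular ?as UNIV (face_ideal (- F) :: ('v, 'k) mpol set)"
    if F: "F = {x, d, e}" "{a, b, c} - {x} = {y, z}" "x \<in> {a, b, c}" "y \<noteq> z" for F x y z
  proof -
    have xyz: "pvar a + pvar b + pvar c = (pvar x + pvar y + pvar z :: ('v, 'k) mpol)"
      using F dist5 by (auto simp: doubleton_eq_iff insert_Diff_if ac_simps split: if_splits)
    have "y \<in> - F" "z \<in> - F" using F dist5 by auto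
    then have "pvar y + pvar z \<in> (face_ideal (insert e (insert d (- F))) :: ('v, 'k) mpol set)"
      by (intro tideal_add[OF tideal_face_ideal]) auto
    then have "pvar a + pvar b + pvar c - pvar x \<in>
        (face_ideal (insert e (insert d (- F))) :: ('v, 'k) mpol set)"
      unfolding xyz by (simp add: add.assoc)
    moreover have "d \<notin> - F" "e \<notin> insert d (- F)" "x \<notin> insert e (insert d (- F))"
      using F dist5 by auto
    moreover have "0 \<in> (face_ideal V :: ('v, 'k) mpol set)" for V
      by (rule tideal_0[OF tideal_face_ideal])
    ultimately show ?thesis
      by (intro weakly_regular_face_Cons[of _ d] weakly_regular_face_Cons[of _ e]
          weakly_regular_face_Cons[of _ x]) simp_all
  qed
  have "weakly_regular ?as (squarefree_ideal (two_of_abc \<union> {S. \<exists>\<sigma>\<in>fst ` set ?xs. \<sigma> \<subseteq> S}))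
      (squarefree_ideal two_of_abc :: ('v, 'k) mpol set)"
  proof (rule weakly_regular_shelling[OF upset5(2) sh])
    fix F assume "F \<in> snd ` set ?xs"
    then consider "F = {a, d, e}" | "F = {b, d, e}" | "F = {c, d, e}" by auto
    then show "weakly_regular ?as UNIV (face_ideal (- F) :: ('v, 'k) mpol set)"
    proof cases
      case 1 show ?thesis by (rule facet[of F a b c]) (use 1 dist5 in auto)
    next
      case 2 show ?thesis by (rule facet[of F b a c]) (use 2 dist5 in auto)
    next
      case 3 show ?thesis by (rule facet[of F c a b]) (use 3 dist5 in auto)
    qed
  qed simp
  moreover have "two_of_abc \<union> {S. \<exists>\<sigma>\<in>fst ` set ?xs. \<sigma> \<subseteq> S} = UNIV" by auto
  ultimately have reg: "weakly_regular ?as (squarefree_ideal UNIV) (squarefree_ideal two_of_abc)"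
    by metis
  have max: "set ?as \<subseteq> graded_max_ideal"
    by (simp add: graded_max_ideal_eq tideal_add[OF tideal_face_ideal])
  have dim: "S \<union> T \<in> two_of_abc" if "S \<in> UNIV" "length ?as < card T" for S T
    using that by (auto simp: card5[OF dist univ, of T] of_bool_def split: if_splits)
  have *: "({} :: 'v set) \<notin> two_of_abc" "{c, d, e} \<union> {} \<notin> two_of_abc" "card {c, d, e} = length ?as"
    using dist5 by auto
  note r = squarefree_pair_CM[OF up upset5(2) subset_UNIV UNIV_I *(1) _ dim UNIV_I *(2,3) max reg]
  show "pair_CM graded_max_ideal UNIV (squarefree_ideal two_of_abc :: ('v, 'k) mpol set)"
    using r(1) by simp
  show "quot_dim (colon (squarefree_ideal two_of_abc :: ('v, 'k) mpol set) UNIV) = 3"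
    using r(2) by (simp add: numeral_eq_enat)
qed

lemma SCM_two_of_abc: "SCM_ideal (squarefree_ideal two_of_abc :: ('v, 'k::field) mpol set)"
  by (rule SCM_ideal_one_step[OF upset5(2) _ pair_CM_two_of_abc(1)]) auto

text \<open>The relative complex of the lower factor consists of the three pairs inside
  \<open>{a, b, c}\<close> alone, so this factor has dimension two, below the dimension three of the
  upper one.\<close>

lemma SCM_large_two_of_abc:
  "SCM_ideal (squarefree_ideal (two_of_abc \<inter> large 3) :: ('v, 'k::field) mpol set)"
proof (rule SCM_ideal_two_steps[OF upset_Int[OF upset5(2) upset_large] upset5(2)])
  let ?Q = "{S. card S = 2 \<and> S \<in> two_of_abc}"
  have *: "two_of_abc \<inter> large 3 \<union> ?Q = two_of_abc"
  proof -
    have "2 \<le> card S" if "S \<in> two_of_abc" for S using that by (auto simp: card5[OF dist univ])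
    then show ?thesis by force
  qed
  have reg: "weakly_regular [esym1, esym2] (squarefree_ideal two_of_abc)
      (squarefree_ideal (two_of_abc \<inter> large 3) :: ('v, 'k) mpol set)"
    using weakly_regular_add_pairs(2)[OF upset5(2), of ?Q, where ?'k = 'k] unfolding * by simp
  have ab: "{a, b} \<in> two_of_abc" "card {a, b} < 3" "card {a, b} = 2" "{a, b} \<notin> two_of_abc \<inter> large 3"
    using dist5 by auto
  have min: "\<tau> \<notin> two_of_abc" if "\<tau> \<subset> {a, b}" for \<tau>
    using that dist5 by auto
  note cm = pair_CM_large[OF upset5(2) ab(1,2) min ab(1,3) reg]
  show "pair_CM graded_max_ideal (squarefree_ideal two_of_abc)
      (squarefree_ideal (two_of_abc \<inter> large 3) :: ('v, 'k) mpol set)" by (rule cm(1))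
  show "quot_dim (colon (squarefree_ideal (two_of_abc \<inter> large 3)) (squarefree_ideal two_of_abc) :: ('v, 'k) mpol set) <
      quot_dim (colon (squarefree_ideal two_of_abc) UNIV :: ('v, 'k) mpol set)"
  proof -
    have "quot_dim (colon (squarefree_ideal (two_of_abc \<inter> large 3))
        (squarefree_ideal two_of_abc) :: ('v, 'k) mpol set) = 2" by (rule cm(2))
    then show ?thesis unfolding pair_CM_two_of_abc(2) by simp
  qed
  show "pair_CM graded_max_ideal UNIV (squarefree_ideal two_of_abc :: ('v, 'k) mpol set)"
    by (rule pair_CM_two_of_abc(1))
  show "two_of_abc \<inter> large 3 \<subset> two_of_abc" using ab(1,4) by blast
qed auto

text \<open>The faces of the lower factor are \<open>{a}\<close>, \<open>{b}\<close> and the seven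
  pairs meeting \<open>{a, b}\<close>. Five pairs are their own restriction sets; the two vertices
  are absorbed by the intervals from \<open>{b}\<close> to \<open>{a, b}\<close> and from
  \<open>{a}\<close> to \<open>{a, c}\<close>.\<close>

lemma SCM_large_meets_ab:
  "SCM_ideal (squarefree_ideal (meets_ab \<inter> large 3) :: ('v, 'k::field) mpol set)"
proof (rule SCM_ideal_two_steps[OF upset_Int[OF upset5(1) upset_large] upset5(1)])
  let ?Q = "{S. card S = 2 \<and> S \<in> meets_ab \<and> S \<noteq> {a, b} \<and> S \<noteq> {a, c}}"
  let ?U = "meets_ab \<inter> large 3 \<union> ?Q"
  have Q: "upset ?U" "weakly_regular [esym1, esym2] (squarefree_ideal ?U)
      (squarefree_ideal (meets_ab \<inter> large 3) :: ('v, 'k) mpol set)"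
    using weakly_regular_add_pairs(1)[OF upset5(1), of ?Q]
      weakly_regular_add_pairs(2)[OF upset5(1), of ?Q, where ?'k = 'k]
    by simp_all
  let ?xs = "[({b}, {a, b}), ({a}, {a, c})]"
  have set_eq5: "S = T \<longleftrightarrow> (a \<in> S \<longleftrightarrow> a \<in> T) \<and> (b \<in> S \<longleftrightarrow> b \<in> T) \<and> (c \<in> S \<longleftrightarrow> c \<in> T) \<and>
    (d \<in> S \<longleftrightarrow> d \<in> T) \<and> (e \<in> S \<longleftrightarrow> e \<in> T)" for S T
    by (simp add: set_eq_iff all5)
  have sh: "shelling ?xs ?U"
    unfolding shelling.simps
  proof (intro conjI allI TrueI)
    fix S
    show "S \<union> {b} \<in> ?U \<longleftrightarrow> \<not> S \<subseteq> {a, b}"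
      by (cases "a \<in> S"; cases "b \<in> S"; cases "c \<in> S"; cases "d \<in> S"; cases "e \<in> S";
          simp add: card5[OF dist univ] subset5 dist5 set_eq5)
    show "S \<union> {a} \<in> ?U \<union> {S. {b} \<subseteq> S} \<longleftrightarrow> \<not> S \<subseteq> {a, c}"
      by (cases "a \<in> S"; cases "b \<in> S"; cases "c \<in> S"; cases "d \<in> S"; cases "e \<in> S";
          simp add: card5[OF dist univ] subset5 dist5 set_eq5)
  qed
  have "weakly_regular [esym1, esym2] (squarefree_ideal (?U \<union> {S. \<exists>\<sigma>\<in>fst ` set ?xs. \<sigma> \<subseteq> S}))
      (squarefree_ideal ?U :: ('v, 'k) mpol set)"
    by (rule weakly_regular_esym_shelling[OF Q(1) sh]) (use dist5 in auto)
  moreover have "?U \<union> {S. \<exists>\<sigma>\<in>fst ` set ?xs. \<sigma> \<subseteq> S} = meets_ab" by auto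
  ultimately have w: "weakly_regular [esym1, esym2] (squarefree_ideal meets_ab)
      (squarefree_ideal ?U :: ('v, 'k) mpol set)"
    by metis
  have reg: "weakly_regular [esym1, esym2] (squarefree_ideal meets_ab)
      (squarefree_ideal (meets_ab \<inter> large 3) :: ('v, 'k) mpol set)"
    by (rule weakly_regular_squarefree_trans[OF upset_Int[OF upset5(1) upset_large] Q(1) upset5(1)
          _ _ Q(2) w]) auto
  have ab: "{a} \<in> meets_ab" "card {a} < 3" "{a, b} \<in> meets_ab" "card {a, b} = 2" "{a} \<notin> meets_ab \<inter> large 3"
    using dist5 by auto
  have min: "\<tau> \<notin> meets_ab" if "\<tau> \<subset> {a}" for \<tau>
    using that dist5 by auto
  note cm = pair_CM_large[OF upset5(1) ab(1,2) min ab(3,4) reg]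
  show "pair_CM graded_max_ideal (squarefree_ideal meets_ab)
      (squarefree_ideal (meets_ab \<inter> large 3) :: ('v, 'k) mpol set)" by (rule cm(1))
  show "quot_dim (colon (squarefree_ideal (meets_ab \<inter> large 3)) (squarefree_ideal meets_ab) :: ('v, 'k) mpol set) <
      quot_dim (colon (squarefree_ideal meets_ab) UNIV :: ('v, 'k) mpol set)"
  proof -
    have "quot_dim (colon (squarefree_ideal (meets_ab \<inter> large 3))
        (squarefree_ideal meets_ab) :: ('v, 'k) mpol set) = 2" by (rule cm(2))
    then show ?thesis unfolding pair_CM_meets_ab(2) by simp
  qed
  show "pair_CM graded_max_ideal UNIV (squarefree_ideal meets_ab :: ('v, 'k) mpol set)"
    by (rule pair_CM_meets_ab(1))
  show "meets_ab \<inter> large 3 \<subset> meets_ab" using ab(1,5) by blast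
qed auto

text \<open>The ideal \<open>a(b, c)\<close> is treated in all five variables: the lower factor is
  the single interval from \<open>{a}\<close> to \<open>{a, d, e}\<close>, of dimension three, and
  the upper one is a polynomial ring of dimension four.\<close>

lemma SCM_star:
  "SCM_ideal (squarefree_ideal {S. a \<in> S \<and> (b \<in> S \<or> c \<in> S)} :: ('v, 'k::field) mpol set)"
proof (rule SCM_ideal_two_steps[OF upset5(4) upset5(3)])
  let ?U = "{S. a \<in> S \<and> (b \<in> S \<or> c \<in> S)}" and ?V = "{S. a \<in> S}"
  have up: "upset (UNIV :: 'v set set)" by (simp add: upset_def)
  let ?as = "map pvar [d, e, a] :: ('v, 'k) mpol list"
  let ?bs = "map pvar [b, c, d, e] :: ('v, 'k) mpol list"
  have "weakly_regular ?as (squarefree_ideal (?U \<union> {S. {a} \<subseteq> S})) (squarefree_ideal ?U)"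
  proof (rule weakly_regular_shelling_step[OF upset5(4)])
    show "S \<union> {a} \<in> ?U \<longleftrightarrow> \<not> S \<subseteq> {a, d, e}" for S by (simp add: subset5 dist5; blast)
    show "weakly_regular ?as UNIV (face_ideal (- {a, d, e}))"
      using dist5 by (intro weakly_regular_pvars) auto
  qed
  moreover have "?U \<union> {S. {a} \<subseteq> S} = ?V" by auto
  ultimately have reg: "weakly_regular ?as (squarefree_ideal ?V) (squarefree_ideal ?U)" by simp
  have "?V = {S. S \<inter> {a} \<noteq> {}}" by auto
  then have face: "squarefree_ideal ?V = (face_ideal {a} :: ('v, 'k) mpol set)"
    by (simp add: face_ideal_def)
  have reg2: "weakly_regular ?bs (squarefree_ideal UNIV) (squarefree_ideal ?V)"
    using weakly_regular_pvars[of "[b, c, d, e]" "{a}", where ?'k = 'k] dist5 by (simp add: face)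
  have max: "set ?as \<subseteq> graded_max_ideal" "set ?bs \<subseteq> graded_max_ideal"
    by (simp_all add: graded_max_ideal_eq)
  have dim: "S \<union> T \<in> ?U" if "S \<in> ?V" "length ?as < card T" for S T
    using that by (auto simp: card5[OF dist univ, of T] of_bool_def split: if_splits)
  have dim2: "S \<union> T \<in> ?V" if "S \<in> UNIV" "length ?bs < card T" for S T
    using that by (auto simp: card5[OF dist univ, of T] of_bool_def split: if_splits)
  have *: "{a} \<in> ?V" "{a} \<notin> ?U" "{a, d, e} \<union> {a} \<notin> ?U" "card {a, d, e} = length ?as"
    "{} \<notin> ?V" "{b, c, d, e} \<union> {} \<notin> ?V" "card {b, c, d, e} = length ?bs"
    using dist5 by auto
  have sub: "?U \<subseteq> ?V" by auto
  have min: "\<tau> \<notin> ?V" if "\<tau> \<subset> {a}" for \<tau> using that by auto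
  note r = squarefree_pair_CM[OF upset5(3,4) sub *(1,2) min dim *(1,3,4) max(1) reg]
  note r2 = squarefree_pair_CM[OF up upset5(3) subset_UNIV UNIV_I *(5) _ dim2 UNIV_I *(6,7) max(2) reg2]
  show "pair_CM graded_max_ideal (squarefree_ideal ?V) (squarefree_ideal ?U :: ('v, 'k) mpol set)"
    using r(1) by simp
  show "pair_CM graded_max_ideal UNIV (squarefree_ideal ?V :: ('v, 'k) mpol set)"
    using r2(1) by simp
  have "quot_dim (colon (squarefree_ideal ?U) (squarefree_ideal ?V :: ('v, 'k) mpol set)) = 3"
    using r(2) by (simp add: numeral_eq_enat)
  moreover have "quot_dim (colon (squarefree_ideal ?V) UNIV :: ('v, 'k) mpol set) = 4"
    using r2(2) by (simp add: numeral_eq_enat)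
  ultimately show "quot_dim (colon (squarefree_ideal ?U) (squarefree_ideal ?V) :: ('v, 'k) mpol set) <
      quot_dim (colon (squarefree_ideal ?V) UNIV :: ('v, 'k) mpol set)" by simp
  show "?U \<subset> ?V" using sub *(1,2) by blast
  show "?V \<noteq> UNIV" using *(5) by blast
qed

end

section \<open>Two coordinate subspaces meeting in a line\<close>

lemma pvar_power: "pvar t ^ k = (monomial (single t k) :: ('v, 'k::field) mpol)"
  by (induction k) (simp_all add: pvar_def flip: monomial_add single_add)

text \<open>All ideals here are spanned by monomials, so it is enough to distribute the terms: one
  without a variable in \<open>V\<close> must have a variable in \<open>W\<close>.\<close>

lemma face_ideal_sum_split:
  assumes "x \<in> face_ideal (V \<union> W)"
  obtains y where "y \<in> face_ideal W" "x - y \<in> face_ideal V"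
proof
  let ?y = "poly_restrict (\<lambda>u. pkeys u \<inter> V = {}) x"
  show "?y \<in> face_ideal W"
    using assms by (auto simp: face_ideal_def squarefree_ideal_def keys_poly_restrict)
  have "x - ?y = poly_restrict (\<lambda>u. pkeys u \<inter> V \<noteq> {}) x"
    using poly_restrict_split[of x "\<lambda>u. pkeys u \<inter> V = {}"] by (metis add_diff_cancel_left')
  then show "x - ?y \<in> face_ideal V"
    by (simp add: face_ideal_def squarefree_ideal_def keys_poly_restrict)
qed

text \<open>A single term of \<open>x\<close> that survives modulo the prime limits the powers of
  \<open>pvar t\<close> dividing \<open>x\<close> there; this makes a greatest such power
  available.\<close>

lemma face_ideal_power_bound:
  fixes x z :: "('v, 'k::field) mpol"
  assumes "x - pvar t ^ k * z \<in> face_ideal V" "u \<in> pkeys x" "pkeys u \<inter> V = {}"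
  shows "k \<le> pcoeff u t"
proof -
  have "u \<notin> pkeys (x - pvar t ^ k * z)"
    using assms(1,3) by (auto simp: face_ideal_def squarefree_ideal_def)
  then have "u \<in> pkeys (pvar t ^ k * z)"
    using assms(2) by (simp add: in_keys_iff lookup_minus)
  then obtain v where "u = single t k + v" by (auto simp: pvar_power keys_monomial_mult)
  then show ?thesis by (simp add: lookup_add)
qed

lemma cong_mult:
  fixes x y :: "'r::comm_ring_1"
  assumes "tideal I" "x - y \<in> I" "u - v \<in> I"
  shows "x * u - y * v \<in> I"
proof -
  have "x * u - y * v = (x - y) * u + y * (u - v)" by (simp add: algebra_simps)
  also have "\<dots> \<in> I" using assms by (intro tideal_add tideal_mult tideal_mult2)
  finally show ?thesis .
qed

lemma cong_power:
  fixes x y :: "'r::comm_ring_1"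
  assumes "tideal I" "x - y \<in> I"
  shows "x ^ n - y ^ n \<in> I"
  by (induction n) (simp_all add: assms cong_mult tideal_0)

text \<open>A product of elements from the annihilators of all factors multiplies the ring into
  \<open>J\<close>. If each annihilator had an element outside \<open>P\<close>, the product would
  be outside \<open>P\<close> as well, although \<open>J\<close> lies in \<open>P\<close>.\<close>

lemma filtration_annihilator_in_prime:
  assumes F: "CM_filtration m J r L" and P: "tprime P" "J \<subseteq> P"
  shows "\<exists>i<r. colon (L i) (L (Suc i)) \<subseteq> P"
proof (rule ccontr)
  assume "\<not> ?thesis"
  then have ex: "\<exists>x\<in>colon (L i) (L (Suc i)). x \<notin> P" if "i < r" for i using that by blast
  have "i \<le> r \<Longrightarrow> \<exists>x. x \<notin> P \<and> (\<forall>y\<in>L i. x * y \<in> J)" for i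
  proof (induction i)
    case 0
    have "1 \<notin> P" using P(1) by (simp add: tprime_def)
    then show ?case using F by (intro exI[of _ 1]) (simp add: CM_filtration_def)
  next
    case (Suc i)
    then obtain x where x: "x \<notin> P" "\<And>y. y \<in> L i \<Longrightarrow> x * y \<in> J" by auto
    obtain z where z: "z \<in> colon (L i) (L (Suc i))" "z \<notin> P" using ex[of i] Suc.prems by auto
    have "x * z * y \<in> J" if "y \<in> L (Suc i)" for y
      using x(2)[of "z * y"] z(1) that by (simp add: colon_def mult.assoc)
    moreover have "x * z \<notin> P" using x z P(1) by (simp add: tprime_mult)
    ultimately show ?case by blast
  qed
  then obtain x where "x \<notin> P" "\<And>y. y \<in> L r \<Longrightarrow> x * y \<in> J" by blast
  moreover have "L r = UNIV" using F by (simp add: CM_filtration_def)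
  ultimately show False using P(2) by (metis UNIV_I mult.right_neutral subsetD)
qed

context
  fixes a b c d t :: "'v::{finite,linorder}" and U :: "'v set set"
    and L :: "('v, 'k::field) mpol set"
  assumes dist: "distinct [a, b, c, d, t]" and univ: "UNIV = {a, b, c, d, t}"
    and upU: "upset U"
    and tU: "{t, a, c} \<in> U" "{t, a, d} \<in> U" "{t, b, c} \<in> U" "{t, b, d} \<in> U"
    and LI: "tideal L" and UL: "squarefree_ideal U \<subseteq> L"
    and LP: "L \<subseteq> face_ideal {a, b}" and LQ: "L \<subseteq> face_ideal {c, d}"
begin

abbreviation (input) "Pab \<equiv> face_ideal {a, b} :: ('v, 'k) mpol set"
abbreviation (input) "Qcd \<equiv> face_ideal {c, d} :: ('v, 'k) mpol set"
abbreviation (input) "Nabcd \<equiv> face_ideal {a, b, c, d} :: ('v, 'k) mpol set"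
abbreviation (input) "Xt \<equiv> pvar t :: ('v, 'k) mpol"

text \<open>Every monomial of the intersection has a variable from each pair, and together with
  \<open>t\<close> these form one of the four sets in \<open>tU\<close>. So \<open>Xt\<close> kills
  the difference between \<open>L\<close> and the intersection of the two primes.\<close>

lemma T_mult_PQ:
  assumes "x \<in> Pab" "x \<in> Qcd"
  shows "Xt * x \<in> L"
proof (rule subsetD[OF UL], unfold squarefree_ideal_def, safe)
  fix u assume "u \<in> pkeys (Xt * x)"
  then obtain v where v: "u = single t 1 + v" "v \<in> pkeys x"
    by (auto simp: pvar_def keys_monomial_mult)
  then have "pkeys v \<inter> {a, b} \<noteq> {}" "pkeys v \<inter> {c, d} \<noteq> {}"
    using assms by (auto simp: face_ideal_def squarefree_ideal_def)
  then obtain i j where "i \<in> pkeys v" "i = a \<or> i = b" "j \<in> pkeys v" "j = c \<or> j = d" by blast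
  moreover have "pkeys u = insert t (pkeys v)" by (simp add: v keys_add_nat)
  ultimately have "{t, i, j} \<in> U" "{t, i, j} \<subseteq> pkeys u" using tU by auto
  then show "pkeys u \<in> U" by (rule upsetD[OF upU])
qed

lemma T_notin: "Xt \<notin> Pab" "Xt \<notin> Qcd" "Xt \<notin> Nabcd"
  using dist by auto

lemma PN: "x \<in> Pab \<Longrightarrow> x \<in> Nabcd" and QN: "x \<in> Qcd \<Longrightarrow> x \<in> Nabcd"
  using face_ideal_mono[of "{a, b}" "{a, b, c, d}"] face_ideal_mono[of "{c, d}" "{a, b, c, d}"] by blast+

lemmas Pid = tidealD[OF tideal_face_ideal[of "{a, b}", where ?'b = 'k]]
lemmas Qid = tidealD[OF tideal_face_ideal[of "{c, d}", where ?'b = 'k]]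
lemmas Nid = tidealD[OF tideal_face_ideal[of "{a, b, c, d}", where ?'b = 'k]]

lemma N_split:
  assumes "x \<in> Nabcd" shows "\<exists>y. y \<in> Qcd \<and> x - y \<in> Pab"
proof -
  have "{a, b, c, d} = {a, b} \<union> {c, d}" by auto
  then have "x \<in> face_ideal ({a, b} \<union> {c, d})" using assms by metis
  then show ?thesis by (rule face_ideal_sum_split) blast
qed

text \<open>\<open>A\<close> and \<open>B\<close> say that \<open>\<alpha>, \<beta>\<close> is
  weakly regular on \<open>R/L\<close>. On the components \<open>R/Pab\<close> and
  \<open>R/Qcd\<close> this becomes regularity up to the factor \<open>Xt\<close>, because elements
  of the intersection are known to enter \<open>L\<close> only after multiplication by
  \<open>Xt\<close>.\<close>

lemma not_regular_aux:
  fixes \<alpha> \<beta> :: "('v, 'k) mpol"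
  assumes A: "\<And>x. \<alpha> * x \<in> L \<Longrightarrow> x \<in> L"
    and B: "\<And>x u. \<beta> * x - \<alpha> * u \<in> L \<Longrightarrow> \<exists>v. x - \<alpha> * v \<in> L"
  shows "\<alpha> \<notin> Pab" "\<alpha> \<notin> Qcd" "\<not> (\<alpha> \<in> Nabcd \<and> \<beta> \<in> Nabcd)"
    "\<And>f g. \<beta> * f - \<alpha> * g \<in> Pab \<Longrightarrow> \<exists>s. Xt * f - \<alpha> * s \<in> Pab"
    "\<And>f g. \<beta> * f - \<alpha> * g \<in> Qcd \<Longrightarrow> \<exists>s. Xt * f - \<alpha> * s \<in> Qcd"
proof -
  show \<alpha>Pab: "\<alpha> \<notin> Pab"
  proof
    assume "\<alpha> \<in> Pab"
    then have "Xt * (\<alpha> * pvar c) \<in> L" by (intro T_mult_PQ Pid(4) Qid(3)) simp_all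
    then have "\<alpha> * (Xt * pvar c) \<in> L" by (simp add: mult.left_commute)
    then have "Xt * pvar c \<in> L" by (rule A)
    then have "Xt * pvar c \<in> Pab" using LP by blast
    then show False using dist by (auto simp: tprime_mult[OF tprime_face_ideal])
  qed
  show \<alpha>Qcd: "\<alpha> \<notin> Qcd"
  proof
    assume "\<alpha> \<in> Qcd"
    then have "Xt * (\<alpha> * pvar a) \<in> L" by (intro T_mult_PQ Pid(3) Qid(4)) simp_all
    then have "\<alpha> * (Xt * pvar a) \<in> L" by (simp add: mult.left_commute)
    then have "Xt * pvar a \<in> L" by (rule A)
    then have "Xt * pvar a \<in> Qcd" using LQ by blast
    then show False using dist by (auto simp: tprime_mult[OF tprime_face_ideal])
  qed
  show "\<not> (\<alpha> \<in> Nabcd \<and> \<beta> \<in> Nabcd)"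
  proof
    assume "\<alpha> \<in> Nabcd \<and> \<beta> \<in> Nabcd"
    then obtain y z where y: "y \<in> Qcd" "\<alpha> - y \<in> Pab" and z: "z \<in> Qcd" "\<beta> - z \<in> Pab"
      using N_split by blast
    \<comment> \<open>Modulo \<open>Pab\<close> the elements \<open>y\<close>, \<open>z\<close> are
      \<open>\<alpha>\<close>, \<open>\<beta>\<close>, and modulo \<open>Qcd\<close> they are zero,
      so this combination vanishes on both components. The resulting \<open>m\<close> would be
      \<open>Xt\<close> modulo \<open>Pab\<close> and zero modulo \<open>Qcd\<close>, which forces
      \<open>Xt\<close> into \<open>Nabcd\<close>.\<close>
    have "\<beta> * y - \<alpha> * z = (\<beta> - z) * y - (\<alpha> - y) * z" by (simp add: algebra_simps)
    also have "\<dots> \<in> Pab" by (rule Pid(6)[OF Pid(4)[OF z(2)] Pid(4)[OF y(2)]])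
    finally have "\<beta> * y - \<alpha> * z \<in> Pab" .
    moreover have "\<beta> * y - \<alpha> * z \<in> Qcd" by (rule Qid(6)[OF Qid(3)[OF y(1)] Qid(3)[OF z(1)]])
    ultimately have "Xt * (\<beta> * y - \<alpha> * z) \<in> L" by (rule T_mult_PQ)
    then have "\<beta> * (Xt * y) - \<alpha> * (Xt * z) \<in> L" by (simp add: algebra_simps)
    then obtain m where m: "Xt * y - \<alpha> * m \<in> L" using B by blast
    have "\<alpha> * (Xt - m) = Xt * (\<alpha> - y) + (Xt * y - \<alpha> * m)" by (simp add: algebra_simps)
    also have "\<dots> \<in> Pab" by (rule Pid(2)[OF Pid(3)[OF y(2)] subsetD[OF LP m]])
    finally have "Xt - m \<in> Pab" using \<alpha>Pab by (simp add: tprime_mult[OF tprime_face_ideal])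
    have "\<alpha> * m = Xt * y - (Xt * y - \<alpha> * m)" by simp
    also have "\<dots> \<in> Qcd" by (rule Qid(6)[OF Qid(3)[OF y(1)] subsetD[OF LQ m]])
    finally have "m \<in> Qcd" using \<alpha>Qcd by (simp add: tprime_mult[OF tprime_face_ideal])
    have "(Xt - m) + m \<in> Nabcd" by (rule Nid(2)[OF PN[OF \<open>Xt - m \<in> Pab\<close>] QN[OF \<open>m \<in> Qcd\<close>]])
    then show False using T_notin by simp
  qed
  \<comment> \<open>Stated for general \<open>V\<close> and \<open>W\<close> to serve both
    components. Multiplying by \<open>Xt\<close> and a variable of \<open>W\<close> moves the
    relation into \<open>L\<close>, where \<open>B\<close> applies; two variables \<open>i\<close>,
    \<open>j\<close> of \<open>W\<close> give quotients \<open>si\<close>, \<open>sj\<close>, and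
    comparing them shows that \<open>si\<close> is divisible by \<open>pvar i\<close> modulo the
    prime of \<open>V\<close>.\<close>
  have division: "\<exists>s. Xt * f - \<alpha> * s \<in> face_ideal V"
    if fg: "\<beta> * f - \<alpha> * g \<in> face_ideal V" and \<alpha>: "\<alpha> \<notin> face_ideal V"
      and LV: "L \<subseteq> face_ideal V" and W: "pvar i \<in> face_ideal W" "pvar j \<in> face_ideal W"
      and VW: "\<And>x. x \<in> face_ideal V \<Longrightarrow> x \<in> face_ideal W \<Longrightarrow> Xt * x \<in> L"
      and ij: "i \<notin> V" "j \<notin> insert i V"
    for f g i j V W
  proof -
    let ?V = "face_ideal V :: ('v, 'k) mpol set"
    note id = tidealD[OF tideal_face_ideal[of V, where ?'b = 'k]]
    have *: "\<exists>s. f * Xt * pvar k - \<alpha> * s \<in> L" if k: "pvar k \<in> face_ideal W" for k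
    proof -
      have "Xt * ((\<beta> * f - \<alpha> * g) * pvar k) \<in> L"
        using fg k by (intro VW id(4)) (auto intro: tideal_mult[OF tideal_face_ideal])
      then have "\<beta> * (f * Xt * pvar k) - \<alpha> * (g * Xt * pvar k) \<in> L" by (simp add: algebra_simps)
      then show ?thesis using B by blast
    qed
    obtain si where si: "f * Xt * pvar i - \<alpha> * si \<in> L" using * W by blast
    obtain sj where sj: "f * Xt * pvar j - \<alpha> * sj \<in> L" using * W by blast
    have "\<alpha> * (pvar i * sj - pvar j * si) =
        pvar j * (f * Xt * pvar i - \<alpha> * si) - pvar i * (f * Xt * pvar j - \<alpha> * sj)"
      by (simp add: algebra_simps)
    also have "\<dots> \<in> ?V"
      by (rule id(6)[OF id(3)[OF subsetD[OF LV si]] id(3)[OF subsetD[OF LV sj]]])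
    finally have "pvar i * sj - pvar j * si \<in> ?V"
      using \<alpha> by (simp add: tprime_mult[OF tprime_face_ideal])
    then have 1: "pvar i * sj - pvar j * si \<in> face_ideal (insert i V)"
      using face_ideal_mono[of V "insert i V"] by blast
    have "pvar i * sj \<in> face_ideal (insert i V)"
      by (rule tideal_mult2[OF tideal_face_ideal]) simp
    then have "pvar i * sj - (pvar i * sj - pvar j * si) \<in> face_ideal (insert i V)"
      using 1 by (rule tideal_diff[OF tideal_face_ideal])
    then have "pvar j * si \<in> face_ideal (insert i V)" by simp
    then have "si \<in> face_ideal (insert i V)"
      using ij by (simp add: tprime_mult[OF tprime_face_ideal])
    also have "face_ideal (insert i V) = ideal_step (pvar i) UNIV ?V"
      by (rule ideal_step_face[symmetric]) (simp add: id)
    finally obtain s where s: "si - pvar i * s \<in> ?V" by (auto simp: ideal_step_UNIV_iff)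
    have "pvar i * (Xt * f - \<alpha> * s) = (f * Xt * pvar i - \<alpha> * si) + \<alpha> * (si - pvar i * s)"
      by (simp add: algebra_simps)
    also have "\<dots> \<in> ?V" by (rule id(2)[OF subsetD[OF LV si] id(3)[OF s]])
    finally have "Xt * f - \<alpha> * s \<in> ?V" using ij by (simp add: tprime_mult[OF tprime_face_ideal])
    then show ?thesis by blast
  qed
  show "\<exists>s. Xt * f - \<alpha> * s \<in> Pab" if "\<beta> * f - \<alpha> * g \<in> Pab" for f g
    using dist by (intro division[OF that \<alpha>Pab LP, of c "{c, d}" d]) (auto intro: T_mult_PQ)
  show "\<exists>s. Xt * f - \<alpha> * s \<in> Qcd" if "\<beta> * f - \<alpha> * g \<in> Qcd" for f g
    using dist by (intro division[OF that \<alpha>Qcd LQ, of a "{a, b}" b]) (auto intro: T_mult_PQ)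
qed

lemma max_ideal_T: "x \<in> graded_max_ideal \<longleftrightarrow> (\<exists>z. x - Xt * z \<in> Nabcd)"
proof -
  have "graded_max_ideal = (face_ideal (insert t {a, b, c, d}) :: ('v, 'k) mpol set)"
    unfolding graded_max_ideal_eq univ by (simp add: insert_commute)
  also have "\<dots> = ideal_step Xt UNIV Nabcd"
    by (rule ideal_step_face[symmetric]) (simp add: Nid)
  finally have eq: "graded_max_ideal = ideal_step Xt UNIV Nabcd" .
  show ?thesis unfolding eq by (rule ideal_step_UNIV_iff)
qed

text \<open>Modulo \<open>Nabcd\<close> the ring is the polynomial ring in \<open>Xt\<close>, and
  \<open>k\<close> is the smaller order of vanishing of the two elements at the origin. Membership
  in the maximal ideal makes it positive; since \<open>k\<close> is greatest, one of the cofactors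
  does not vanish at the origin.\<close>

lemma common_T_power:
  assumes \<alpha>\<beta>: "\<alpha> \<in> graded_max_ideal" "\<beta> \<in> graded_max_ideal" and "\<not> (\<alpha> \<in> Nabcd \<and> \<beta> \<in> Nabcd)"
  obtains k z w where "0 < k" "\<alpha> - Xt ^ k * z \<in> Nabcd" "\<beta> - Xt ^ k * w \<in> Nabcd"
    "\<not> (z \<in> graded_max_ideal \<and> w \<in> graded_max_ideal)"
proof -
  define G where "G k \<longleftrightarrow> (\<exists>z w. \<alpha> - Xt ^ k * z \<in> Nabcd \<and> \<beta> - Xt ^ k * w \<in> Nabcd)" for k
  obtain x u where x: "x = \<alpha> \<or> x = \<beta>" "u \<in> pkeys x" "pkeys u \<inter> {a, b, c, d} = {}"
    using assms(3) by (force simp: face_ideal_def squarefree_ideal_def)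
  have bound: "k \<le> pcoeff u t" if "G k" for k
    using that x face_ideal_power_bound[of x t k _ "{a, b, c, d}" u] unfolding G_def by blast
  have G1: "G 1" using \<alpha>\<beta> by (simp add: G_def max_ideal_T)
  define k where "k = (GREATEST k. G k)"
  have Gk: "G k" unfolding k_def using GreatestI_nat[of G 1 "pcoeff u t"] G1 bound by blast
  have max: "\<not> G (Suc k)"
    using Greatest_le_nat[of G "Suc k" "pcoeff u t"] bound unfolding k_def by fastforce
  have k: "0 < k" using Greatest_le_nat[of G 1 "pcoeff u t"] bound G1 unfolding k_def by fastforce
  obtain z w where zw: "\<alpha> - Xt ^ k * z \<in> Nabcd" "\<beta> - Xt ^ k * w \<in> Nabcd" using Gk unfolding G_def by blast
  have "\<not> (z \<in> graded_max_ideal \<and> w \<in> graded_max_ideal)"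
  proof
    assume "z \<in> graded_max_ideal \<and> w \<in> graded_max_ideal"
    then obtain z' w' where z'w': "z - Xt * z' \<in> Nabcd" "w - Xt * w' \<in> Nabcd" by (auto simp: max_ideal_T)
    have "\<alpha> - Xt ^ Suc k * z' = (\<alpha> - Xt ^ k * z) + Xt ^ k * (z - Xt * z')" by (simp add: algebra_simps)
    also have "\<dots> \<in> Nabcd" by (rule Nid(2)[OF zw(1) Nid(3)[OF z'w'(1)]])
    finally have 1: "\<alpha> - Xt ^ Suc k * z' \<in> Nabcd" .
    have "\<beta> - Xt ^ Suc k * w' = (\<beta> - Xt ^ k * w) + Xt ^ k * (w - Xt * w')" by (simp add: algebra_simps)
    also have "\<dots> \<in> Nabcd" by (rule Nid(2)[OF zw(2) Nid(3)[OF z'w'(2)]])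
    finally have "G (Suc k)" using 1 unfolding G_def by blast
    then show False using max by blast
  qed
  then show thesis using that[OF k zw] by blast
qed

text \<open>Let \<open>\<epsilon>\<close> be the idempotent that is one modulo \<open>Pab\<close> and zero modulo \<open>Qcd\<close>.  It is not in
  \<open>R / (Pab \<inter> Qcd)\<close>, but \<open>Nabcd\<close> multiplies it into that ring, and multiplying by \<open>Xt\<close> as well makes
  the product well defined modulo \<open>L\<close>.  Regularity of the third element puts \<open>Xt * p12 * \<epsilon>\<close> into the
  ideal of the first two, and on the line where only \<open>Xt\<close> survives this reads \<open>Xt\<^sup>2 * z = al * \<sigma>\<close>.  The
  cubes make \<open>al\<close> divisible by \<open>Xt\<^sup>3 * z\<close> there, which is then absurd.\<close>

lemma no_regular_triple:
  assumes max: "{\<alpha>, \<beta>, \<gamma>} \<subseteq> graded_max_ideal" and reg: "weakly_regular [\<alpha>, \<beta>, \<gamma>] UNIV L"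
  shows False
proof -
  define al be where "al = \<alpha> ^ 3" and "be = \<beta> ^ 3"
  have reg0: "\<forall>x\<in>UNIV. \<alpha> * x \<in> L \<longrightarrow> x \<in> L" "weakly_regular [\<beta>, \<gamma>] UNIV (ideal_step \<alpha> UNIV L)"
    using reg unfolding weakly_regular.simps(2)[of \<alpha>] by blast+
  \<comment> \<open>\<open>\<beta>\<close> is cubed while it leads the sequence modulo
    \<open>\<alpha>\<close>; afterwards \<open>\<alpha>\<close> leads the whole sequence and can be
    cubed in turn.\<close>
  have "weakly_regular [be, \<gamma>] UNIV (ideal_step \<alpha> UNIV L)"
    unfolding be_def by (rule weakly_regular_power2[OF tideal_ideal_step[OF tideal_UNIV LI] reg0(2)])
  then have "weakly_regular [\<alpha>, be, \<gamma>] UNIV L"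
    using reg0(1) unfolding weakly_regular.simps(2)[of \<alpha>] by blast
  then have "weakly_regular [al, be, \<gamma>] UNIV L"
    unfolding al_def by (rule weakly_regular_power3[OF LI])
  then have reg3: "\<forall>x\<in>UNIV. al * x \<in> L \<longrightarrow> x \<in> L"
    "\<forall>x\<in>UNIV. be * x \<in> ideal_step al UNIV L \<longrightarrow> x \<in> ideal_step al UNIV L"
    "\<forall>x\<in>UNIV. \<gamma> * x \<in> ideal_step be UNIV (ideal_step al UNIV L) \<longrightarrow>
      x \<in> ideal_step be UNIV (ideal_step al UNIV L)"
    unfolding weakly_regular.simps by blast+
  have A: "x \<in> L" if "al * x \<in> L" for x using reg3(1) that by blast
  have B: "\<exists>v. x - al * v \<in> L" if "be * x - al * u \<in> L" for x u
    using reg3(2) that unfolding ideal_step_UNIV_iff by blast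
  have C: "\<exists>v u. x - be * v - al * u \<in> L" if "\<gamma> * x - be * v - al * u \<in> L" for x u v
    using reg3(3) that unfolding ideal_step_UNIV_iff by blast
  have Cn: "\<exists>v u. x - be * v - al * u \<in> L" if "\<gamma> ^ n * x - be * v - al * u \<in> L" for n x u v
    using that
  proof (induction n arbitrary: x u v)
    case 0
    then show ?case by auto
  next
    case (Suc n)
    then have "\<gamma> * (\<gamma> ^ n * x) - be * v - al * u \<in> L" by (simp add: mult.assoc)
    then show ?case using C Suc.IH by blast
  qed
  have alP: "al \<notin> Pab" by (rule not_regular_aux(1)[of al be]) (erule A, erule B)
  have alQ: "al \<notin> Qcd" by (rule not_regular_aux(2)[of al be]) (erule A, erule B)
  have alN: "\<not> (al \<in> Nabcd \<and> be \<in> Nabcd)" by (rule not_regular_aux(3)[of al be]) (erule A, erule B)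
  have divP: "\<exists>s. Xt * f - al * s \<in> Pab" if "be * f - al * g \<in> Pab" for f g
    by (rule not_regular_aux(4)[OF _ _ that]) (erule A, erule B)
  have divQ: "\<exists>s. Xt * f - al * s \<in> Qcd" if "be * f - al * g \<in> Qcd" for f g
    by (rule not_regular_aux(5)[OF _ _ that]) (erule A, erule B)
  note prime = tprime_mult[OF tprime_face_ideal]
  have "\<not> (\<alpha> \<in> Nabcd \<and> \<beta> \<in> Nabcd)"
    using alN Nid(3) by (auto simp: al_def be_def power3_eq_cube)
  then obtain k z0 w0 where k: "0 < k" and z0: "\<alpha> - Xt ^ k * z0 \<in> Nabcd" and w0: "\<beta> - Xt ^ k * w0 \<in> Nabcd"
    and zw0: "\<not> (z0 \<in> graded_max_ideal \<and> w0 \<in> graded_max_ideal)"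
    using common_T_power[of \<alpha> \<beta>] max by auto
  define K z w where "K = 3 * k" and "z = z0 ^ 3" and "w = w0 ^ 3"
  have z: "al - Xt ^ K * z \<in> Nabcd" and w: "be - Xt ^ K * w \<in> Nabcd"
    using cong_power[OF tideal_face_ideal z0, of 3] cong_power[OF tideal_face_ideal w0, of 3]
    by (simp_all add: al_def be_def K_def z_def w_def power_mult_distrib mult.commute flip: power_mult)
  have zw: "\<not> (z \<in> graded_max_ideal \<and> w \<in> graded_max_ideal)"
    using zw0 tprime_power[OF tprime_face_ideal] by (auto simp: z_def w_def graded_max_ideal_eq)
  \<comment> \<open>The third element is only brought to the same divisibility: its
    \<open>K\<close>-th power is divisible by \<open>Xt ^ K\<close> modulo \<open>Nabcd\<close>, and
    \<open>Cn\<close> cancels that power one factor at a time.\<close>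
  obtain g0 where "\<gamma> - Xt * g0 \<in> Nabcd" using max by (auto simp: max_ideal_T)
  then have "\<gamma> ^ K - (Xt * g0) ^ K \<in> Nabcd" by (rule cong_power[OF tideal_face_ideal])
  then obtain g where g: "\<gamma> ^ K - Xt ^ K * g \<in> Nabcd" by (auto simp: power_mult_distrib)
  \<comment> \<open>The rows \<open>(al, be, \<delta>)\<close> and \<open>(z, w, g)\<close> are
    proportional modulo \<open>Nabcd\<close> with factor \<open>Xt ^ K\<close>, so their two-by-two
    minors vanish there. The elements \<open>y12\<close>, \<open>y13\<close>, \<open>y23\<close>
    below represent these minors times the idempotent.\<close>
  define \<delta> p12 p13 p23 where "\<delta> = \<gamma> ^ K" and "p12 = z * be - w * al"
    and "p13 = z * \<delta> - g * al" and "p23 = w * \<delta> - g * be"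
  have cross: "r * y - s * x \<in> Nabcd" if "x - Xt ^ K * r \<in> Nabcd" "y - Xt ^ K * s \<in> Nabcd" for r s x y
  proof -
    have "r * y - s * x = r * (y - Xt ^ K * s) - s * (x - Xt ^ K * r)" by (simp add: algebra_simps)
    also have "\<dots> \<in> Nabcd" by (rule Nid(6)[OF Nid(3)[OF that(2)] Nid(3)[OF that(1)]])
    finally show ?thesis .
  qed
  have pN: "p12 \<in> Nabcd" "p13 \<in> Nabcd" "p23 \<in> Nabcd"
    unfolding p12_def p13_def p23_def \<delta>_def by (rule cross z w g)+
  obtain y12 where y12: "y12 \<in> Qcd" "p12 - y12 \<in> Pab" using N_split[OF pN(1)] by blast
  obtain y13 where y13: "y13 \<in> Qcd" "p13 - y13 \<in> Pab" using N_split[OF pN(2)] by blast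
  obtain y23 where y23: "y23 \<in> Qcd" "p23 - y23 \<in> Pab" using N_split[OF pN(3)] by blast
  \<comment> \<open>The minors satisfy \<open>\<delta> * p12 - be * p13 + al * p23 = 0\<close>, so
    replacing each by its multiple of the idempotent gives an element of both primes.\<close>
  define E where "E = \<delta> * y12 - be * y13 + al * y23"
  have "E \<in> Qcd"
    unfolding E_def by (rule Qid(2)[OF Qid(6)[OF Qid(3)[OF y12(1)] Qid(3)[OF y13(1)]] Qid(3)[OF y23(1)]])
  moreover have "E \<in> Pab"
  proof -
    have "E = be * (p13 - y13) - \<delta> * (p12 - y12) - al * (p23 - y23)"
      by (simp add: E_def p12_def p13_def p23_def algebra_simps)
    also have "\<dots> \<in> Pab"
      by (rule Pid(6)[OF Pid(6)[OF Pid(3)[OF y13(2)] Pid(3)[OF y12(2)]] Pid(3)[OF y23(2)]])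
    finally show ?thesis .
  qed
  ultimately have "Xt * E \<in> L" by (intro T_mult_PQ)
  then have "\<gamma> ^ K * (Xt * y12) - be * (Xt * y13) - al * (- (Xt * y23)) \<in> L"
    by (simp add: E_def \<delta>_def algebra_simps)
  then obtain m2 m1 where m: "Xt * y12 - be * m2 - al * m1 \<in> L" using Cn by blast
  \<comment> \<open>Modulo \<open>Pab\<close> the element \<open>y12\<close> is
    \<open>p12 = z * be - w * al\<close>, and modulo \<open>Qcd\<close> it is zero; the one relation
    for \<open>y12\<close> thus becomes two relations between \<open>be\<close> and
    \<open>al\<close>, one on each component.\<close>
  have mP: "be * (Xt * z - m2) - al * (m1 + Xt * w) \<in> Pab"
  proof -
    have "be * (Xt * z - m2) - al * (m1 + Xt * w) = (Xt * y12 - be * m2 - al * m1) + Xt * (p12 - y12)"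
      by (simp add: p12_def algebra_simps)
    also have "\<dots> \<in> Pab" by (rule Pid(2)[OF subsetD[OF LP m] Pid(3)[OF y12(2)]])
    finally show ?thesis .
  qed
  have mQ: "be * m2 - al * (- m1) \<in> Qcd"
  proof -
    have "be * m2 - al * (- m1) = Xt * y12 - (Xt * y12 - be * m2 - al * m1)" by simp
    also have "\<dots> \<in> Qcd" by (rule Qid(6)[OF Qid(3)[OF y12(1)] subsetD[OF LQ m]])
    finally show ?thesis .
  qed
  obtain s where s: "Xt * (Xt * z - m2) - al * s \<in> Pab" using divP[OF mP] by blast
  obtain s' where s': "Xt * m2 - al * s' \<in> Qcd" using divQ[OF mQ] by blast
  have t: "Xt * (m1 + Xt * w) - be * s \<in> Pab"
  proof -
    have "al * (Xt * (m1 + Xt * w) - be * s) =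
        be * (Xt * (Xt * z - m2) - al * s) - Xt * (be * (Xt * z - m2) - al * (m1 + Xt * w))"
      by (simp add: algebra_simps)
    also have "\<dots> \<in> Pab" by (rule Pid(6)[OF Pid(3)[OF s] Pid(3)[OF mP]])
    finally show ?thesis using alP by (simp add: prime)
  qed
  have t': "Xt * (- m1) - be * s' \<in> Qcd"
  proof -
    have "al * (Xt * (- m1) - be * s') = be * (Xt * m2 - al * s') - Xt * (be * m2 - al * (- m1))"
      by (simp add: algebra_simps)
    also have "\<dots> \<in> Qcd" by (rule Qid(6)[OF Qid(3)[OF s'] Qid(3)[OF mQ]])
    finally show ?thesis using alQ by (simp add: prime)
  qed
  have K: "K = Suc (K - 3) + 2" using k by (simp add: K_def)
  \<comment> \<open>On the line the hypotheses read
    \<open>Xt ^ 2 * r = Xt ^ K * r * \<sigma>\<close> with \<open>K\<close> at least three, so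
    \<open>r\<close> times \<open>1 - Xt ^ (K - 2) * \<sigma>\<close> vanishes, and the second
    factor is one at the origin.\<close>
  have fin: "r \<in> graded_max_ideal" if "Xt ^ 2 * r - x * \<sigma> \<in> Nabcd" "x - Xt ^ K * r \<in> Nabcd" for r x \<sigma>
  proof -
    have TK: "Xt ^ K = Xt ^ 2 * (Xt * Xt ^ (K - 3))"
      by (subst K) (simp add: power_add algebra_simps power2_eq_square)
    have "Xt ^ 2 * (r * (1 - Xt * (Xt ^ (K - 3) * \<sigma>))) = (Xt ^ 2 * r - x * \<sigma>) + (x - Xt ^ K * r) * \<sigma>"
      unfolding TK by (simp add: algebra_simps)
    also have "\<dots> \<in> Nabcd" by (rule Nid(2)[OF that(1) Nid(4)[OF that(2)]])
    finally have "r \<in> Nabcd \<or> 1 - Xt * (Xt ^ (K - 3) * \<sigma>) \<in> Nabcd"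
      using T_notin(3) by (simp add: prime power2_eq_square)
    then show ?thesis
    proof
      assume "r \<in> Nabcd"
      then show ?thesis unfolding max_ideal_T by (intro exI[of _ 0]) simp
    next
      assume "1 - Xt * (Xt ^ (K - 3) * \<sigma>) \<in> Nabcd"
      then have "1 \<in> (graded_max_ideal :: ('v, 'k) mpol set)" unfolding max_ideal_T by blast
      then show ?thesis
        using tprime_face_ideal[of "UNIV :: 'v set", where ?'k = 'k]
        by (simp add: graded_max_ideal_eq tprime_def)
    qed
  qed
  \<comment> \<open>Both relations hold on the common line; adding them cancels \<open>m2\<close>
    here and \<open>m1\<close> in the companion for \<open>w\<close>.\<close>
  have "Xt ^ 2 * z - al * (s + s') = (Xt * (Xt * z - m2) - al * s) + (Xt * m2 - al * s')"
    by (simp add: algebra_simps power2_eq_square)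
  also have "\<dots> \<in> Nabcd" by (rule Nid(2)[OF PN[OF s] QN[OF s']])
  finally have "z \<in> graded_max_ideal" using z fin by blast
  have "Xt ^ 2 * w - be * (s + s') = (Xt * (m1 + Xt * w) - be * s) + (Xt * (- m1) - be * s')"
    by (simp add: algebra_simps power2_eq_square)
  also have "\<dots> \<in> Nabcd" by (rule Nid(2)[OF PN[OF t] QN[OF t']])
  finally have "w \<in> graded_max_ideal" using w fin by blast
  then show False using zw \<open>z \<in> graded_max_ideal\<close> by blast
qed

end

text \<open>Each of the two primes contains the annihilator of some factor, which then has dimension
  at least three. No factor has larger dimension and the dimensions increase strictly, so both times
  it is the last factor. Its ideal therefore lies in both primes, and Cohen--Macaulayness would
  provide a regular sequence of three elements.\<close>

lemma not_SCM_ideal: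
  fixes a b c d t :: "'v::{finite,linorder}"
  assumes dist: "distinct [a, b, c, d, t]" and univ: "UNIV = {a, b, c, d, t}" and up: "upset U"
    and tU: "{t, a, c} \<in> U" "{t, a, d} \<in> U" "{t, b, c} \<in> U" "{t, b, d} \<in> U"
    and ab: "- {a, b} \<notin> U" and cd: "- {c, d} \<notin> U" and four: "large 4 \<subseteq> U"
  shows "\<not> SCM_ideal (squarefree_ideal U :: ('v, 'k::field) mpol set)"
proof
  let ?J = "squarefree_ideal U :: ('v, 'k) mpol set"
  assume "SCM_ideal ?J"
  then obtain r L where F: "CM_filtration graded_max_ideal ?J r L"
    using SCM_ideal_imp_filtration tideal_squarefree_ideal[OF up] by blast
  have L0: "L 0 = ?J" and Lr: "L r = UNIV" and id: "\<And>i. i \<le> r \<Longrightarrow> tideal (L i)"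
    and sub: "\<And>i. i < r \<Longrightarrow> L i \<subset> L (Suc i)"
    and cm: "\<And>i. i < r \<Longrightarrow> pair_CM graded_max_ideal (L (Suc i)) (L i)"
    and dims: "\<And>i j. i < j \<Longrightarrow> j < r \<Longrightarrow>
      quot_dim (colon (L i) (L (Suc i))) < quot_dim (colon (L j) (L (Suc j)))"
    using F unfolding CM_filtration_def by blast+
  \<comment> \<open>All factors are annihilated by \<open>?J\<close>, whose faces have at most three
    elements.\<close>
  have le3: "quot_dim (colon (L i) (L (Suc i))) \<le> 3" if i: "i < r" for i
  proof -
    have "?J \<subseteq> L i" using chain_subset[of r L 0 i] sub i L0 by auto
    then have "?J \<subseteq> colon (L i) (L (Suc i))"
      using tideal_mult2[OF id[of i]] i by (auto simp: colon_def)
    then have "quot_dim (colon (L i) (L (Suc i))) \<le> enat 3"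
    proof (rule quot_dim_le)
      show "card S \<le> 3" if "S \<notin> U" for S using four that by force
    qed
    then show ?thesis by (simp add: numeral_eq_enat)
  qed
  have card3: "card (- {x, y}) = 3" if "x \<noteq> y" for x y :: 'v
  proof -
    have "card (UNIV :: 'v set) = 5" unfolding univ using dist by simp
    then show ?thesis using that by (simp add: Compl_eq_Diff_UNIV card_Diff_subset)
  qed
  have top: "Suc (r - 1) = r \<and> L (r - 1) \<subseteq> face_ideal {x, y}"
    if xy: "x \<noteq> y" "- {x, y} \<notin> U" for x y
  proof -
    have "?J \<subseteq> face_ideal {x, y}" by (rule squarefree_ideal_subset_face_ideal[OF xy(2) up])
    then obtain i where i: "i < r" "colon (L i) (L (Suc i)) \<subseteq> face_ideal {x, y}"
      using filtration_annihilator_in_prime[OF F tprime_face_ideal] by blast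
    have ge: "3 \<le> quot_dim (colon (L i) (L (Suc i)))"
      using quot_dim_ge[OF i(2)] card3[OF xy(1)] by (simp add: numeral_eq_enat)
    have "i = r - 1"
    proof (rule ccontr)
      assume "i \<noteq> r - 1"
      then have "i < r - 1" "r - 1 < r" using i(1) by auto
      then show False using dims[of i "r - 1"] le3[of "r - 1"] ge by simp
    qed
    moreover have "colon (L (r - 1)) UNIV = L (r - 1)"
      using tideal_mult2[OF id[of "r - 1"]] by (auto simp: colon_def) (metis mult.right_neutral)
    ultimately show ?thesis using i Lr by auto
  qed
  define M where "M = L (r - 1)"
  have M: "tideal M" "?J \<subseteq> M" "M \<subseteq> face_ideal {a, b}" "M \<subseteq> face_ideal {c, d}"
    using top[of a b] top[of c d] ab cd dist id[of "r - 1"] chain_subset[of r L 0 "r - 1"] sub L0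
    by (auto simp: M_def)
  have r: "Suc (r - 1) = r" "r - 1 < r" using top[of a b] ab dist by auto
  have colM: "colon M UNIV = M"
    using tideal_mult2[OF M(1)] by (auto simp: colon_def) (metis mult.right_neutral)
  have "UNIV \<noteq> M" using M(3) tprime_face_ideal[of "{a, b}"] by (auto simp: tprime_def)
  then have "pair_depth graded_max_ideal UNIV M = quot_dim M"
    using cm[OF r(2)] unfolding r(1) Lr M_def[symmetric] pair_CM_def colM by simp
  moreover have "3 \<le> quot_dim M"
    using quot_dim_ge[OF M(3)] card3[of a b] dist by (simp add: numeral_eq_enat)
  ultimately have depth: "3 \<le> pair_depth graded_max_ideal UNIV M" by simp
  have "\<exists>as. set as \<subseteq> graded_max_ideal \<and> weakly_regular as UNIV M \<and> 3 \<le> length as"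
  proof (rule ccontr)
    assume no: "\<not> ?thesis"
    have "pair_depth graded_max_ideal UNIV M \<le> enat 2"
      unfolding pair_depth_def
    proof (rule Sup_least)
      fix x assume "x \<in> {enat (length as) |as. set as \<subseteq> graded_max_ideal \<and>
        weakly_regular as UNIV M \<and> ideal_steps as UNIV M \<noteq> UNIV}"
      then obtain as where as: "x = enat (length as)" "set as \<subseteq> graded_max_ideal" "weakly_regular as UNIV M"
        by blast
      then have "\<not> 3 \<le> length as" using no by blast
      then show "x \<le> enat 2" by (simp add: as(1))
    qed
    then have "3 \<le> enat 2" using depth by (rule order_trans[rotated])
    then show False by (simp add: numeral_eq_enat)
  qed
  then obtain as where as: "set as \<subseteq> graded_max_ideal" "weakly_regular as UNIV M" "3 \<le> length as" by blast
  then obtain x y z zs where xyz: "as = [x, y, z] @ zs"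
    by (metis One_nat_def Suc_le_length_iff append_Cons append_Nil numeral_3_eq_3)
  have "weakly_regular [x, y, z] UNIV M" using as(2) unfolding xyz weakly_regular_append by blast
  moreover have "{x, y, z} \<subseteq> graded_max_ideal" using as(1) by (simp add: xyz)
  ultimately show False
    using no_regular_triple[OF dist univ up tU M(1-4)] by blast
qed

section \<open>Minimal generators and matroidal ideals\<close>

definition exp_dvd :: "'v mpol_exp \<Rightarrow> 'v mpol_exp \<Rightarrow> bool" where
  "exp_dvd w u \<longleftrightarrow> (\<exists>t. u = w + t)"

lemma exp_dvd_iff: "exp_dvd w u \<longleftrightarrow> (\<forall>i. pcoeff w i \<le> pcoeff u i)"
proof
  assume le: "\<forall>i. pcoeff w i \<le> pcoeff u i"
  have "u = w + (u - w)" by (rule poly_mapping_eqI) (simp add: lookup_add lookup_minus le)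
  then show "exp_dvd w u" unfolding exp_dvd_def ..
qed (auto simp: exp_dvd_def lookup_add)

lemma exp_dvd_refl [simp]: "exp_dvd u u"
  by (simp add: exp_dvd_iff)

lemma exp_dvd_trans: "exp_dvd u v \<Longrightarrow> exp_dvd v w \<Longrightarrow> exp_dvd u w"
  unfolding exp_dvd_iff using order_trans by blast

lemma exp_dvd_antisym: "exp_dvd u v \<Longrightarrow> exp_dvd v u \<Longrightarrow> u = v"
  unfolding exp_dvd_iff by (intro poly_mapping_eqI) (simp add: order_antisym)

lemma exp_dvd_mdeg: "exp_dvd w u \<Longrightarrow> mdeg w \<le> mdeg u"
  unfolding exp_dvd_iff mdeg_def by (intro sum_mono) simp

lemma exp_dvd_mdeg_eq:
  assumes "exp_dvd w u" "mdeg w = mdeg u"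
  shows "w = u"
proof -
  obtain t where t: "u = w + t" using assms(1) by (auto simp: exp_dvd_def)
  then have "mdeg t = 0" using assms(2) by (simp add: mdeg_add)
  then have "t = 0" by (intro poly_mapping_eqI) (simp add: mdeg_def)
  then show ?thesis using t by simp
qed

lemma Idl_monomials_exp_dvd:
  "Idl\<^bsub>mpol_ring\<^esub> (monomial ` S :: ('v, 'k::field) mpol set) =
    {f. \<forall>u\<in>pkeys f. \<exists>s\<in>S. exp_dvd s u}"
  by (simp add: Idl_monomials exp_dvd_def)

definition minimal_exps :: "('v, 'k::field) mpol set \<Rightarrow> 'v mpol_exp set" where
  "minimal_exps I = {u. monomial u \<in> I \<and> (\<forall>v. monomial v \<in> I \<and> exp_dvd v u \<longrightarrow> v = u)}"

lemma minimal_exps_below: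
  fixes I :: "('v::finite, 'k::field) mpol set"
  assumes "monomial u \<in> I"
  shows "\<exists>s\<in>minimal_exps I. exp_dvd s u"
  using assms
proof (induction "mdeg u" arbitrary: u rule: less_induct)
  case less
  show ?case
  proof (cases "u \<in> minimal_exps I")
    case False
    then obtain v where v: "monomial v \<in> I" "exp_dvd v u" "v \<noteq> u"
      using less.prems by (auto simp: minimal_exps_def)
    then have "mdeg v < mdeg u" using exp_dvd_mdeg exp_dvd_mdeg_eq by (metis le_neq_implies_less)
    then obtain s where "s \<in> minimal_exps I" "exp_dvd s v" using less.hyps v(1) by blast
    then show ?thesis using exp_dvd_trans v(2) by blast
  qed (use exp_dvd_refl in blast)
qed

text \<open>Every monomial generating set contains the monomials of \<open>I\<close> minimal under
  divisibility, and these already generate; so the set described by \<open>THE\<close> exists and is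
  unique.\<close>

lemma min_gens_eq:
  fixes I :: "('v::finite, 'k::field) mpol set"
  assumes "monomial_ideal I"
  shows "min_gens I = minimal_exps I" "Idl\<^bsub>mpol_ring\<^esub> (monomial ` min_gens I) = I"
proof -
  obtain S where S: "I = Idl\<^bsub>mpol_ring\<^esub> (monomial ` S)" using assms by (auto simp: monomial_ideal_def)
  let ?M = "minimal_exps I"
  have gen: "Idl\<^bsub>mpol_ring\<^esub> (monomial ` ?M) = I"
  proof
    have "monomial ` ?M \<subseteq> I" by (auto simp: minimal_exps_def)
    moreover have "tideal I" unfolding S by (rule tideal_Idl)
    ultimately show "Idl\<^bsub>mpol_ring\<^esub> (monomial ` ?M) \<subseteq> I" using Idl_least by blast
    show "I \<subseteq> Idl\<^bsub>mpol_ring\<^esub> (monomial ` ?M)"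
    proof
      fix f assume f: "f \<in> I"
      have "\<exists>s\<in>?M. exp_dvd s u" if u: "u \<in> pkeys f" for u
      proof (rule minimal_exps_below)
        show "monomial u \<in> I" using f u unfolding S Idl_monomials_exp_dvd by auto
      qed
      then show "f \<in> Idl\<^bsub>mpol_ring\<^esub> (monomial ` ?M)" unfolding Idl_monomials_exp_dvd by blast
    qed
  qed
  have sub: "?M \<subseteq> T" if T: "Idl\<^bsub>mpol_ring\<^esub> (monomial ` T) = I" for T
  proof
    fix u assume u: "u \<in> ?M"
    then have "monomial u \<in> Idl\<^bsub>mpol_ring\<^esub> (monomial ` T :: ('v, 'k) mpol set)"
      unfolding T by (simp add: minimal_exps_def)
    then obtain s where s: "s \<in> T" "exp_dvd s u" unfolding Idl_monomials_exp_dvd by auto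
    have "monomial s \<in> I" using Idl_superset[of "monomial ` T"] s(1) T by blast
    then show "u \<in> T" using u s by (auto simp: minimal_exps_def)
  qed
  show eq: "min_gens I = ?M"
    unfolding min_gens_def
  proof (rule the_equality)
    show "Idl\<^bsub>mpol_ring\<^esub> (monomial ` ?M) = I \<and>
      (\<forall>T. T \<subset> ?M \<longrightarrow> Idl\<^bsub>mpol_ring\<^esub> (monomial ` T) \<noteq> I)"
      using gen sub by blast
    fix T assume "Idl\<^bsub>mpol_ring\<^esub> (monomial ` T) = I \<and>
      (\<forall>T'. T' \<subset> T \<longrightarrow> Idl\<^bsub>mpol_ring\<^esub> (monomial ` T') \<noteq> I)"
    then show "T = ?M" using sub[of T] gen by blast
  qed
  show "Idl\<^bsub>mpol_ring\<^esub> (monomial ` min_gens I) = I" unfolding eq by (rule gen)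
qed

lemma min_gens_Idl:
  fixes S :: "'v::finite mpol_exp set"
  assumes "\<And>u v. u \<in> S \<Longrightarrow> v \<in> S \<Longrightarrow> exp_dvd v u \<Longrightarrow> v = u"
  shows "min_gens (Idl\<^bsub>mpol_ring\<^esub> (monomial ` S) :: ('v, 'k::field) mpol set) = S"
proof -
  let ?I = "Idl\<^bsub>mpol_ring\<^esub> (monomial ` S) :: ('v, 'k) mpol set"
  have mem: "monomial u \<in> ?I \<longleftrightarrow> (\<exists>s\<in>S. exp_dvd s u)" for u
    unfolding Idl_monomials_exp_dvd by simp
  have "monomial_ideal ?I" unfolding monomial_ideal_def by blast
  then have "min_gens ?I = minimal_exps ?I" by (rule min_gens_eq)
  also have "\<dots> = S"
  proof
    show "minimal_exps ?I \<subseteq> S"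
    proof
      fix u assume u: "u \<in> minimal_exps ?I"
      then obtain s where s: "s \<in> S" "exp_dvd s u" by (auto simp: minimal_exps_def mem)
      then have "s = u" using u exp_dvd_refl[of s] unfolding minimal_exps_def mem by blast
      then show "u \<in> S" using s by simp
    qed
    show "S \<subseteq> minimal_exps ?I"
    proof
      fix u assume u: "u \<in> S"
      have "v = u" if "s \<in> S" "exp_dvd s v" "exp_dvd v u" for s v
        using assms[OF u that(1)] exp_dvd_trans[OF that(2,3)] that exp_dvd_antisym by blast
      then show "u \<in> minimal_exps ?I" using u exp_dvd_refl[of u] unfolding minimal_exps_def mem by blast
    qed
  qed
  finally show ?thesis .
qed

lemma coeff_mult_unique:
  fixes h k :: "'a::comm_monoid_add \<Rightarrow>\<^sub>0 'b::comm_semiring_0"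
  assumes "\<And>p q. p \<in> pkeys h \<Longrightarrow> q \<in> pkeys k \<Longrightarrow> p + q = m + n \<Longrightarrow> p = m \<and> q = n"
    and "m \<in> pkeys h" "n \<in> pkeys k"
  shows "pcoeff (h * k) (m + n) = pcoeff h m * pcoeff k n"
proof -
  have "h * k = (\<Sum>p\<in>pkeys h. \<Sum>q\<in>pkeys k. single (p + q) (pcoeff h p * pcoeff k q))"
    by (subst expand_poly[of h], subst expand_poly[of k])
      (simp add: sum_product mult_single)
  then have "pcoeff (h * k) (m + n) =
      (\<Sum>p\<in>pkeys h. \<Sum>q\<in>pkeys k. if p + q = m + n then pcoeff h p * pcoeff k q else 0)"
    by (simp add: lookup_sum lookup_single when_def)
  also have "\<dots> = (\<Sum>p\<in>pkeys h. \<Sum>q\<in>pkeys k. if p = m then if q = n then pcoeff h m * pcoeff k n else 0 else 0)"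
    by (intro sum.cong) (use assms(1) in auto)
  also have "\<dots> = pcoeff h m * pcoeff k n"
    using assms(2,3) by (simp add: sum.delta' sum.If_cases)
  finally show ?thesis .
qed

text \<open>Compare the largest and the smallest exponents of the two factors in a monomial order.\<close>

lemma dvd_monomial_imp:
  fixes h :: "('v::{finite,linorder}, 'k::field) mpol"
  assumes "h dvd monomial u"
  obtains w where "pkeys h = {w}" "exp_dvd w u"
proof -
  obtain k where k: "monomial u = h * k" using assms by (auto simp: dvd_def)
  have ne: "pkeys h \<noteq> {}" "pkeys k \<noteq> {}"
    using k keys_monomial[of u, where ?'k = 'k] by (metis insert_not_empty keys_eq_empty mult_zero_left, metis insert_not_empty keys_eq_empty mult_zero_right)
  define M N m n where "M = Max (pkeys h)" and "N = Max (pkeys k)"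
    and "m = Min (pkeys h)" and "n = Min (pkeys k)"
  have mem: "M \<in> pkeys h" "N \<in> pkeys k" "m \<in> pkeys h" "n \<in> pkeys k"
    unfolding M_def N_def m_def n_def using ne by (auto intro: Max_in Min_in)
  have le: "p \<le> M" "m \<le> p" if "p \<in> pkeys h" for p
    using that by (simp_all add: M_def m_def)
  have le': "q \<le> N" "n \<le> q" if "q \<in> pkeys k" for q
    using that by (simp_all add: N_def n_def)
  \<comment> \<open>Equal sums turn both inequalities into equalities; the fact serves the largest
    exponents and, with the roles exchanged, the smallest ones.\<close>
  have max: "p = M \<and> q = N" if "p \<le> M" "q \<le> N" "p + q = M + N" for p q M N :: "'v mpol_exp"
    using that by (metis add_left_cancel add_right_cancel add_less_le_mono add_le_less_mono less_irrefl order_le_less)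
  have uniq: "p = M \<and> q = N" if "p \<in> pkeys h" "q \<in> pkeys k" "p + q = M + N" for p q
    using max[OF le(1)[OF that(1)] le'(1)[OF that(2)] that(3)] .
  have uniq': "p = m \<and> q = n" if "p \<in> pkeys h" "q \<in> pkeys k" "p + q = m + n" for p q
    using max[OF le(2)[OF that(1)] le'(2)[OF that(2)] that(3)[symmetric]] by simp
  have "pcoeff (h * k) (M + N) = pcoeff h M * pcoeff k N"
    by (rule coeff_mult_unique) (use uniq mem in blast)+
  then have "pcoeff (h * k) (M + N) \<noteq> 0" using mem by (simp add: in_keys_iff)
  moreover have "pcoeff (h * k) (m + n) = pcoeff h m * pcoeff k n"
    by (rule coeff_mult_unique) (use uniq' mem in blast)+
  then have "pcoeff (h * k) (m + n) \<noteq> 0" using mem by (simp add: in_keys_iff)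
  ultimately have "M + N \<in> pkeys (monomial u :: ('v, 'k) mpol)" "m + n \<in> pkeys (monomial u :: ('v, 'k) mpol)"
    unfolding k in_keys_iff by blast+
  then have u: "M + N = u" "m + n = u" by simp_all
  then have "m = M" using max[of m M n N] le[OF mem(1)] le'[OF mem(2)] by simp
  then have "pkeys h = {M}" using le mem by (auto simp: order_antisym)
  moreover have "exp_dvd M u" using u by (auto simp: exp_dvd_def)
  ultimately show thesis by (rule that)
qed

lemma monomial_dvd_iff:
  "(monomial w :: ('v::{finite,linorder}, 'k::field) mpol) dvd monomial u \<longleftrightarrow> exp_dvd w u"
proof
  assume "(monomial w :: ('v, 'k) mpol) dvd monomial u"
  then show "exp_dvd w u" by (rule dvd_monomial_imp) simp
qed (auto simp: exp_dvd_def monomial_add)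

lemma pvar_dvd_iff:
  "(pvar i :: ('v::{finite,linorder}, 'k::field) mpol) dvd monomial u \<longleftrightarrow> i \<in> pkeys u"
  unfolding pvar_def monomial_dvd_iff exp_dvd_iff
  by (auto simp: lookup_single when_def in_keys_iff Suc_le_eq split: if_splits)

text \<open>The divisors competing in the definition of the gcd are arbitrary polynomials, so
  nonzero scalar multiples of monomials have to be covered.\<close>

lemma dvd_monomial_iff:
  fixes h :: "('v::{finite,linorder}, 'k::field) mpol"
  assumes "pkeys h = {w}"
  shows "h dvd monomial u \<longleftrightarrow> exp_dvd w u"
proof
  assume "h dvd monomial u"
  then show "exp_dvd w u" using assms by (auto elim: dvd_monomial_imp)
next
  assume "exp_dvd w u"
  then have "(monomial w :: ('v, 'k) mpol) dvd monomial u" by (simp add: monomial_dvd_iff)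
  moreover have "h dvd monomial w"
  proof -
    have h: "h = single w (pcoeff h w)" using expand_poly[of h] assms by simp
    have "pcoeff h w \<noteq> 0" using assms by (auto simp: in_keys_iff)
    then have "h * single 0 (inverse (pcoeff h w)) = monomial w"
      by (subst h) (simp add: mult_single monomial_def)
    then show ?thesis by (metis dvd_triv_left)
  qed
  ultimately show "h dvd monomial u" by (rule dvd_trans[rotated])
qed

section \<open>Squarefree generators and matroid bases\<close>

definition upgen :: "'v set set \<Rightarrow> 'v set set" where
  "upgen B = {S. \<exists>T\<in>B. T \<subseteq> S}"

lemma upset_upgen: "upset (upgen B)"
  unfolding upgen_def by (auto simp: upset_def)

lemma exp_dvd_sqfree_iff: "exp_dvd (sqfree_exp S) u \<longleftrightarrow> S \<subseteq> pkeys u"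
  unfolding exp_dvd_def by (rule sqfree_exp_dvd_iff)

lemma Idl_sqfree:
  "Idl\<^bsub>mpol_ring\<^esub> (monomial ` sqfree_exp ` B) =
    (squarefree_ideal (upgen B) :: ('v::finite, 'k::field) mpol set)"
  by (simp add: Idl_monomials_exp_dvd squarefree_ideal_def upgen_def exp_dvd_sqfree_iff)

lemma inj_sqfree_exp: "inj sqfree_exp"
  by (rule injI) (metis keys_sqfree_exp)

lemma mdeg_sqfree_exp: "mdeg (sqfree_exp S) = card S"
  by (simp add: mdeg_def coeff_sqfree_exp sum.If_cases)

lemma sqfree_expI:
  assumes "\<And>i. pcoeff u i \<le> 1"
  shows "u = sqfree_exp (pkeys u)"
proof (rule poly_mapping_eqI)
  fix i show "pcoeff u i = pcoeff (sqfree_exp (pkeys u)) i"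
    using assms[of i] by (auto simp: coeff_sqfree_exp in_keys_iff)
qed

lemma min_gens_sqfree:
  assumes "\<And>S. S \<in> B \<Longrightarrow> card S = d"
  shows "min_gens (squarefree_ideal (upgen B) :: ('v::finite, 'k::field) mpol set) = sqfree_exp ` B"
  unfolding Idl_sqfree[symmetric]
proof (rule min_gens_Idl)
  fix u v assume "u \<in> sqfree_exp ` B" "v \<in> sqfree_exp ` B" "exp_dvd v u"
  then show "v = u" using assms by (intro exp_dvd_mdeg_eq) (auto simp: mdeg_sqfree_exp)
qed

lemma sqfree_exp_exchange:
  assumes "i \<in> S" "j \<notin> S"
  shows "sqfree_exp S - single i 1 + single j 1 = sqfree_exp (insert j (S - {i}))"
  using assms by (intro poly_mapping_eqI)
    (auto simp: lookup_add lookup_minus coeff_sqfree_exp lookup_single when_def)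

definition matroid_bases :: "nat \<Rightarrow> 'v set set \<Rightarrow> bool" where
  "matroid_bases d B \<longleftrightarrow> (\<forall>S\<in>B. card S = d) \<and>
     (\<forall>S\<in>B. \<forall>T\<in>B. \<forall>i\<in>S - T. \<exists>j\<in>T - S. insert j (S - {i}) \<in> B)"

text \<open>For exponents zero and one a strict inequality is membership in a set difference, and
  the exponent arithmetic is the exchange of one element.\<close>

lemma exchange_sqfree_iff:
  "(\<forall>u\<in>sqfree_exp ` B. \<forall>v\<in>sqfree_exp ` B. \<forall>i. pcoeff v i < pcoeff u i \<longrightarrow>
      (\<exists>j. pcoeff u j < pcoeff v j \<and> u - single i 1 + single j 1 \<in> sqfree_exp ` B)) \<longleftrightarrow>
    (\<forall>S\<in>B. \<forall>T\<in>B. \<forall>i\<in>S - T. \<exists>j\<in>T - S. insert j (S - {i}) \<in> B)"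
proof -
  have lt: "pcoeff (sqfree_exp T) i < pcoeff (sqfree_exp S) i \<longleftrightarrow> i \<in> S - T" for S T :: "'a set" and i
    by (simp add: coeff_sqfree_exp)
  have ex: "i \<in> S - T \<Longrightarrow> j \<in> T - S \<Longrightarrow>
      sqfree_exp S - single i 1 + single j 1 \<in> sqfree_exp ` B \<longleftrightarrow> insert j (S - {i}) \<in> B" for S T i j
    by (subst sqfree_exp_exchange) (auto simp: inj_image_mem_iff[OF inj_sqfree_exp])
  have step: "(\<forall>i. i \<in> S - T \<longrightarrow>
        (\<exists>j. j \<in> T - S \<and> sqfree_exp S - single i 1 + single j 1 \<in> sqfree_exp ` B)) \<longleftrightarrow>
      (\<forall>i\<in>S - T. \<exists>j\<in>T - S. insert j (S - {i}) \<in> B)" for S T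
    by (intro iffI ballI allI impI; use ex[of _ S T] in blast)
  show ?thesis unfolding ball_simps lt step ..
qed

lemma matroidalI:
  assumes "matroid_bases d B"
  shows "matroidal d (squarefree_ideal (upgen B) :: ('v::finite, 'k::field) mpol set)"
proof -
  have B: "card S = d" if "S \<in> B" for S using assms that by (simp add: matroid_bases_def)
  have mg: "min_gens (squarefree_ideal (upgen B) :: ('v, 'k) mpol set) = sqfree_exp ` B"
    by (rule min_gens_sqfree) (rule B)
  have "monomial_ideal (squarefree_ideal (upgen B) :: ('v, 'k) mpol set)"
    unfolding monomial_ideal_def Idl_sqfree[symmetric] by blast
  then show ?thesis
    using assms unfolding matroidal_def polymatroidal_def mg exchange_sqfree_iff
    by (auto simp: matroid_bases_def mdeg_sqfree_exp coeff_sqfree_exp)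
qed

lemma matroidalE:
  fixes J :: "('v::finite, 'k::field) mpol set"
  assumes "matroidal d J"
  obtains B where "matroid_bases d B" "J = squarefree_ideal (upgen B)" "min_gens J = sqfree_exp ` B"
proof -
  let ?B = "pkeys ` min_gens J"
  have J: "monomial_ideal J" "\<And>u. u \<in> min_gens J \<Longrightarrow> mdeg u = d"
    "\<And>u i. u \<in> min_gens J \<Longrightarrow> pcoeff u i \<le> 1"
    using assms by (auto simp: matroidal_def polymatroidal_def)
  have mg: "min_gens J = sqfree_exp ` ?B"
  proof -
    have "u = sqfree_exp (pkeys u)" if "u \<in> min_gens J" for u using J(3) that by (intro sqfree_expI)
    then show ?thesis by (force simp: image_image)
  qed
  have "J = squarefree_ideal (upgen ?B)"
    using min_gens_eq(2)[OF J(1)] Idl_sqfree[of ?B, where ?'k = 'k] mg by simp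
  moreover have "matroid_bases d ?B"
    unfolding matroid_bases_def
  proof
    show "\<forall>S\<in>?B. card S = d"
    proof
      fix S assume "S \<in> ?B"
      then have "sqfree_exp S \<in> min_gens J" using mg by blast
      then show "card S = d" using J(2)[of "sqfree_exp S"] by (simp add: mdeg_sqfree_exp)
    qed
    have "\<forall>u\<in>sqfree_exp ` ?B. \<forall>v\<in>sqfree_exp ` ?B. \<forall>i. pcoeff v i < pcoeff u i \<longrightarrow>
      (\<exists>j. pcoeff u j < pcoeff v j \<and> u - single i 1 + single j 1 \<in> sqfree_exp ` ?B)"
      unfolding mg[symmetric] using assms by (simp add: matroidal_def polymatroidal_def)
    then show "\<forall>S\<in>?B. \<forall>T\<in>?B. \<forall>i\<in>S - T. \<exists>j\<in>T - S. insert j (S - {i}) \<in> ?B"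
      unfolding exchange_sqfree_iff .
  qed
  ultimately show thesis using mg that by blast
qed

lemma ideal_supp_sqfree:
  fixes J :: "('v::{finite,linorder}, 'k::field) mpol set"
  assumes "min_gens J = sqfree_exp ` B"
  shows "ideal_supp J = \<Union>B"
  unfolding ideal_supp_def assms by (auto simp: pvar_dvd_iff)

text \<open>Every divisor of a monomial is a scalar multiple of a monomial, so the comparison
  reduces to exponents, whose minimum over \<open>B\<close> is the exponent of the intersection. A
  member of \<open>B\<close> is what makes a common divisor a divisor of some monomial.\<close>

lemma ideal_gcd_sqfree:
  fixes J :: "('v::{finite,linorder}, 'k::field) mpol set"
  assumes "min_gens J = sqfree_exp ` B" "B \<noteq> {}"
  shows "ideal_gcd J = monomial (sqfree_exp (\<Inter>B))"
  unfolding ideal_gcd_def assms(1)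
proof (rule the_equality)
  let ?g = "sqfree_exp (\<Inter>B)"
  have dvd: "exp_dvd ?g u" if "u \<in> sqfree_exp ` B" for u
    using that by (auto simp: exp_dvd_sqfree_iff)
  have below: "exp_dvd w ?g" if "\<And>u. u \<in> sqfree_exp ` B \<Longrightarrow> exp_dvd w u" for w
    unfolding exp_dvd_iff
  proof
    fix i
    show "pcoeff w i \<le> pcoeff ?g i"
    proof (cases "i \<in> \<Inter>B")
      case True
      obtain S where "S \<in> B" using assms(2) by blast
      then have "pcoeff w i \<le> pcoeff (sqfree_exp S) i" using that unfolding exp_dvd_iff by blast
      then show ?thesis using True \<open>S \<in> B\<close> by (simp add: coeff_sqfree_exp)
    next
      case False
      then obtain S where "S \<in> B" "i \<notin> S" by blast
      then have "pcoeff w i \<le> pcoeff (sqfree_exp S) i" using that unfolding exp_dvd_iff by blast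
      then show ?thesis using \<open>i \<notin> S\<close> by (simp add: coeff_sqfree_exp)
    qed
  qed
  have poly_below: "h dvd monomial ?g" if h: "\<forall>u\<in>sqfree_exp ` B. h dvd monomial u" for h :: "('v, 'k) mpol"
  proof -
    obtain S where "S \<in> B" using assms(2) by blast
    then obtain w where w: "pkeys h = {w}" using h by (meson dvd_monomial_imp image_eqI)
    have "exp_dvd w ?g" by (rule below) (use h dvd_monomial_iff[OF w] in auto)
    then show ?thesis by (simp add: dvd_monomial_iff[OF w])
  qed
  show "monomial ?g \<in> range monomial \<and>
      (\<forall>u\<in>sqfree_exp ` B. (monomial ?g :: ('v, 'k) mpol) dvd monomial u) \<and>
      (\<forall>h. (\<forall>u\<in>sqfree_exp ` B. h dvd monomial u) \<longrightarrow> h dvd (monomial ?g :: ('v, 'k) mpol))"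
    using dvd poly_below by (auto simp: monomial_dvd_iff)
  fix g :: "('v, 'k) mpol"
  assume g: "g \<in> range monomial \<and> (\<forall>u\<in>sqfree_exp ` B. g dvd monomial u) \<and>
      (\<forall>h. (\<forall>u\<in>sqfree_exp ` B. h dvd monomial u) \<longrightarrow> h dvd g)"
  then obtain w where w: "g = monomial w" by blast
  have "exp_dvd w ?g" using g poly_below[of g] by (simp add: w monomial_dvd_iff)
  moreover have "exp_dvd ?g w" using g dvd by (simp add: w flip: monomial_dvd_iff[where ?'k = 'k])
  ultimately have "w = ?g" by (rule exp_dvd_antisym)
  then show "g = monomial ?g" by (simp add: w)
qed

lemma monomial_inj: "(monomial u :: ('v, 'k::field) mpol) = monomial v \<longleftrightarrow> u = v"
  by (metis keys_monomial singleton_inject)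

lemma monomial_sqfree_eq_1: "(monomial (sqfree_exp S) :: ('v::finite, 'k::field) mpol) = 1 \<longleftrightarrow> S = {}"
  by (metis keys_sqfree_exp keys_zero monomial_0 monomial_inj sum.empty sqfree_exp_def)

lemma monomial_sqfree_eq_pvar:
  "(monomial (sqfree_exp S) :: ('v::finite, 'k::field) mpol) = pvar i \<longleftrightarrow> S = {i}"
proof -
  have "pvar i = (monomial (sqfree_exp {i}) :: ('v, 'k) mpol)" by (simp add: pvar_def sqfree_exp_def)
  then show ?thesis by (metis keys_sqfree_exp monomial_inj)
qed

section \<open>Matroids of rank three on five elements\<close>

lemma set_add_eq_ideal_sum: "I <+>\<^bsub>type_ring\<^esub> J = ideal_sum I J"
  by (auto simp: set_add_def' ideal_sum_def)

lemma l_coset_type_ring: "x <#\<^bsub>type_ring\<^esub> I = (*) x ` I"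
  by (auto simp: l_coset_def)

lemma ideal_sum_squarefree:
  fixes U V :: "'v::finite set set"
  assumes "upset U" "upset V"
  shows "ideal_sum (squarefree_ideal U) (squarefree_ideal V) =
    (squarefree_ideal (U \<union> V) :: ('v, 'k::field) mpol set)"
proof
  have id: "tideal (squarefree_ideal (U \<union> V) :: ('v, 'k) mpol set)"
    by (intro tideal_squarefree_ideal upset_Un assms)
  show "ideal_sum (squarefree_ideal U) (squarefree_ideal V) \<subseteq>
      (squarefree_ideal (U \<union> V) :: ('v, 'k) mpol set)"
  proof
    fix z :: "('v, 'k) mpol" assume "z \<in> ideal_sum (squarefree_ideal U) (squarefree_ideal V)"
    then obtain x y where z: "z = x + y" "x \<in> squarefree_ideal U" "y \<in> squarefree_ideal V"
      by (rule ideal_sumE)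
    show "z \<in> squarefree_ideal (U \<union> V)"
      unfolding z(1) using z(2,3) squarefree_ideal_mono[of U "U \<union> V"] squarefree_ideal_mono[of V "U \<union> V"]
      by (intro tideal_add[OF id]) auto
  qed
  show "squarefree_ideal (U \<union> V) \<subseteq>
      (ideal_sum (squarefree_ideal U) (squarefree_ideal V) :: ('v, 'k) mpol set)"
  proof
    fix f :: "('v, 'k) mpol" assume f: "f \<in> squarefree_ideal (U \<union> V)"
    have zero: "0 \<in> (squarefree_ideal U :: ('v, 'k) mpol set)" "0 \<in> (squarefree_ideal V :: ('v, 'k) mpol set)"
      by (simp_all add: squarefree_ideal_def)
    show "f \<in> ideal_sum (squarefree_ideal U) (squarefree_ideal V)"
    proof (rule tideal_monomials)
      show "tideal (ideal_sum (squarefree_ideal U) (squarefree_ideal V) :: ('v, 'k) mpol set)"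
        by (intro tideal_ideal_sum tideal_squarefree_ideal assms)
      fix u assume "u \<in> pkeys f"
      then consider "pkeys u \<in> U" | "pkeys u \<in> V" using f by (auto simp: squarefree_ideal_def)
      then show "monomial u \<in> (ideal_sum (squarefree_ideal U) (squarefree_ideal V) :: ('v, 'k) mpol set)"
      proof cases
        case 1
        then show ?thesis using ideal_sumI[OF _ zero(2), of "monomial u" "squarefree_ideal U"] by simp
      next
        case 2
        then show ?thesis using ideal_sumI[OF zero(1), of "monomial u" "squarefree_ideal V"] by simp
      qed
    qed
  qed
qed

text \<open>The second hypothesis says that the generators avoid the variable \<open>i\<close>; so
  no square of it arises, and the product is again a squarefree ideal.\<close>

lemma pvar_times_squarefree:
  fixes U :: "'v::finite set set"
  assumes U: "upset U" "\<And>S. insert i S \<in> U \<Longrightarrow> S \<in> U"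
  shows "(*) (pvar i) ` squarefree_ideal U = (squarefree_ideal {S \<in> U. i \<in> S} :: ('v, 'k::field) mpol set)"
proof
  show "(*) (pvar i) ` squarefree_ideal U \<subseteq> (squarefree_ideal {S \<in> U. i \<in> S} :: ('v, 'k) mpol set)"
    using upsetD[OF U(1) _ subset_insertI]
    by (auto simp: squarefree_ideal_def pvar_def keys_monomial_mult keys_add_nat)
  show "squarefree_ideal {S \<in> U. i \<in> S} \<subseteq> ((*) (pvar i) ` squarefree_ideal U :: ('v, 'k) mpol set)"
  proof
    fix f :: "('v, 'k) mpol" assume f: "f \<in> squarefree_ideal {S \<in> U. i \<in> S}"
    note id = tidealD[OF tideal_squarefree_ideal[OF U(1), where ?'b = 'k]]
    show "f \<in> (*) (pvar i) ` squarefree_ideal U"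
    proof (rule tideal_monomials)
      show "tideal ((*) (pvar i) ` squarefree_ideal U :: ('v, 'k) mpol set)"
        unfolding tideal_iff
      proof (intro conjI ballI allI)
        show "0 \<in> (*) (pvar i) ` (squarefree_ideal U :: ('v, 'k) mpol set)"
          using id(1) by (intro image_eqI[of _ _ 0]) auto
      next
        fix x y assume "x \<in> (*) (pvar i) ` (squarefree_ideal U :: ('v, 'k) mpol set)"
          "y \<in> (*) (pvar i) ` (squarefree_ideal U :: ('v, 'k) mpol set)"
        then obtain p q where "x = pvar i * p" "y = pvar i * q" "p \<in> squarefree_ideal U" "q \<in> squarefree_ideal U"
          by blast
        then show "x + y \<in> (*) (pvar i) ` squarefree_ideal U"
          using id(2)[of p q] by (intro image_eqI[of _ _ "p + q"]) (auto simp: distrib_left)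
      next
        fix r x assume "x \<in> (*) (pvar i) ` (squarefree_ideal U :: ('v, 'k) mpol set)"
        then obtain p where "x = pvar i * p" "p \<in> squarefree_ideal U" by blast
        then show "r * x \<in> (*) (pvar i) ` squarefree_ideal U"
          using id(3)[of p r] by (intro image_eqI[of _ _ "r * p"]) (auto simp: ac_simps)
      qed
      fix u assume u: "u \<in> pkeys f"
      then have u: "pkeys u \<in> U" "i \<in> pkeys u" using f by (auto simp: squarefree_ideal_def)
      then obtain v where v: "u = single i 1 + v" using exp_split_single[OF u(2)] by blast
      then have "pkeys v \<in> U" using u U(2)[of "pkeys v"] by (simp add: keys_add_nat)
      then show "monomial u \<in> (*) (pvar i) ` (squarefree_ideal U :: ('v, 'k) mpol set)"
        unfolding v monomial_add by (intro image_eqI[of _ _ "monomial v"]) (auto simp: pvar_def)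
    qed
  qed
qed

lemma upgen_avoid:
  assumes "\<And>S. S \<in> B \<Longrightarrow> i \<notin> S" "insert i S \<in> upgen B"
  shows "S \<in> upgen B"
  using assms unfolding upgen_def by blast

abbreviation (input) decomposition_sum ::
  "'v \<Rightarrow> 'v \<Rightarrow> 'v \<Rightarrow> 'v \<Rightarrow> 'v \<Rightarrow> ('v, 'k::field) mpol set \<Rightarrow> ('v, 'k) mpol set \<Rightarrow> ('v, 'k) mpol set \<Rightarrow>
    ('v, 'k) mpol set" where
  "decomposition_sum a b c d e J1 J2 J3 \<equiv>
    (pvar a * pvar b) <#\<^bsub>mpol_ring\<^esub> (Idl\<^bsub>mpol_ring\<^esub> {pvar c, pvar d, pvar e})
      <+>\<^bsub>mpol_ring\<^esub> (pvar a <#\<^bsub>mpol_ring\<^esub> J1) <+>\<^bsub>mpol_ring\<^esub> (pvar b <#\<^bsub>mpol_ring\<^esub> J2)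
      <+>\<^bsub>mpol_ring\<^esub> J3"

lemma decomposition_ideal:
  fixes a b c d e :: "'v::{finite,linorder}" and U1 U2 U3 :: "'v set set"
  assumes dist: "distinct [a, b, c, d, e]"
    and U1: "upset U1" "\<And>S. insert a S \<in> U1 \<Longrightarrow> S \<in> U1"
    and U2: "upset U2" "\<And>S. insert b S \<in> U2 \<Longrightarrow> S \<in> U2"
    and U3: "upset U3"
  shows "decomposition_sum a b c d e (squarefree_ideal U1) (squarefree_ideal U2) (squarefree_ideal U3) =
    (squarefree_ideal ({S. a \<in> S \<and> b \<in> S \<and> (c \<in> S \<or> d \<in> S \<or> e \<in> S)} \<union>
      {S \<in> U1. a \<in> S} \<union> {S \<in> U2. b \<in> S} \<union> U3) :: ('v, 'k::field) mpol set)"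
proof -
  let ?F = "{S. S \<inter> {c, d, e} \<noteq> {}}"
  have F: "upset ?F" by (auto simp: upset_def)
  have Fb: "upset {S \<in> ?F. b \<in> S}" by (auto simp: upset_def)
  have "(*) (pvar a * pvar b) ` face_ideal {c, d, e} =
      ((*) (pvar a) ` (*) (pvar b) ` squarefree_ideal ?F :: ('v, 'k) mpol set)"
    by (simp add: image_image face_ideal_def mult.assoc)
  also have "\<dots> = (*) (pvar a) ` squarefree_ideal {S \<in> ?F. b \<in> S}"
    using dist by (subst pvar_times_squarefree[OF F]) auto
  also have "\<dots> = squarefree_ideal {S \<in> {S \<in> ?F. b \<in> S}. a \<in> S}"
    using dist by (subst pvar_times_squarefree[OF Fb]) auto
  also have "{S \<in> {S \<in> ?F. b \<in> S}. a \<in> S} = {S. a \<in> S \<and> b \<in> S \<and> (c \<in> S \<or> d \<in> S \<or> e \<in> S)}"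
    by auto
  finally have p: "(*) (pvar a * pvar b) ` face_ideal {c, d, e} =
    (squarefree_ideal {S. a \<in> S \<and> b \<in> S \<and> (c \<in> S \<or> d \<in> S \<or> e \<in> S)} :: ('v, 'k) mpol set)" .
  have Idl: "Idl\<^bsub>mpol_ring\<^esub> {pvar c, pvar d, pvar e} = (face_ideal {c, d, e} :: ('v, 'k) mpol set)"
    using Idl_pvars[of "{c, d, e}", where ?'k = 'k] by simp
  have up: "upset {S. a \<in> S \<and> b \<in> S \<and> (c \<in> S \<or> d \<in> S \<or> e \<in> S)}"
    "upset {S \<in> U1. a \<in> S}" "upset {S \<in> U2. b \<in> S}"
    using U1(1) U2(1) by (auto simp: upset_def)
  have q1: "(*) (pvar a) ` squarefree_ideal U1 = (squarefree_ideal {S \<in> U1. a \<in> S} :: ('v, 'k) mpol set)"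
    by (rule pvar_times_squarefree[OF U1(1)]) (rule U1(2))
  have q2: "(*) (pvar b) ` squarefree_ideal U2 = (squarefree_ideal {S \<in> U2. b \<in> S} :: ('v, 'k) mpol set)"
    by (rule pvar_times_squarefree[OF U2(1)]) (rule U2(2))
  show ?thesis
    unfolding l_coset_type_ring set_add_eq_ideal_sum Idl p q1 q2
    by (simp add: ideal_sum_squarefree up U3 upset_Un)
qed

text \<open>The family is a graph on the vertices \<open>c\<close>, \<open>d\<close>,
  \<open>e\<close>. Each vertex is avoided by just one possible edge, so an empty intersection
  forces all three edges; if \<open>c\<close> is the common vertex, both edges at \<open>c\<close>
  occur in order to cover \<open>d\<close> and \<open>e\<close>.\<close>

lemma cycle_graph_cases:
  assumes dist: "distinct [c, d, e]" and B: "\<And>S. S \<in> B \<Longrightarrow> card S = 2" "\<Union>B = {c, d, e}"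
  shows "\<Inter>B = {} \<Longrightarrow> B = {{c, d}, {c, e}, {d, e}}"
    and "\<Inter>B = {c} \<Longrightarrow> B = {{c, d}, {c, e}}"
proof -
  have edge: "S = {c, d} \<or> S = {c, e} \<or> S = {d, e}" if S: "S \<in> B" for S
  proof -
    obtain x y where xy: "S = {x, y}" "x \<noteq> y" using B(1)[OF S] by (auto simp: card_2_iff)
    have "x \<in> {c, d, e}" "y \<in> {c, d, e}" using S B(2) xy by blast+
    then show ?thesis using xy by auto
  qed
  show "B = {{c, d}, {c, e}, {d, e}}" if I: "\<Inter>B = {}"
  proof -
    have "\<exists>S\<in>B. x \<notin> S" for x using I by blast
    then have "\<exists>S\<in>B. c \<notin> S" "\<exists>S\<in>B. d \<notin> S" "\<exists>S\<in>B. e \<notin> S" by blast+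
    then have "{d, e} \<in> B" "{c, e} \<in> B" "{c, d} \<in> B" using edge by (metis insertI1 insertI2)+
    then show ?thesis using edge by blast
  qed
  show "B = {{c, d}, {c, e}}" if I: "\<Inter>B = {c}"
  proof -
    have "c \<in> S" if "S \<in> B" for S using I that by blast
    moreover have "\<exists>S\<in>B. d \<in> S" "\<exists>S\<in>B. e \<in> S" using B(2) by blast+
    ultimately show ?thesis using edge dist by (auto 4 4)
  qed
qed

lemma upgen_triangle: "upgen {{c, d}, {c, e}, {d, e}} =
    {S. c \<in> S \<and> d \<in> S \<or> c \<in> S \<and> e \<in> S \<or> d \<in> S \<and> e \<in> S}"
  by (auto simp: upgen_def)

lemma upgen_star: "upgen {{c, d}, {c, e}} = {S. c \<in> S \<and> (d \<in> S \<or> e \<in> S)}"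
  by (auto simp: upgen_def)

lemma upgen_card:
  fixes B :: "'v::finite set set"
  assumes "\<And>S. S \<in> B \<Longrightarrow> card S = n" "card S = n"
  shows "S \<in> upgen B \<longleftrightarrow> S \<in> B"
proof
  assume "S \<in> upgen B"
  then obtain T where "T \<in> B" "T \<subseteq> S" by (auto simp: upgen_def)
  then show "S \<in> B" using assms card_subset_eq[of S T] by auto
qed (auto simp: upgen_def)

text \<open>Everything is read off from the relation \<open>D\<close>. It is transitive on distinct
  elements, and a class with four elements would make the fifth variable a loop; so if no two
  disjoint pairs are related, the related pairs form nothing, one edge or a triangle.\<close>

lemma rank_three_matroid_cases:
  fixes B :: "'v::finite set set"
  assumes B: "matroid_bases 3 B" and card: "card (UNIV :: 'v set) = 5"
    and loops: "\<Union>B = UNIV" and coloops: "\<Inter>B = {}"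
  shows "large 4 \<subseteq> upgen B"
    and "(\<exists>a b c d t. distinct [a, b, c, d, t] \<and> UNIV = {a, b, c, d, t} \<and>
        {{t, a, c}, {t, a, d}, {t, b, c}, {t, b, d}} \<subseteq> B \<and> - {a, b} \<notin> B \<and> - {c, d} \<notin> B) \<or>
      (\<exists>a b c d e. distinct [a, b, c, d, e] \<and> UNIV = {a, b, c, d, e} \<and>
        (upgen B = large 3 \<or> upgen B = {S. a \<in> S \<or> b \<in> S} \<inter> large 3 \<or>
         upgen B = {S. a \<in> S \<and> b \<in> S \<or> a \<in> S \<and> c \<in> S \<or> b \<in> S \<and> c \<in> S} \<inter> large 3))"
proof -
  have B3: "card S = 3" if "S \<in> B" for S using B that by (simp add: matroid_bases_def)
  have ex: "\<exists>j\<in>T - S. insert j (S - {i}) \<in> B" if "S \<in> B" "T \<in> B" "i \<in> S - T" for S T i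
    using B that unfolding matroid_bases_def by blast
  have compl: "card (- S) = 5 - card S" for S :: "'v set"
    using card by (simp add: Compl_eq_Diff_UNIV card_Diff_subset)
  show large4: "large 4 \<subseteq> upgen B"
  proof
    fix S :: "'v set" assume "S \<in> large 4"
    then have "card (- S) \<le> 1" using compl by simp
    then have "\<forall>x\<in>- S. \<forall>y\<in>- S. x = y" by (simp add: card_le_Suc0_iff_eq)
    then obtain x where x: "- S \<subseteq> {x}" by (cases "- S = {}") auto
    obtain T where "T \<in> B" "x \<notin> T" using coloops by blast
    then show "S \<in> upgen B" using x unfolding upgen_def by blast
  qed
  \<comment> \<open>parallelism in the dual matroid\<close>
  define D where "D x y \<longleftrightarrow> x \<noteq> y \<and> - {x, y} \<notin> B" for x y
  have sym: "D x y \<longleftrightarrow> D y x" for x y by (auto simp: D_def insert_commute)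
  have three: "\<exists>x y. x \<noteq> y \<and> S = - {x, y}" if "card S = 3" for S :: "'v set"
  proof -
    have "card (- S) = 2" using compl[of S] that by simp
    then obtain x y where "- S = {x, y}" "x \<noteq> y" by (auto simp: card_2_iff)
    then show ?thesis by blast
  qed
  \<comment> \<open>Exchange \<open>y\<close> out of the basis complementary to
    \<open>{x, z}\<close> against a basis avoiding \<open>y\<close>: only \<open>x\<close> or
    \<open>z\<close> can enter, and either result is the complement of a related pair.\<close>
  have trans: "D x z" if xy: "D x y" and yz: "D y z" and "x \<noteq> z" for x y z
  proof (rule ccontr)
    assume "\<not> D x z"
    then have S: "- {x, z} \<in> B" using \<open>x \<noteq> z\<close> by (simp add: D_def)
    obtain T where T: "T \<in> B" "y \<notin> T" using coloops by blast
    have "y \<in> - {x, z} - T" using xy yz T by (auto simp: D_def)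
    then obtain j where j: "j \<in> T - - {x, z}" "insert j (- {x, z} - {y}) \<in> B" using ex[OF S T(1)] by blast
    then consider "j = x" | "j = z" by blast
    then show False
    proof cases
      case 1
      have "insert j (- {x, z} - {y}) = - {y, z}" using 1 xy \<open>x \<noteq> z\<close> by (auto simp: D_def)
      then show False using j yz by (simp add: D_def)
    next
      case 2
      have "insert j (- {x, z} - {y}) = - {x, y}" using 2 yz \<open>x \<noteq> z\<close> by (auto simp: D_def)
      then show False using j xy by (simp add: D_def)
    qed
  qed
  \<comment> \<open>Otherwise the four elements are mutually related. A basis containing the fifth
    variable would be the complement of a pair among the four, so the fifth variable would be a
    loop.\<close>
  have cross: "\<not> D x z" if xy: "D x y" and zw: "D z w" and dist: "distinct [x, y, z, w]" for x y z w
  proof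
    assume xz: "D x z"
    have D: "D p q" if "p \<in> {x, y, z, w}" "q \<in> {x, y, z, w}" "p \<noteq> q" for p q
    proof -
      have "D x p \<or> p = x" if "p \<in> {x, y, z, w}" for p
        using that xy xz zw trans[OF xz zw] dist by auto
      then show ?thesis using that trans[of p x q] sym by blast
    qed
    have "card (- {x, y, z, w}) = 1" using compl[of "{x, y, z, w}"] dist by simp
    then obtain v where v: "- {x, y, z, w} = {v}" by (auto simp: card_1_singleton_iff)
    obtain S where S: "S \<in> B" "v \<in> S" using loops by blast
    obtain p q where pq: "p \<noteq> q" "S = - {p, q}" using three[OF B3[OF S(1)]] by blast
    then have "p \<noteq> v" "q \<noteq> v" using S(2) by auto
    moreover have "r \<in> {x, y, z, w} \<or> r \<in> - {x, y, z, w}" for r by blast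
    ultimately have "p \<in> {x, y, z, w}" "q \<in> {x, y, z, w}" unfolding v by blast+
    then show False using D[of p q] pq S(1) by (simp add: D_def)
  qed
  \<comment> \<open>Only three-element sets, the complements of pairs, have to be compared: smaller
    sets lie in neither side and larger ones in both.\<close>
  have upgen_eq: "upgen B = V \<inter> large 3"
    if "\<And>x y. x \<noteq> y \<Longrightarrow> - {x, y} \<in> V \<longleftrightarrow> \<not> D x y" "large 4 \<subseteq> V" for V
  proof (rule Set.set_eqI)
    fix S
    show "S \<in> upgen B \<longleftrightarrow> S \<in> V \<inter> large 3"
    proof (cases "card S = 3")
      case True
      then obtain x y where "x \<noteq> y" "S = - {x, y}" using three by blast
      then have "S \<in> B \<longleftrightarrow> S \<in> V" using that(1)[of x y] by (simp add: D_def)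
      then show ?thesis using True upgen_card[OF B3 True] by simp
    next
      case False
      show ?thesis
      proof (cases "4 \<le> card S")
        case True
        then have "S \<in> large 4" by simp
        then show ?thesis using large4 that(2) by auto
      next
        case small: False
        have "3 \<le> card S" if "T \<in> B" "T \<subseteq> S" for T
          using B3[OF that(1)] card_mono[OF _ that(2)] by simp
        then have "S \<notin> upgen B" using False small by (fastforce simp: upgen_def)
        then show ?thesis using False small by simp
      qed
    qed
  qed
  show "(\<exists>a b c d t. distinct [a, b, c, d, t] \<and> UNIV = {a, b, c, d, t} \<and>
        {{t, a, c}, {t, a, d}, {t, b, c}, {t, b, d}} \<subseteq> B \<and> - {a, b} \<notin> B \<and> - {c, d} \<notin> B) \<or>
      (\<exists>a b c d e. distinct [a, b, c, d, e] \<and> UNIV = {a, b, c, d, e} \<and>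
        (upgen B = large 3 \<or> upgen B = {S. a \<in> S \<or> b \<in> S} \<inter> large 3 \<or>
         upgen B = {S. a \<in> S \<and> b \<in> S \<or> a \<in> S \<and> c \<in> S \<or> b \<in> S \<and> c \<in> S} \<inter> large 3))"
    (is "?bad \<or> ?good")
  proof (cases "\<exists>a b c d. D a b \<and> D c d \<and> distinct [a, b, c, d]")
    case True
    then obtain a b c d where D: "D a b" "D c d" and dist: "distinct [a, b, c, d]" by blast
    have "card (- {a, b, c, d}) = 1" using compl[of "{a, b, c, d}"] dist by simp
    then obtain t where t: "- {a, b, c, d} = {t}" by (auto simp: card_1_singleton_iff)
    have "t \<in> - {a, b, c, d}" unfolding t by simp
    then have t': "t \<notin> {a, b, c, d}" by simp
    have "UNIV = {a, b, c, d} \<union> - {a, b, c, d}" by blast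
    then have univ: "UNIV = {a, b, c, d, t}" unfolding t by auto
    have n: "\<not> D a c" "\<not> D a d" "\<not> D b c" "\<not> D b d"
      using cross[of a b c d] cross[of a b d c] cross[of b a c d] cross[of b a d c] D sym dist by auto
    have eq: "{t, a, c} = - {b, d}" "{t, a, d} = - {b, c}" "{t, b, c} = - {a, d}" "{t, b, d} = - {a, c}"
      using univ t' dist by auto
    have "{{t, a, c}, {t, a, d}, {t, b, c}, {t, b, d}} \<subseteq> B"
      unfolding eq using n dist by (auto simp: D_def)
    moreover have "distinct [a, b, c, d, t]" using dist t' by auto
    moreover have "- {a, b} \<notin> B" "- {c, d} \<notin> B" using D by (auto simp: D_def)
    ultimately have ?bad using univ by blast
    then show ?thesis ..
  next
    case no: False
    have meet: "{x, y} \<inter> {z, w} \<noteq> {}" if "D x y" "D z w" for x y z w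
    proof
      assume "{x, y} \<inter> {z, w} = {}"
      then have "distinct [x, y, z, w]" using that by (auto simp: D_def)
      then show False using no that by blast
    qed
    have rest: "\<exists>c d e. distinct [a, b, c, d, e] \<and> UNIV = {a, b, c, d, e}" if "a \<noteq> b" for a b :: 'v
    proof -
      have "card (- {a, b}) = 3" using compl[of "{a, b}"] that by simp
      then obtain c d e where cde: "- {a, b} = {c, d, e}" "c \<noteq> d" "d \<noteq> e" "c \<noteq> e"
        by (auto simp: card_3_iff)
      have "a \<notin> - {a, b}" "b \<notin> - {a, b}" by simp_all
      then have "distinct [a, b, c, d, e]" using cde(2-4) that unfolding cde(1) by simp
      moreover have "UNIV = {a, b} \<union> - {a, b}" by blast
      then have "UNIV = {a, b, c, d, e}" unfolding cde(1) by auto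
      ultimately show ?thesis by blast
    qed
    have ?good
    proof (cases "\<exists>a b. D a b")
      case False
      obtain a b :: 'v where "a \<noteq> b"
      proof (cases "\<forall>x y :: 'v. x = y")
        case True
        then have "UNIV \<subseteq> {undefined :: 'v}" by auto
        then have "card (UNIV :: 'v set) \<le> card {undefined :: 'v}" by (intro card_mono) auto
        then show ?thesis using card by simp
      qed (use that in blast)
      then obtain c d e where e: "distinct [a, b, c, d, e]" "UNIV = {a, b, c, d, e}" using rest by blast
      have "upgen B = UNIV \<inter> large 3" by (rule upgen_eq) (use False in auto)
      then have "upgen B = large 3" by simp
      then show ?thesis using e by blast
    next
      case True
      then obtain a b where ab: "D a b" by blast
      then have "a \<noteq> b" by (simp add: D_def)
      show ?thesis
      proof (cases "\<exists>c. c \<noteq> b \<and> D a c \<or> c \<noteq> a \<and> D b c")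
        case True
        then obtain c where c: "D a c" "D b c" "c \<noteq> a" "c \<noteq> b"
          using trans ab sym \<open>a \<noteq> b\<close> by (metis D_def)
        have "card (- {a, b, c}) = 2" using compl[of "{a, b, c}"] c \<open>a \<noteq> b\<close> by simp
        then obtain d e where de: "- {a, b, c} = {d, e}" "d \<noteq> e" by (auto simp: card_2_iff)
        have "x \<notin> - {a, b, c}" if "x \<in> {a, b, c}" for x using that by simp
        then have e: "distinct [a, b, c, d, e]" using de(2) c \<open>a \<noteq> b\<close> unfolding de(1) by auto
        have "UNIV = {a, b, c} \<union> - {a, b, c}" by blast
        then have univ: "UNIV = {a, b, c, d, e}" unfolding de(1) by auto
        \<comment> \<open>A pair that meets all three sides of the triangle \<open>a\<close>,
          \<open>b\<close>, \<open>c\<close> consists of two of its corners.\<close>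
        have Dxy: "D x y \<longleftrightarrow> x \<in> {a, b, c} \<and> y \<in> {a, b, c}" if "x \<noteq> y" for x y
        proof
          assume "D x y"
          then show "x \<in> {a, b, c} \<and> y \<in> {a, b, c}"
            using meet[OF _ ab] meet[OF _ c(1)] meet[OF _ c(2)] e by fastforce
        next
          assume "x \<in> {a, b, c} \<and> y \<in> {a, b, c}"
          then show "D x y" using that ab c sym by blast
        qed
        let ?V = "{S. a \<in> S \<and> b \<in> S \<or> a \<in> S \<and> c \<in> S \<or> b \<in> S \<and> c \<in> S}"
        have "upgen B = ?V \<inter> large 3"
        proof (rule upgen_eq)
          show "- {x, y} \<in> ?V \<longleftrightarrow> \<not> D x y" if "x \<noteq> y" for x y
            using Dxy[OF that] that e by auto
          show "large 4 \<subseteq> ?V"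
            by (auto simp: card5[OF e univ] of_bool_def split: if_splits)
        qed
        then show ?thesis using e univ by blast
      next
        case none: False
        obtain c d e where e: "distinct [a, b, c, d, e]" and univ: "UNIV = {a, b, c, d, e}"
          using rest[OF \<open>a \<noteq> b\<close>] by blast
        have Dxy: "D x y \<longleftrightarrow> {x, y} = {a, b}" if "x \<noteq> y" for x y
        proof
          assume D: "D x y"
          have n: "D a z \<Longrightarrow> z = b" "D b z \<Longrightarrow> z = a" for z using none by blast+
          consider "x = a" | "x = b" | "y = a" | "y = b" using meet[OF D ab] by blast
          then show "{x, y} = {a, b}"
          proof cases
            case 1 then show ?thesis using n(1)[of y] D by simp
          next
            case 2 then show ?thesis using n(2)[of y] D by (simp add: insert_commute)
          next
            case 3 then show ?thesis using n(1)[of x] D sym[of x y] by (simp add: insert_commute)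
          next
            case 4 then show ?thesis using n(2)[of x] D sym[of x y] by simp
          qed
        next
          assume "{x, y} = {a, b}"
          then show "D x y" using ab sym by (auto simp: doubleton_eq_iff)
        qed
        let ?V = "{S. a \<in> S \<or> b \<in> S}"
        have "upgen B = ?V \<inter> large 3"
        proof (rule upgen_eq)
          show "- {x, y} \<in> ?V \<longleftrightarrow> \<not> D x y" if "x \<noteq> y" for x y
            using Dxy[OF that] that e by auto
          show "large 4 \<subseteq> ?V"
            by (auto simp: card5[OF e univ] of_bool_def split: if_splits)
        qed
        then show ?thesis using e univ by blast
      qed
    qed
    then show ?thesis ..
  qed
qed

lemma UNIV_5: "distinct [1, 2, 3, 4, 5 :: 5]" "(UNIV :: 5 set) = {1, 2, 3, 4, 5}"
proof -
  show d: "distinct [1, 2, 3, 4, 5 :: 5]" by simp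
  have "card {1, 2, 3, 4, 5 :: 5} = card (UNIV :: 5 set)" using distinct_card[OF d] by simp
  then show "(UNIV :: 5 set) = {1, 2, 3, 4, 5}" by (metis card_subset_eq finite subset_UNIV)
qed

text \<open>Bundles the decomposition for five named variables, so that the permutation enters only
  at the very end.\<close>

definition SCM_decomposition ::
  "('v::finite, 'k::field) mpol set \<Rightarrow> 'v \<Rightarrow> 'v \<Rightarrow> 'v \<Rightarrow> 'v \<Rightarrow> 'v \<Rightarrow>
    ('v, 'k) mpol set \<Rightarrow> ('v, 'k) mpol set \<Rightarrow> ('v, 'k) mpol set \<Rightarrow> bool" where
  "SCM_decomposition J a b c d e J1 J2 J3 \<longleftrightarrow>
       J = decomposition_sum a b c d e J1 J2 J3 \<and>
       matroidal 2 J1 \<and> SCM_ideal J1 \<and> ideal_supp J1 = {c, d, e} \<and>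
       matroidal 2 J2 \<and> SCM_ideal J2 \<and> ideal_supp J2 = {c, d, e} \<and>
       J3 = Idl\<^bsub>mpol_ring\<^esub> (monomial ` {u \<in> min_gens J.
              \<not> (pvar a :: ('v, 'k) mpol) dvd monomial u \<and>
              \<not> (pvar b :: ('v, 'k) mpol) dvd monomial u}) \<and>
       J3 \<subseteq> J1 \<inter> J2 \<and>
       ((ideal_gcd J1 = 1 \<and> ideal_gcd J2 = 1) \<or>
        (ideal_gcd J1 = pvar c \<and> ideal_gcd J2 = pvar c \<and> J3 = {0}))"

lemma squarefree_ideal_empty: "squarefree_ideal {} = {0}"
proof -
  have "f = 0" if "f \<in> squarefree_ideal {}" for f :: "('a, 'b) mpol"
    using that by (metis (no_types, lifting) all_not_in_conv keys_eq_empty mem_Collect_eq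
        squarefree_ideal_def)
  moreover have "0 \<in> (squarefree_ideal {} :: ('a, 'b) mpol set)" by (simp add: squarefree_ideal_def)
  ultimately show ?thesis by blast
qed

lemma upgen_empty [simp]: "upgen {} = {}"
  by (simp add: upgen_def)

lemma matroid_bases_triangle:
  "distinct [c, d, e] \<Longrightarrow> matroid_bases 2 {{c, d}, {c, e}, {d, e}}"
  by (auto simp: matroid_bases_def insert_Diff_if doubleton_eq_iff)

lemma matroid_bases_star:
  "distinct [c, d, e] \<Longrightarrow> matroid_bases 2 {{c, d}, {c, e}}"
  by (auto simp: matroid_bases_def insert_Diff_if doubleton_eq_iff)

lemma squarefree_facts:
  fixes B :: "'v::{finite,linorder} set set"
  assumes "matroid_bases n B" "B \<noteq> {}"
  defines "J \<equiv> squarefree_ideal (upgen B) :: ('v, 'k::field) mpol set"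
  shows "matroidal n J" "ideal_supp J = \<Union>B" "ideal_gcd J = monomial (sqfree_exp (\<Inter>B))"
proof -
  have "min_gens J = sqfree_exp ` B"
    unfolding J_def by (rule min_gens_sqfree) (use assms(1) in \<open>auto simp: matroid_bases_def\<close>)
  then show "ideal_supp J = \<Union>B" "ideal_gcd J = monomial (sqfree_exp (\<Inter>B))"
    using ideal_supp_sqfree ideal_gcd_sqfree assms(2) by blast+
  show "matroidal n J" unfolding J_def by (rule matroidalI) fact
qed

section \<open>The decomposition compared with the three shapes of matroid\<close>

context
  fixes a b c d e :: "'v::{finite,linorder}" and B :: "'v set set" and J :: "('v, 'k::field) mpol set"
  assumes dist: "distinct [a, b, c, d, e]" and univ: "UNIV = {a, b, c, d, e}"
    and B: "matroid_bases 3 B" and J: "J = squarefree_ideal (upgen B)"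
    and gens: "min_gens J = sqfree_exp ` B"
begin

lemmas cardJ = card5[OF dist univ]
lemmas subsetJ = subset5[OF dist univ]
lemmas distJ = dist5[OF dist univ]

text \<open>A basis has three elements, so the only one that can avoid \<open>a\<close> and
  \<open>b\<close> is \<open>{c, d, e}\<close>; the third ideal is thus principal or zero.\<close>

lemma avoiding_bases:
  "Idl\<^bsub>mpol_ring\<^esub> (monomial ` {u \<in> min_gens J.
      \<not> (pvar a :: ('v, 'k) mpol) dvd monomial u \<and> \<not> (pvar b :: ('v, 'k) mpol) dvd monomial u}) =
    (squarefree_ideal (if {c, d, e} \<in> upgen B then {S. {c, d, e} \<subseteq> S} else {}) :: ('v, 'k) mpol set)"
proof -
  have card: "card S = 3" if "S \<in> B" for S using B that by (simp add: matroid_bases_def)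
  have cde: "{c, d, e} \<in> upgen B \<longleftrightarrow> {c, d, e} \<in> B"
    by (rule upgen_card[OF card]) (use dist in auto)
  have eq: "S = {c, d, e}" if S: "S \<in> B" "a \<notin> S" "b \<notin> S" for S
  proof (rule card_subset_eq)
    show "S \<subseteq> {c, d, e}" using S(2,3) distJ by (simp add: subsetJ)
    show "card S = card {c, d, e}" using card[OF S(1)] dist by simp
  qed simp
  have "{u \<in> min_gens J. \<not> (pvar a :: ('v, 'k) mpol) dvd monomial u \<and>
      \<not> (pvar b :: ('v, 'k) mpol) dvd monomial u} = sqfree_exp ` {S \<in> B. a \<notin> S \<and> b \<notin> S}"
    unfolding gens by (auto simp: pvar_dvd_iff)
  moreover have "{S \<in> B. a \<notin> S \<and> b \<notin> S} = (if {c, d, e} \<in> upgen B then {{c, d, e}} else {})"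
  proof (cases "{c, d, e} \<in> B")
    case True
    have "{S \<in> B. a \<notin> S \<and> b \<notin> S} = {{c, d, e}}"
    proof
      show "{S \<in> B. a \<notin> S \<and> b \<notin> S} \<subseteq> {{c, d, e}}" using eq by blast
      show "{{c, d, e}} \<subseteq> {S \<in> B. a \<notin> S \<and> b \<notin> S}" using True distJ by simp
    qed
    then show ?thesis using True cde by simp
  next
    case False
    then have "{S \<in> B. a \<notin> S \<and> b \<notin> S} = {}" using eq by blast
    then show ?thesis using False cde by simp
  qed
  moreover have "upgen (if {c, d, e} \<in> upgen B then {{c, d, e}} else {}) =
      (if {c, d, e} \<in> upgen B then {S. {c, d, e} \<subseteq> S} else {})"
    by (simp add: upgen_def)
  ultimately show ?thesis by (simp only: Idl_sqfree)
qed

lemma decomposition_formula: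
  assumes "upset U3" and B1: "\<Union>B1 \<subseteq> {c, d, e}" and B2: "\<Union>B2 \<subseteq> {c, d, e}"
  shows "decomposition_sum a b c d e (squarefree_ideal (upgen B1)) (squarefree_ideal (upgen B2)) (squarefree_ideal U3) =
    (squarefree_ideal ({S. a \<in> S \<and> b \<in> S \<and> (c \<in> S \<or> d \<in> S \<or> e \<in> S)} \<union>
      {S \<in> upgen B1. a \<in> S} \<union> {S \<in> upgen B2. b \<in> S} \<union> U3) :: ('v, 'k) mpol set)"
proof (rule decomposition_ideal[OF dist upset_upgen _ upset_upgen _ assms(1)])
  show "S \<in> upgen B1" if "insert a S \<in> upgen B1" for S
    by (rule upgen_avoid[OF _ that]) (use B1 distJ in blast)
  show "S \<in> upgen B2" if "insert b S \<in> upgen B2" for S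
    by (rule upgen_avoid[OF _ that]) (use B2 distJ in blast)
qed

abbreviation (input) "triangle_cde \<equiv> {{c, d}, {c, e}, {d, e}}"
abbreviation (input) "star_cde \<equiv> {{c, d}, {c, e}}"

lemma shape_triangle:
  "{S. a \<in> S \<and> b \<in> S \<and> (c \<in> S \<or> d \<in> S \<or> e \<in> S)} \<union>
      {S \<in> upgen triangle_cde. a \<in> S} \<union> {S \<in> upgen triangle_cde. b \<in> S} \<union> {S. {c, d, e} \<subseteq> S} = large 3"
  (is "?L = _")
proof (rule Set.set_eqI)
  fix S show "S \<in> ?L \<longleftrightarrow> S \<in> large 3"
    unfolding upgen_triangle
    by (cases "a \<in> S"; cases "b \<in> S"; cases "c \<in> S"; cases "d \<in> S"; cases "e \<in> S"; simp add: cardJ)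
qed

lemma shape_triangle_pair:
  "{S. a \<in> S \<and> b \<in> S \<and> (c \<in> S \<or> d \<in> S \<or> e \<in> S)} \<union>
      {S \<in> upgen triangle_cde. a \<in> S} \<union> {S \<in> upgen triangle_cde. b \<in> S} \<union> {} = {S. a \<in> S \<or> b \<in> S} \<inter> large 3"
  (is "?L = ?R")
proof (rule Set.set_eqI)
  fix S show "S \<in> ?L \<longleftrightarrow> S \<in> ?R"
    unfolding upgen_triangle
    by (cases "a \<in> S"; cases "b \<in> S"; cases "c \<in> S"; cases "d \<in> S"; cases "e \<in> S"; simp add: cardJ)
qed

lemma shape_star:
  "{S. a \<in> S \<and> b \<in> S \<and> (c \<in> S \<or> d \<in> S \<or> e \<in> S)} \<union>
      {S \<in> upgen star_cde. a \<in> S} \<union> {S \<in> upgen star_cde. b \<in> S} \<union> {} =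
    {S. a \<in> S \<and> b \<in> S \<or> a \<in> S \<and> c \<in> S \<or> b \<in> S \<and> c \<in> S} \<inter> large 3"
  (is "?L = ?R")
proof (rule Set.set_eqI)
  fix S show "S \<in> ?L \<longleftrightarrow> S \<in> ?R"
    unfolding upgen_star
    by (cases "a \<in> S"; cases "b \<in> S"; cases "c \<in> S"; cases "d \<in> S"; cases "e \<in> S"; simp add: cardJ)
qed

lemma rotated: "distinct [c, d, e, a, b]" "UNIV = {c, d, e, a, b}"
  using dist univ by auto

text \<open>In the uniform case and for the class \<open>{a, b}\<close> both ideals of degree two
  are the triangle on \<open>c\<close>, \<open>d\<close>, \<open>e\<close>, and the third ideal
  depends on whether \<open>{c, d, e}\<close> is a basis. For the class \<open>{a, b, c}\<close>
  they are the star at \<open>c\<close>, which accounts for the gcd \<open>pvar c\<close>, and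
  \<open>{c, d, e}\<close> is no basis.\<close>

lemma shape_imp_decomposition:
  assumes "upgen B = large 3 \<or> upgen B = {S. a \<in> S \<or> b \<in> S} \<inter> large 3 \<or>
    upgen B = {S. a \<in> S \<and> b \<in> S \<or> a \<in> S \<and> c \<in> S \<or> b \<in> S \<and> c \<in> S} \<inter> large 3"
  shows "\<exists>J1 J2 J3. SCM_decomposition J a b c d e J1 J2 J3"
proof -
  have tri: "distinct [c, d, e]" using dist by simp
  let ?U3 = "if {c, d, e} \<in> upgen B then {S. {c, d, e} \<subseteq> S} else {}"
  have U3: "upset ?U3" by (auto simp: upset_def)
  define T where "T = (squarefree_ideal (upgen triangle_cde) :: ('v, 'k) mpol set)"
  define R where "R = (squarefree_ideal (upgen star_cde) :: ('v, 'k) mpol set)"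
  have T: "matroidal 2 T" "ideal_supp T = {c, d, e}" "ideal_gcd T = 1" "SCM_ideal T"
  proof -
    note f = squarefree_facts[OF matroid_bases_triangle[OF tri], where ?'k = 'k, folded T_def]
    show "matroidal 2 T" "ideal_supp T = {c, d, e}" using f(1,2) by auto
    have "\<Inter>triangle_cde = {}" using tri by auto
    then show "ideal_gcd T = 1" using f(3) by (simp add: monomial_sqfree_eq_1)
    show "SCM_ideal T" unfolding T_def upgen_triangle by (rule SCM_two_of_abc[OF rotated])
  qed
  have R: "matroidal 2 R" "ideal_supp R = {c, d, e}" "ideal_gcd R = pvar c" "SCM_ideal R"
  proof -
    note f = squarefree_facts[OF matroid_bases_star[OF tri], where ?'k = 'k, folded R_def]
    show "matroidal 2 R" "ideal_supp R = {c, d, e}" using f(1,2) by auto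
    have "\<Inter>star_cde = {c}" using tri by auto
    then show "ideal_gcd R = pvar c" using f(3) by (simp add: monomial_sqfree_eq_pvar)
    show "SCM_ideal R" unfolding R_def upgen_star by (rule SCM_star[OF rotated])
  qed
  have cde: "{c, d, e} \<in> large 3" "{c, d, e} \<notin> {S. a \<in> S \<or> b \<in> S}"
    "{c, d, e} \<notin> {S. a \<in> S \<and> b \<in> S \<or> a \<in> S \<and> c \<in> S \<or> b \<in> S \<and> c \<in> S}"
    using dist by auto
  have tri_formula: "decomposition_sum a b c d e T T (squarefree_ideal ?U3) = J" if "{S. a \<in> S \<and> b \<in> S \<and> (c \<in> S \<or> d \<in> S \<or> e \<in> S)} \<union>
      {S \<in> upgen triangle_cde. a \<in> S} \<union> {S \<in> upgen triangle_cde. b \<in> S} \<union> ?U3 = upgen B"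
  proof -
    note decomposition_formula[OF U3, of triangle_cde triangle_cde, folded T_def]
    then show ?thesis unfolding that J by simp
  qed
  have T_case: "\<exists>J1 J2 J3. SCM_decomposition J a b c d e J1 J2 J3"
    if "{S. a \<in> S \<and> b \<in> S \<and> (c \<in> S \<or> d \<in> S \<or> e \<in> S)} \<union>
      {S \<in> upgen triangle_cde. a \<in> S} \<union> {S \<in> upgen triangle_cde. b \<in> S} \<union> ?U3 = upgen B"
  proof -
    have "squarefree_ideal ?U3 \<subseteq> T"
      unfolding T_def upgen_triangle by (rule squarefree_ideal_mono) auto
    then have "SCM_decomposition J a b c d e T T (squarefree_ideal ?U3)"
      unfolding SCM_decomposition_def avoiding_bases
      using T tri_formula[OF that] by simp
    then show ?thesis by blast
  qed
  consider (uniform) "upgen B = large 3" | (pair) "upgen B = {S. a \<in> S \<or> b \<in> S} \<inter> large 3"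
    | (triple) "upgen B = {S. a \<in> S \<and> b \<in> S \<or> a \<in> S \<and> c \<in> S \<or> b \<in> S \<and> c \<in> S} \<inter> large 3"
    using assms by blast
  then show ?thesis
  proof cases
    case uniform
    have "{c, d, e} \<in> upgen B" unfolding uniform by (rule cde(1))
    then have U3e: "?U3 = {S. {c, d, e} \<subseteq> S}" by (rule if_P)
    show ?thesis by (rule T_case, subst U3e, subst shape_triangle, rule uniform[symmetric])
  next
    case pair
    have "{c, d, e} \<notin> upgen B" unfolding pair using cde(2) by blast
    then have U3e: "?U3 = {}" by (rule if_not_P)
    show ?thesis by (rule T_case, subst U3e, subst shape_triangle_pair, rule pair[symmetric])
  next
    case triple
    have "{c, d, e} \<notin> upgen B" unfolding triple using cde(3) by blast
    then have U3e: "?U3 = {}" by (rule if_not_P)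
    have "J = decomposition_sum a b c d e R R (squarefree_ideal {})"
      unfolding R_def J triple shape_star[symmetric]
      by (rule decomposition_formula[symmetric]) (auto simp: upset_def)
    then have "SCM_decomposition J a b c d e R R {0}"
      unfolding SCM_decomposition_def avoiding_bases U3e squarefree_ideal_empty
      using R tideal_0[OF tideal_squarefree_ideal[OF upset_upgen]] by (simp add: R_def)
    then show ?thesis by blast
  qed
qed

text \<open>Degree, support and gcd determine the two ideals of degree two: gcd one leaves the
  triangle, gcd \<open>pvar c\<close> the star at \<open>c\<close>. So \<open>J\<close> is one of
  the three ideals with a known filtration.\<close>

lemma decomposition_imp_SCM:
  assumes "SCM_decomposition J a b c d e J1 J2 J3"
  shows "SCM_ideal J"
proof -
  have formula: "J = decomposition_sum a b c d e J1 J2 J3"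
    and m: "matroidal 2 J1" "matroidal 2 J2" and supp: "ideal_supp J1 = {c, d, e}" "ideal_supp J2 = {c, d, e}"
    and J3: "J3 = squarefree_ideal (if {c, d, e} \<in> upgen B then {S. {c, d, e} \<subseteq> S} else {})"
    and gcd: "ideal_gcd J1 = 1 \<and> ideal_gcd J2 = 1 \<or>
      ideal_gcd J1 = pvar c \<and> ideal_gcd J2 = pvar c \<and> J3 = {0}"
    using assms unfolding SCM_decomposition_def avoiding_bases by blast+
  have tri: "distinct [c, d, e]" using dist by simp
  have cls: "(ideal_gcd I = 1 \<longrightarrow> I = squarefree_ideal (upgen triangle_cde)) \<and>
      (ideal_gcd I = pvar c \<longrightarrow> I = squarefree_ideal (upgen star_cde))"
    if I: "matroidal 2 I" "ideal_supp I = {c, d, e}" for I :: "('v, 'k) mpol set"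
  proof -
    obtain A where A: "matroid_bases 2 A" "I = squarefree_ideal (upgen A)" "min_gens I = sqfree_exp ` A"
      using I(1) by (rule matroidalE)
    have supp: "\<Union>A = {c, d, e}" using ideal_supp_sqfree[OF A(3)] I(2) by simp
    then have "A \<noteq> {}" by auto
    then have g: "ideal_gcd I = monomial (sqfree_exp (\<Inter>A))" by (rule ideal_gcd_sqfree[OF A(3)])
    have card: "card S = 2" if "S \<in> A" for S using A(1) that by (simp add: matroid_bases_def)
    show ?thesis
    proof (intro conjI impI)
      assume "ideal_gcd I = 1"
      then have "\<Inter>A = {}" unfolding g monomial_sqfree_eq_1 .
      then have "A = triangle_cde" by (rule cycle_graph_cases(1)[OF tri card supp, rotated])
      then show "I = squarefree_ideal (upgen triangle_cde)" using A(2) by simp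
    next
      assume "ideal_gcd I = pvar c"
      then have "\<Inter>A = {c}" unfolding g monomial_sqfree_eq_pvar .
      then have "A = star_cde" by (rule cycle_graph_cases(2)[OF tri card supp, rotated])
      then show "I = squarefree_ideal (upgen star_cde)" using A(2) by simp
    qed
  qed
  from gcd show ?thesis
  proof
    assume g: "ideal_gcd J1 = 1 \<and> ideal_gcd J2 = 1"
    let ?U3 = "if {c, d, e} \<in> upgen B then {S. {c, d, e} \<subseteq> S} else {}"
    have U3: "upset ?U3" by (auto simp: upset_def)
    have J12: "J1 = squarefree_ideal (upgen triangle_cde)" "J2 = squarefree_ideal (upgen triangle_cde)"
      using cls[OF m(1) supp(1)] cls[OF m(2) supp(2)] g by blast+
    have "J = squarefree_ideal ({S. a \<in> S \<and> b \<in> S \<and> (c \<in> S \<or> d \<in> S \<or> e \<in> S)} \<union>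
      {S \<in> upgen triangle_cde. a \<in> S} \<union> {S \<in> upgen triangle_cde. b \<in> S} \<union> ?U3)"
      unfolding formula J12 J3 by (rule decomposition_formula[OF U3]) auto
    then consider "J = squarefree_ideal (large 3)" | "J = squarefree_ideal ({S. a \<in> S \<or> b \<in> S} \<inter> large 3)"
      using shape_triangle shape_triangle_pair by (cases "{c, d, e} \<in> upgen B") simp_all
    then show ?thesis
      using SCM_uniform[OF dist univ, where ?'k = 'k] SCM_large_meets_ab[OF dist univ, where ?'k = 'k]
      by cases simp_all
  next
    assume g: "ideal_gcd J1 = pvar c \<and> ideal_gcd J2 = pvar c \<and> J3 = {0}"
    have J12: "J1 = squarefree_ideal (upgen star_cde)" "J2 = squarefree_ideal (upgen star_cde)"
      using cls[OF m(1) supp(1)] cls[OF m(2) supp(2)] g by blast+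
    have J3': "J3 = squarefree_ideal {}" using g by (simp add: squarefree_ideal_empty)
    have "J = squarefree_ideal ({S. a \<in> S \<and> b \<in> S \<or> a \<in> S \<and> c \<in> S \<or> b \<in> S \<and> c \<in> S} \<inter> large 3)"
      unfolding formula J12 J3' shape_star[symmetric]
      by (rule decomposition_formula) (auto simp: upset_def)
    then show ?thesis using SCM_large_two_of_abc[OF dist univ, where ?'k = 'k] by simp
  qed
qed

end

theorem proposition4p9:
  fixes J :: "(5, 'k::field) mpol set"
  assumes "matroidal 3 J"
    and "ideal_supp J = UNIV"
    and "ideal_gcd J = 1"
  shows "SCM_ideal J \<longleftrightarrow>
    (\<exists>(y :: 5 \<Rightarrow> 5) J1 J2 J3. bij y \<and>
       J = (pvar (y 1) * pvar (y 2))
              <#\<^bsub>mpol_ring\<^esub> (Idl\<^bsub>mpol_ring\<^esub> {pvar (y 3), pvar (y 4), pvar (y 5)})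
           <+>\<^bsub>mpol_ring\<^esub> (pvar (y 1) <#\<^bsub>mpol_ring\<^esub> J1)
           <+>\<^bsub>mpol_ring\<^esub> (pvar (y 2) <#\<^bsub>mpol_ring\<^esub> J2)
           <+>\<^bsub>mpol_ring\<^esub> J3 \<and>
       matroidal 2 J1 \<and> SCM_ideal J1 \<and> ideal_supp J1 = {y 3, y 4, y 5} \<and>
       matroidal 2 J2 \<and> SCM_ideal J2 \<and> ideal_supp J2 = {y 3, y 4, y 5} \<and>
       J3 = Idl\<^bsub>mpol_ring\<^esub> (monomial ` {u \<in> min_gens J.
              \<not> (pvar (y 1) :: (5, 'k) mpol) dvd monomial u \<and>
              \<not> (pvar (y 2) :: (5, 'k) mpol) dvd monomial u}) \<and>
       J3 \<subseteq> J1 \<inter> J2 \<and>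
       ((ideal_gcd J1 = 1 \<and> ideal_gcd J2 = 1) \<or>
        (ideal_gcd J1 = pvar (y 3) \<and> ideal_gcd J2 = pvar (y 3) \<and> J3 = {0})))"
  unfolding SCM_decomposition_def[symmetric]
proof -
  obtain B where B: "matroid_bases 3 B" and J: "J = squarefree_ideal (upgen B)"
    and gens: "min_gens J = sqfree_exp ` B"
    using assms(1) by (rule matroidalE)
  have loops: "\<Union>B = UNIV" using ideal_supp_sqfree[OF gens] assms(2) by simp
  then have "B \<noteq> {}" by auto
  then have coloops: "\<Inter>B = {}"
    using ideal_gcd_sqfree[OF gens] assms(3) by (simp add: monomial_sqfree_eq_1)
  have card: "card (UNIV :: 5 set) = 5" by simp
  note cases = rank_three_matroid_cases[OF B card loops coloops]
  show "SCM_ideal J \<longleftrightarrow>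
    (\<exists>(y :: 5 \<Rightarrow> 5) J1 J2 J3. bij y \<and> SCM_decomposition J (y 1) (y 2) (y 3) (y 4) (y 5) J1 J2 J3)"
  proof
    assume SCM: "SCM_ideal J"
    from cases(2) show "\<exists>(y :: 5 \<Rightarrow> 5) J1 J2 J3. bij y \<and>
        SCM_decomposition J (y 1) (y 2) (y 3) (y 4) (y 5) J1 J2 J3"
    proof
      assume "\<exists>a b c d t. distinct [a, b, c, d, t] \<and> UNIV = {a, b, c, d, t} \<and>
        {{t, a, c}, {t, a, d}, {t, b, c}, {t, b, d}} \<subseteq> B \<and> - {a, b} \<notin> B \<and> - {c, d} \<notin> B"
      then obtain a b c d t where dist: "distinct [a, b, c, d, t]" and univ: "UNIV = {a, b, c, d, t}"
        and t: "{t, a, c} \<in> B" "{t, a, d} \<in> B" "{t, b, c} \<in> B" "{t, b, d} \<in> B"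
        and nB: "- {a, b} \<notin> B" "- {c, d} \<notin> B" by auto
      have sub: "S \<in> B \<Longrightarrow> S \<in> upgen B" for S by (auto simp: upgen_def)
      have c3: "- {x, y} \<in> upgen B \<longleftrightarrow> - {x, y} \<in> B" if "x \<noteq> y" for x y
        by (rule upgen_card[of B 3])
          (use B that card in \<open>auto simp: matroid_bases_def Compl_eq_Diff_UNIV card_Diff_subset\<close>)
      have "- {a, b} \<notin> upgen B" "- {c, d} \<notin> upgen B" using c3 nB dist by auto
      then have "\<not> SCM_ideal J"
        unfolding J by (intro not_SCM_ideal[OF dist univ upset_upgen _ _ _ _ _ _ cases(1)] sub t)
      then show ?thesis using SCM by contradiction
    next
      assume "\<exists>a b c d e. distinct [a, b, c, d, e] \<and> UNIV = {a, b, c, d, e} \<and>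
        (upgen B = large 3 \<or> upgen B = {S. a \<in> S \<or> b \<in> S} \<inter> large 3 \<or>
         upgen B = {S. a \<in> S \<and> b \<in> S \<or> a \<in> S \<and> c \<in> S \<or> b \<in> S \<and> c \<in> S} \<inter> large 3)"
      then obtain a b c d e :: 5 where dist: "distinct [a, b, c, d, e]" and univ: "UNIV = {a, b, c, d, e}"
        and shape: "upgen B = large 3 \<or> upgen B = {S. a \<in> S \<or> b \<in> S} \<inter> large 3 \<or>
         upgen B = {S. a \<in> S \<and> b \<in> S \<or> a \<in> S \<and> c \<in> S \<or> b \<in> S \<and> c \<in> S} \<inter> large 3"
        by blast
      obtain J1 J2 J3 where dec: "SCM_decomposition J a b c d e J1 J2 J3"
        using shape_imp_decomposition[OF dist univ B J gens shape] by blast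
      \<comment> \<open>The last branch serves the index \<open>5\<close>, which in the type of five
        elements is the number \<open>0\<close>.\<close>
      define y :: "5 \<Rightarrow> 5" where "y i = (if i = 1 then a else if i = 2 then b else if i = 3 then c
        else if i = 4 then d else e)" for i
      have y: "y 1 = a" "y 2 = b" "y 3 = c" "y 4 = d" "y 5 = e" by (simp_all add: y_def)
      have "{a, b, c, d, e} \<subseteq> range y" unfolding y[symmetric] by blast
      then have "surj y" using univ by auto
      then have "bij y" by (simp add: bij_def finite_UNIV_surj_inj)
      then show ?thesis using dec by (intro exI[of _ y]) (auto simp: y)
    qed
  next
    assume "\<exists>(y :: 5 \<Rightarrow> 5) J1 J2 J3. bij y \<and>
        SCM_decomposition J (y 1) (y 2) (y 3) (y 4) (y 5) J1 J2 J3"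
    then obtain y :: "5 \<Rightarrow> 5" and J1 J2 J3 where y: "bij y"
      and dec: "SCM_decomposition J (y 1) (y 2) (y 3) (y 4) (y 5) J1 J2 J3" by blast
    have "distinct (map y [1, 2, 3, 4, 5])"
      using UNIV_5(1) y by (simp only: distinct_map) (meson bij_is_inj inj_on_subset subset_UNIV)
    moreover have "UNIV = y ` {1, 2, 3, 4, 5}" using y UNIV_5(2) by (metis bij_is_surj)
    ultimately show "SCM_ideal J"
      using decomposition_imp_SCM[OF _ _ B J gens dec] by simp
  qed
qed

end
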